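(* Let $G$ be a polycyclic group acting properly on a CAT(0) cube complex. Then $G$ is virtually free abelian.
   Context: CAT(0) cube complexes may be infinite-dimensional, and groups act on them by cubical automorphisms. A group is polycyclic if it is solvable and all its subgroups are finitely generated. Properness of the action is understood in the usual sense; in particular, stabilisers of vertices and of cubes are finite. Virtually free abelian means having a finite-index subgroup that is free abelian (possibly trivial). *)

theory Defs
  imports
    "HOL-Analysis.Analysis"
    "HOL-Algebra.Group_Action"
    "HOL-Algebra.Solvable_Groups"
    "HOL-Algebra.Free_Abelian_Groups"
begin

section \<open>Euclidean unit cubes\<close>

text \<open>
  As in \<^const>\<open>Euclidean_space\<close>, a point of n-space is a function on the natural numbers that
  vanishes from index n on.
\<close>

definition unit_cube :: "nat \<Rightarrow> (nat \<Rightarrow> real) set" where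
  "unit_cube n = {x. (\<forall>i<n. 0 \<le> x i \<and> x i \<le> 1) \<and> (\<forall>i\<ge>n. x i = 0)}"

definition open_cube :: "nat \<Rightarrow> (nat \<Rightarrow> real) set" where
  "open_cube n = {x. (\<forall>i<n. 0 < x i \<and> x i < 1) \<and> (\<forall>i\<ge>n. x i = 0)}"

definition cube_corners :: "nat \<Rightarrow> (nat \<Rightarrow> real) set" where
  "cube_corners n = {x \<in> unit_cube n. \<forall>i<n. x i = 0 \<or> x i = 1}"

definition cube_topology :: "nat \<Rightarrow> (nat \<Rightarrow> real) topology" where
  "cube_topology n = subtopology (Euclidean_space n) (unit_cube n)"

text \<open>The cube itself counts as a face (take the index set empty).\<close>

definition cube_faces :: "nat \<Rightarrow> (nat \<Rightarrow> real) set set" where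
  "cube_faces n =
     {{x \<in> unit_cube n. \<forall>i\<in>I. x i = \<epsilon> i} | I \<epsilon>. I \<subseteq> {..<n} \<and> \<epsilon> \<in> I \<rightarrow> {0, 1}}"

definition cube_isometry ::
    "nat \<Rightarrow> (nat \<Rightarrow> real) set \<Rightarrow> nat \<Rightarrow> (nat \<Rightarrow> real) set \<Rightarrow> ((nat \<Rightarrow> real) \<Rightarrow> nat \<Rightarrow> real) \<Rightarrow> bool"
  where
  "cube_isometry m A n B h \<longleftrightarrow>
     bij_betw h A B \<and>
     (\<forall>x\<in>A. \<forall>y\<in>A. L2_set (\<lambda>i. h x i - h y i) {..<n} = L2_set (\<lambda>i. x i - y i) {..<m})"


section \<open>Cube complexes\<close>

text \<open>
  A cube complex is a CW complex obtained by gluing cubes of arbitrary finite dimensions by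
  isometries along their faces. It is given by its set of points, its cells, and for each cell a
  dimension and a characteristic map from the unit cube of that dimension. The conditions say that
  the complex is the disjoint union of the images of the open cubes, on which characteristic maps
  are injective, and that the restriction of a characteristic map to a face is again a
  characteristic map, up to an isometric parametrisation of that face. Neither embeddedness of
  the closed cubes, nor local finiteness, nor a bound on the dimensions is required.
\<close>

record ('a, 'c) cube_structure =
  points :: "'a set"
  cells :: "'c set"
  cell_dim :: "'c \<Rightarrow> nat"
  char_map :: "'c \<Rightarrow> (nat \<Rightarrow> real) \<Rightarrow> 'a"

definition cube_complex :: "('a, 'c) cube_structure \<Rightarrow> bool" where
  "cube_complex K \<longleftrightarrow>
     (\<forall>e\<in>cells K. char_map K e \<in> unit_cube (cell_dim K e) \<rightarrow> points K) \<and>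
     bij_betw (\<lambda>(e, y). char_map K e y) (SIGMA e:cells K. open_cube (cell_dim K e)) (points K) \<and>
     (\<forall>e\<in>cells K. \<forall>F\<in>cube_faces (cell_dim K e).
        \<exists>f\<in>cells K. \<exists>h. cube_isometry (cell_dim K f) (unit_cube (cell_dim K f)) (cell_dim K e) F h \<and>
          (\<forall>y\<in>unit_cube (cell_dim K f). char_map K e (h y) = char_map K f y))"

text \<open>The weak (CW) topology.\<close>

definition complex_topology :: "('a, 'c) cube_structure \<Rightarrow> 'a topology" where
  "complex_topology K = topology (\<lambda>U. U \<subseteq> points K \<and>
     (\<forall>e\<in>cells K. openin (cube_topology (cell_dim K e))
        {y \<in> unit_cube (cell_dim K e). char_map K e y \<in> U}))"

lemma topspace_cube_topology: "topspace (cube_topology n) = unit_cube n"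
  by (auto simp: cube_topology_def topspace_Euclidean_space unit_cube_def)

lemma openin_complex_topology:
  "openin (complex_topology K) U \<longleftrightarrow> U \<subseteq> points K \<and>
     (\<forall>e\<in>cells K. openin (cube_topology (cell_dim K e))
        {y \<in> unit_cube (cell_dim K e). char_map K e y \<in> U})"
proof -
  have "istopology (\<lambda>U. U \<subseteq> points K \<and>
     (\<forall>e\<in>cells K. openin (cube_topology (cell_dim K e))
        {y \<in> unit_cube (cell_dim K e). char_map K e y \<in> U}))"
    unfolding istopology_def
  proof (intro conjI allI impI ballI; (elim conjE)?)
    fix S T e
    assume "\<forall>e\<in>cells K. openin (cube_topology (cell_dim K e))
          {y \<in> unit_cube (cell_dim K e). char_map K e y \<in> S}"
      and "\<forall>e\<in>cells K. openin (cube_topology (cell_dim K e))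
          {y \<in> unit_cube (cell_dim K e). char_map K e y \<in> T}"
      and "e \<in> cells K"
    moreover have "{y \<in> unit_cube (cell_dim K e). char_map K e y \<in> S \<inter> T} =
        {y \<in> unit_cube (cell_dim K e). char_map K e y \<in> S} \<inter>
        {y \<in> unit_cube (cell_dim K e). char_map K e y \<in> T}"
      by blast
    ultimately show "openin (cube_topology (cell_dim K e))
        {y \<in> unit_cube (cell_dim K e). char_map K e y \<in> S \<inter> T}"
      by (simp add: openin_Int)
  next
    fix \<U> e
    assume *: "\<forall>U\<in>\<U>. U \<subseteq> points K \<and> (\<forall>e\<in>cells K. openin (cube_topology (cell_dim K e))
          {y \<in> unit_cube (cell_dim K e). char_map K e y \<in> U})"
      and "e \<in> cells K"
    have "{y \<in> unit_cube (cell_dim K e). char_map K e y \<in> \<Union>\<U>} =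
        (\<Union>U\<in>\<U>. {y \<in> unit_cube (cell_dim K e). char_map K e y \<in> U})"
      by blast
    then show "openin (cube_topology (cell_dim K e))
        {y \<in> unit_cube (cell_dim K e). char_map K e y \<in> \<Union>\<U>}"
      using * \<open>e \<in> cells K\<close> by auto
  qed blast+
  then show ?thesis
    by (simp add: complex_topology_def topology_inverse')
qed

lemma topspace_complex_topology:
  assumes "cube_complex K"
  shows "topspace (complex_topology K) = points K"
proof (rule antisym)
  show "topspace (complex_topology K) \<subseteq> points K"
    using openin_complex_topology[of K "topspace (complex_topology K)"] by simp
  have "{y \<in> unit_cube (cell_dim K e). char_map K e y \<in> points K} =
      topspace (cube_topology (cell_dim K e))" if "e \<in> cells K" for e
    using assms that by (auto simp: cube_complex_def topspace_cube_topology)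
  then have "openin (complex_topology K) (points K)"
    by (simp add: openin_complex_topology)
  then show "points K \<subseteq> topspace (complex_topology K)"
    by (rule openin_subset)
qed


section \<open>Links and CAT(0) cube complexes\<close>

definition vertices :: "('a, 'c) cube_structure \<Rightarrow> 'a set" where
  "vertices K = {char_map K v (\<lambda>_. 0) | v. v \<in> cells K \<and> cell_dim K v = 0}"

text \<open>
  A vertex of the link of x is an end of an edge at x. It is represented by that edge parametrised
  by unit speed and starting from x, so that a loop at x gives two vertices of the link. The
  simplices of the link of x are the corners of cubes at x; the vertices of such a simplex are
  the edges of the cube that leave the corner, one for each coordinate direction. The vertex cell
  itself gives the empty simplex.
\<close>

definition corners_at :: "('a, 'c) cube_structure \<Rightarrow> 'a \<Rightarrow> ('c \<times> (nat \<Rightarrow> real)) set" where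
  "corners_at K x =
     {(e, c). e \<in> cells K \<and> c \<in> cube_corners (cell_dim K e) \<and> char_map K e c = x}"

definition corner_edge ::
    "('a, 'c) cube_structure \<Rightarrow> 'c \<times> (nat \<Rightarrow> real) \<Rightarrow> nat \<Rightarrow> (real \<Rightarrow> 'a)" where
  "corner_edge K = (\<lambda>(e, c) i. \<lambda>t\<in>{0..1}. char_map K e (c(i := \<bar>c i - t\<bar>)))"

definition corner_simplex ::
    "('a, 'c) cube_structure \<Rightarrow> 'c \<times> (nat \<Rightarrow> real) \<Rightarrow> (real \<Rightarrow> 'a) set" where
  "corner_simplex K p = corner_edge K p ` {..<cell_dim K (fst p)}"

text \<open>
  The link is simplicial if every simplex has pairwise distinct vertices and is determined by its
  set of vertices.
\<close>

definition simplicial_link :: "('a, 'c) cube_structure \<Rightarrow> 'a \<Rightarrow> bool" where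
  "simplicial_link K x \<longleftrightarrow>
     (\<forall>p\<in>corners_at K x. inj_on (corner_edge K p) {..<cell_dim K (fst p)}) \<and>
     inj_on (corner_simplex K) (corners_at K x)"

text \<open>A simplicial complex, given by the vertex sets of its simplices, is flag if any finite set of
  pairwise adjacent vertices spans a simplex.\<close>

definition flag :: "'v set set \<Rightarrow> bool" where
  "flag \<S> \<longleftrightarrow>
     (\<forall>V. finite V \<and> V \<subseteq> \<Union>\<S> \<and> (\<forall>a\<in>V. \<forall>b\<in>V. a \<noteq> b \<longrightarrow> {a, b} \<in> \<S>) \<longrightarrow> V \<in> \<S>)"

definition nonpositively_curved :: "('a, 'c) cube_structure \<Rightarrow> bool" where
  "nonpositively_curved K \<longleftrightarrow>
     (\<forall>x\<in>vertices K. simplicial_link K x \<and> flag (corner_simplex K ` corners_at K x))"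

text \<open>Simply connected spaces are nonempty by convention; otherwise every group would act properly
  on a CAT(0) cube complex, namely the empty one.\<close>

definition simply_connected_space :: "'a topology \<Rightarrow> bool" where
  "simply_connected_space X \<longleftrightarrow>
     topspace X \<noteq> {} \<and> path_connected_space X \<and>
     (\<forall>\<gamma>. pathin X \<gamma> \<and> \<gamma> 0 = \<gamma> 1 \<longrightarrow>
        homotopic_with (\<lambda>\<delta>. \<delta> 0 = \<gamma> 0 \<and> \<delta> 1 = \<gamma> 0) (top_of_set {0..1}) X \<gamma> (\<lambda>_. \<gamma> 0))"

definition CAT0_cube_complex :: "('a, 'c) cube_structure \<Rightarrow> bool" where
  "CAT0_cube_complex K \<longleftrightarrow>
     cube_complex K \<and> nonpositively_curved K \<and> simply_connected_space (complex_topology K)"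


section \<open>Actions on cube complexes\<close>

definition cubical_automorphism :: "('a, 'c) cube_structure \<Rightarrow> ('a \<Rightarrow> 'a) \<Rightarrow> bool" where
  "cubical_automorphism K \<psi> \<longleftrightarrow>
     bij_betw \<psi> (points K) (points K) \<and>
     (\<forall>e\<in>cells K. \<exists>f\<in>cells K. \<exists>h.
        cube_isometry (cell_dim K e) (unit_cube (cell_dim K e))
                      (cell_dim K f) (unit_cube (cell_dim K f)) h \<and>
        (\<forall>y\<in>unit_cube (cell_dim K e). \<psi> (char_map K e y) = char_map K f (h y)))"

definition cubical_action ::
    "('g, 'm) monoid_scheme \<Rightarrow> ('a, 'c) cube_structure \<Rightarrow> ('g \<Rightarrow> 'a \<Rightarrow> 'a) \<Rightarrow> bool" where
  "cubical_action G K \<phi> \<longleftrightarrow>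
     group_action G (points K) \<phi> \<and> (\<forall>g\<in>carrier G. cubical_automorphism K (\<phi> g))"

text \<open>
  Properness of the action of a discrete group. For cubical actions this is, with respect to the
  weak topology, the same as finiteness of all stabilisers of vertices, and it is implied by metric
  properness.
\<close>

definition proper_action ::
    "('g, 'm) monoid_scheme \<Rightarrow> 'a topology \<Rightarrow> ('g \<Rightarrow> 'a \<Rightarrow> 'a) \<Rightarrow> bool" where
  "proper_action G X \<phi> \<longleftrightarrow>
     (\<forall>C. compactin X C \<longrightarrow> finite {g \<in> carrier G. \<phi> g ` C \<inter> C \<noteq> {}})"

lemma proper_action_finite_stabilizer:
  assumes "proper_action G X \<phi>" "x \<in> topspace X"
  shows "finite (stabilizer G \<phi> x)"
proof -
  have "compactin X {x}"
    using assms(2) by simp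
  then have "finite {g \<in> carrier G. \<phi> g ` {x} \<inter> {x} \<noteq> {}}"
    using assms(1) unfolding proper_action_def by blast
  then show ?thesis
    by (rule rev_finite_subset) (auto simp: stabilizer_def)
qed


section \<open>Classes of groups\<close>

definition polycyclic :: "('g, 'm) monoid_scheme \<Rightarrow> bool" where
  "polycyclic G \<longleftrightarrow>
     group G \<and> solvable G \<and>
     (\<forall>H. subgroup H G \<longrightarrow> (\<exists>S. finite S \<and> S \<subseteq> carrier G \<and> generate G S = H))"

text \<open>A basis of a subgroup injects into the subgroup, so bases among the subsets of the type of
  group elements suffice; the rank is arbitrary.\<close>

definition virtually_free_abelian :: "('g, 'm) monoid_scheme \<Rightarrow> bool" where
  "virtually_free_abelian G \<longleftrightarrow>
     (\<exists>H. subgroup H G \<and> finite (rcosets\<^bsub>G\<^esub> H) \<and>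
          (\<exists>B :: 'g set. G\<lparr>carrier := H\<rparr> \<cong> free_Abelian_group B))"

end

theory Submission
  imports Defs
begin

text \<open>
  Edge paths without backtracking, taken up to exchanging two sides of a square for the opposite
  two, form the fibres of a local system on the vertices, since by the link condition three squares
  around a corner bound a cube. A local system on the vertices extends over the open cells, and
  paths and homotopies lift. As the complex is simply connected, any two reduced paths with the
  same end points thus differ by exchanges of squares. Hence the vertices form a median graph,
  whose half-spaces are the walls. If the number of walls between x and the translate of x under
  the n-th power of g is less than n for some n, then some positive power of g fixes the median of
  three points of the orbit of x, so that g has finite order because the action is proper.

  So every element of infinite order is undistorted for the length l of G given by the walls. On a
  normal free abelian subgroup A of finite rank, l controls the exponents, so the conjugacy classes
  in A are finite and a subgroup of finite index centralises A. If a commutator z of g and h is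
  central, then z to the power n * n is the commutator of the n-th powers of g and h and has length
  O(n), so z has finite order. Induction along a solvable series shows that G is virtually abelian.
\<close>

text \<open>The complex may be infinite-dimensional, so the proof uses no axes and no CAT(0) metric;
  a group element is studied only through the half-spaces that it permutes. Up to translation,
  finitely many half-spaces cut the orbit of x under g. Those that no power of g preserves have
  limits at both ends of the orbit. Different limits force linear growth. Equal limits mean that
  such a half-space deviates from its limit only on a window of bounded length; of three widely
  spaced orbit points at most one falls into it, so a majority vote ignores it.

  Undistorted cyclic subgroups do not at once control an abelian group, since a product might be far
  shorter than its exponents suggest. But the lower bound n for the length of n-th powers is
  uniform, so no element of infinite order has stable length below 1, and Dirichlet approximation
  turns this gap into bounds on exponents. Stable length replaces length because conjugation
  preserves it.

  Local systems stand in for covering spaces: fibres and transport suffice, and no covering complex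
  is built.\<close>

section \<open>Edge paths in square complexes\<close>

text \<open>\<open>Sq x a y b\<close> records the two ways round a square from one corner to the
  opposite one: \<open>x\<close> then \<open>a\<close>, or \<open>y\<close> then \<open>b\<close>.
  \<open>Sq_rot\<close> views the same square from the far end of \<open>x\<close>. In
  \<open>Sq_cube\<close>, \<open>yx\<close> is the edge parallel to \<open>y\<close> that starts
  where \<open>x\<close> ends, and so on; this axiom carries the flag condition for three
  directions.\<close>

locale square_complex =
  fixes E :: "'e set" and src tgt :: "'e \<Rightarrow> 'v" and rev_edge :: "'e \<Rightarrow> 'e"
    and Sq :: "'e \<Rightarrow> 'e \<Rightarrow> 'e \<Rightarrow> 'e \<Rightarrow> bool"
  assumes rev_in: "a \<in> E \<Longrightarrow> rev_edge a \<in> E"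
    and rev_rev: "rev_edge (rev_edge a) = a"
    and src_rev: "a \<in> E \<Longrightarrow> src (rev_edge a) = tgt a"
    and Sq_in: "Sq x a y b \<Longrightarrow> x \<in> E" "Sq x a y b \<Longrightarrow> a \<in> E"
    and Sq_src: "Sq x a y b \<Longrightarrow> src x = src y"
    and Sq_mid: "Sq x a y b \<Longrightarrow> tgt x = src a"
    and Sq_tgt: "Sq x a y b \<Longrightarrow> tgt a = tgt b"
    and Sq_sym: "Sq x a y b \<Longrightarrow> Sq y b x a"
    and Sq_rot: "Sq x a y b \<Longrightarrow> Sq (rev_edge x) y a (rev_edge b)"
    and Sq_neq: "Sq x a y b \<Longrightarrow> x \<noteq> y"
    and Sq_unique: "Sq x a y b \<Longrightarrow> Sq x a' y b' \<Longrightarrow> a = a' \<and> b = b'"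
    and Sq_cube: "Sq x yx y xy \<Longrightarrow> Sq x zx z xz \<Longrightarrow> Sq y zy z yz \<Longrightarrow>
      \<exists>zxy yxz xyz. Sq yx zxy zx yxz \<and> Sq xy zxy zy xyz \<and> Sq xz yxz yz xyz"
begin

lemma tgt_rev: "a \<in> E \<Longrightarrow> tgt (rev_edge a) = src a"
  using src_rev[OF rev_in, of a] rev_rev by simp

lemma Sq_turn: "Sq x a y b \<Longrightarrow> Sq (rev_edge a) (rev_edge x) (rev_edge b) (rev_edge y)"
  using Sq_rot[OF Sq_sym[OF Sq_rot]] rev_rev by (metis Sq_rot Sq_sym)

text \<open>Edge paths are lists of oriented edges with the last edge at the head.\<close>

primrec path :: "'v \<Rightarrow> 'e list \<Rightarrow> 'v \<Rightarrow> bool" where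
  "path u [] v \<longleftrightarrow> u = v"
| "path u (a # p) v \<longleftrightarrow> a \<in> E \<and> tgt a = v \<and> path u p (src a)"

lemma path_append: "path u p v \<Longrightarrow> path v q w \<Longrightarrow> path u (q @ p) w"
  by (induction q arbitrary: w) auto

lemma path_rev: "path u p v \<Longrightarrow> path v (rev (map rev_edge p)) u"
proof (induction p arbitrary: v)
  case (Cons a p)
  then have "path v [rev_edge a] (src a)" using tgt_rev src_rev rev_in by auto
  moreover have "path (src a) (rev (map rev_edge p)) u" using Cons by auto
  ultimately show ?case using path_append by fastforce
qed simp

inductive swap :: "'e list \<Rightarrow> 'e list \<Rightarrow> bool" where
  swap_here: "Sq x a y b \<Longrightarrow> swap (a # x # p) (b # y # p)"
| swap_Cons: "swap p q \<Longrightarrow> swap (c # p) (c # q)"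

abbreviation swaps (infix "\<simeq>" 50) where "p \<simeq> q \<equiv> swap\<^sup>*\<^sup>* p q"

lemma swap_sym: "swap p q \<Longrightarrow> swap q p"
  by (induction rule: swap.induct) (auto intro: swap.intros Sq_sym)

lemma swaps_sym: "p \<simeq> q \<Longrightarrow> q \<simeq> p"
proof (induction rule: rtranclp_induct)
  case (step y z)
  then show ?case by (meson converse_rtranclp_into_rtranclp swap_sym)
qed simp

lemma swaps_trans [trans]: "p \<simeq> q \<Longrightarrow> q \<simeq> r \<Longrightarrow> p \<simeq> r"
  by (rule rtranclp_trans)

lemma swaps_Cons: "p \<simeq> q \<Longrightarrow> c # p \<simeq> c # q"
proof (induction rule: rtranclp_induct)
  case (step y z)
  then show ?case by (meson rtranclp.rtrancl_into_rtrancl swap_Cons)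
qed simp

lemma swaps_here: "Sq x a y b \<Longrightarrow> a # x # p \<simeq> b # y # p"
  by (simp add: swap_here r_into_rtranclp)

lemma swap_length: "swap p q \<Longrightarrow> length p = length q"
  by (induction rule: swap.induct) auto

lemma swaps_length: "p \<simeq> q \<Longrightarrow> length p = length q"
  by (induction rule: rtranclp_induct) (auto dest: swap_length)

lemma swap_path: "swap p q \<Longrightarrow> path u p v \<Longrightarrow> path u q v"
proof (induction arbitrary: v rule: swap.induct)
  case (swap_here x a y b p)
  then show ?case
    using Sq_in[of x a y b] Sq_in[OF Sq_sym, of x a y b] Sq_src Sq_mid[OF Sq_sym, of x a y b]
      Sq_tgt[of x a y b] Sq_src[of x a y b] by auto
qed auto

lemma swaps_path: "p \<simeq> q \<Longrightarrow> path u p v \<Longrightarrow> path u q v"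
  by (induction rule: rtranclp_induct) (auto dest: swap_path)

text \<open>The cube axiom makes swap equivalence behave like trace equivalence: the last edge of a
  path can be changed in at most one way up to a square.\<close>

lemma swaps_last:
  "a # p \<simeq> b # q \<Longrightarrow>
    (a = b \<and> p \<simeq> q) \<or> (\<exists>t x y. Sq x a y b \<and> p \<simeq> x # t \<and> q \<simeq> y # t)"
proof (induction "length p" arbitrary: a p b q rule: less_induct)
  case less
  have "case w of [] \<Rightarrow> False | b # q \<Rightarrow>
      (a = b \<and> p \<simeq> q) \<or> (\<exists>t x y. Sq x a y b \<and> p \<simeq> x # t \<and> q \<simeq> y # t)"
    if "a # p \<simeq> w" for w
    using that
  proof (induction rule: rtranclp_induct)
    case (step w w')
    obtain b q where w: "w = b # q" using step.IH by (cases w) auto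
    have IH: "(a = b \<and> p \<simeq> q) \<or> (\<exists>t x y. Sq x a y b \<and> p \<simeq> x # t \<and> q \<simeq> y # t)"
      using step.IH w by simp
    show ?case using step.hyps(2) unfolding w
    proof (cases rule: swap.cases)
      case (swap_Cons q')
      then have "q \<simeq> q'" by auto
      moreover have "w' = b # q'" using swap_Cons by auto
      moreover have "(a = b \<and> p \<simeq> q') \<or> (\<exists>t x y. Sq x a y b \<and> p \<simeq> x # t \<and> q' \<simeq> y # t)"
        using IH
      proof (elim disjE exE conjE)
        assume "a = b" "p \<simeq> q"
        then show ?thesis using \<open>q \<simeq> q'\<close> swaps_trans by blast
      next
        fix t x y assume "Sq x a y b" "p \<simeq> x # t" "q \<simeq> y # t"
        then show ?thesis using \<open>q \<simeq> q'\<close> swaps_trans swaps_sym by blast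
      qed
      ultimately show ?thesis by simp
    next
      case (swap_here y1 z1 c s)
      have sq1: "Sq y1 b z1 c" and q: "q = y1 # s" and w': "w' = c # z1 # s"
        using swap_here by auto
      show ?thesis using IH
      proof (elim disjE exE conjE)
        assume "a = b" "p \<simeq> q"
        then show ?thesis using sq1 q w' by auto
      next
        fix t x y assume *: "Sq x a y b" "p \<simeq> x # t" "q \<simeq> y # t"
        have len: "length s < length p"
          using swaps_length[OF step.hyps(1)] w q by simp
        \<comment> \<open>The rests below \<open>b\<close> are equivalent and shorter than
          \<open>p\<close>, so the outer induction compares their last edges \<open>y1\<close> and
          \<open>y\<close>.\<close>
        from *(3) q have "y1 # s \<simeq> y # t" by simp
        from less.hyps[OF len this] show ?thesis
        proof (elim disjE exE conjE)
          assume y: "y1 = y" "s \<simeq> t"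
          \<comment> \<open>Seen from the start of \<open>b\<close>, both squares span the same two
            edges, so they coincide and the new swap undoes the old one.\<close>
          have "Sq (rev_edge y) x b (rev_edge a)" "Sq (rev_edge y) z1 b (rev_edge c)"
            using Sq_rot[OF Sq_sym[OF *(1)]] Sq_rot[OF sq1] y by auto
          then have "x = z1" "rev_edge a = rev_edge c" using Sq_unique by blast+
          then have "x = z1" "a = c" using rev_rev by metis+
          then show ?thesis using w' y *(2) swaps_Cons[OF swaps_sym[OF y(2)]]
            by (auto intro: swaps_trans)
        next
          fix t' p2 p1 assume **: "Sq p2 y1 p1 y" "s \<simeq> p2 # t'" "t \<simeq> p1 # t'"
          \<comment> \<open>The reverses of \<open>y\<close> and \<open>y1\<close> and the edge
            \<open>b\<close> leave a common vertex and pairwise span squares. The opposite three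
            squares of the resulting cube relate \<open>a\<close> to \<open>c\<close>
            directly.\<close>
          have c1: "Sq (rev_edge y) (rev_edge p1) (rev_edge y1) (rev_edge p2)"
            using Sq_turn[OF Sq_sym[OF **(1)]] .
          have c2: "Sq (rev_edge y) x b (rev_edge a)" using Sq_rot[OF Sq_sym[OF *(1)]] .
          have c3: "Sq (rev_edge y1) z1 b (rev_edge c)" using Sq_rot[OF sq1] .
          obtain k l m where k: "Sq (rev_edge p1) k x l" "Sq (rev_edge p2) k z1 m"
              "Sq (rev_edge a) l (rev_edge c) m"
            using Sq_cube[OF c1 c2 c3] by blast
          have k1: "Sq p1 x k (rev_edge l)" "Sq p2 z1 k (rev_edge m)"
            using Sq_rot[OF k(1)] Sq_rot[OF k(2)] rev_rev by auto
          have k2: "Sq (rev_edge l) a (rev_edge m) c"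
            using Sq_turn[OF k(3)] rev_rev by simp
          have "p \<simeq> x # p1 # t'" using *(2) swaps_Cons[OF **(3)] by (rule swaps_trans)
          also have "\<dots> \<simeq> rev_edge l # k # t'" using k1(1) by (rule swaps_here)
          finally have 1: "p \<simeq> rev_edge l # k # t'" .
          have "z1 # s \<simeq> z1 # p2 # t'" using swaps_Cons[OF **(2)] .
          also have "\<dots> \<simeq> rev_edge m # k # t'" using k1(2) by (rule swaps_here)
          finally show ?thesis using 1 k2 w' by auto
        qed
      qed
    qed
  qed auto
  from this[OF less.prems] show ?case by simp
qed

text \<open>A square whose two ways end in the same edge would, turned round, have two equal sides
  at one corner.\<close>

lemma swaps_Cons_cancel: "a # p \<simeq> a # q \<Longrightarrow> p \<simeq> q"
  using swaps_last[of a p a q] Sq_neq Sq_turn by blast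

lemma swaps_last_neq:
  "a # p \<simeq> b # q \<Longrightarrow> a \<noteq> b \<Longrightarrow> \<exists>t x y. Sq x a y b \<and> p \<simeq> x # t \<and> q \<simeq> y # t"
  using swaps_last by blast

definition reduced :: "'e list \<Rightarrow> bool" where
  "reduced p \<longleftrightarrow> (\<forall>s c t. \<not> p \<simeq> s @ c # rev_edge c # t)"

lemma reducedD: "reduced p \<Longrightarrow> p \<simeq> s @ c # rev_edge c # t \<Longrightarrow> False"
  by (auto simp: reduced_def)

lemma reduced_swaps: "reduced p \<Longrightarrow> p \<simeq> q \<Longrightarrow> reduced q"
  unfolding reduced_def by (meson swaps_trans)

lemma reduced_Nil: "reduced []"
  unfolding reduced_def by (auto dest: swaps_length)

lemma reduced_tl: "reduced (a # p) \<Longrightarrow> reduced p"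
  unfolding reduced_def by (metis append_Cons swaps_Cons)

lemma reduced_Cons_not: "reduced (a # p) \<Longrightarrow> \<not> p \<simeq> rev_edge a # q"
  unfolding reduced_def by (metis append_Nil swaps_Cons)

text \<open>A backtrack in an equivalent path either lies below the last edge \<open>b\<close> or
  cancels \<open>b\<close>. For \<open>b\<close> different from \<open>a\<close>, the two paths
  differ by a square above a common rest \<open>t1\<close> shorter than \<open>p\<close>. A
  backtrack of the first kind is excluded by induction, because \<open>y # t1\<close> is reduced;
  one of the second kind, by a second comparison of last edges, puts a backtrack into
  \<open>x # t1\<close>, which is equivalent to \<open>p\<close>.\<close>

lemma reduced_Cons:
  "reduced p \<Longrightarrow> \<forall>q. \<not> p \<simeq> rev_edge a # q \<Longrightarrow> reduced (a # p)"
proof (induction "length p" arbitrary: a p rule: less_induct)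
  case less
  show ?case unfolding reduced_def
  proof (intro allI notI)
    fix s c t assume *: "a # p \<simeq> s @ c # rev_edge c # t"
    then obtain b q where bq: "s @ c # rev_edge c # t = b # q"
      by (cases s) auto
    have **: "a # p \<simeq> b # q" using * bq by simp
    have bt: "\<not> (\<exists>s' c' t'. q = s' @ c' # rev_edge c' # t') \<Longrightarrow> q = rev_edge b # t"
      using bq by (cases s) auto
    show False
    proof (cases "a = b")
      case True
      then have pq: "p \<simeq> q" using ** swaps_Cons_cancel by blast
      then have "q = rev_edge b # t" using bt less.prems(1) reducedD by blast
      then show False using pq less.prems(2) True by auto
    next
      case False
      obtain t1 x y where sq: "Sq x a y b" and p: "p \<simeq> x # t1" and q: "q \<simeq> y # t1"
        using swaps_last_neq[OF ** False] by blast
      have rx: "reduced (x # t1)" using reduced_swaps[OF less.prems(1) p] .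
      then have rt: "reduced t1" by (rule reduced_tl)
      have len: "length t1 < length p" using swaps_length[OF p] by simp
      have "\<not> t1 \<simeq> rev_edge y # u" for u
      proof
        assume "t1 \<simeq> rev_edge y # u"
        then have "p \<simeq> x # rev_edge y # u" using p swaps_Cons swaps_trans by blast
        moreover have "Sq (rev_edge y) x b (rev_edge a)" using Sq_rot[OF Sq_sym[OF sq]] .
        ultimately have "p \<simeq> rev_edge a # b # u" using swaps_here swaps_trans by blast
        then show False using less.prems(2) by blast
      qed
      then have ry: "reduced (y # t1)" using less.hyps[OF len rt] by blast
      then have "reduced q" using reduced_swaps[OF _ swaps_sym[OF q]] by blast
      then have "q = rev_edge b # t" using bt reducedD by blast
      then have yb: "y # t1 \<simeq> rev_edge b # t" using q swaps_sym by metis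
      have sq': "Sq (rev_edge y) x b (rev_edge a)" using Sq_rot[OF Sq_sym[OF sq]] .
      have "y \<noteq> rev_edge b" using Sq_neq[OF sq'] rev_rev by metis
      from swaps_last_neq[OF yb this] obtain u c1 d1
        where u: "Sq c1 y d1 (rev_edge b)" "t1 \<simeq> c1 # u" by blast
      have "Sq (rev_edge y) (rev_edge c1) b (rev_edge d1)"
        using Sq_turn[OF u(1)] rev_rev by simp
      then have "rev_edge c1 = x" using sq' Sq_unique by blast
      then have "c1 = rev_edge x" using rev_rev by metis
      then have "x # t1 \<simeq> [] @ x # rev_edge x # u" using u(2) swaps_Cons by simp
      then show False using rx reducedD by blast
    qed
  qed
qed

section \<open>The universal cover as reduced paths\<close>

definition pclass :: "'e list \<Rightarrow> 'e list set" where "pclass p = {q. p \<simeq> q}"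

lemma pclass_eq_iff: "pclass p = pclass q \<longleftrightarrow> p \<simeq> q"
  unfolding pclass_def by (auto intro: swaps_trans swaps_sym)

definition cover :: "'v \<Rightarrow> 'v \<Rightarrow> 'e list set set" where
  "cover u v = {pclass p | p. path u p v \<and> reduced p}"

text \<open>Right multiplication of a reduced class by an edge, as in a free group: cancel if some
  representative ends in the reverse edge, otherwise append. Both branches are written on the whole
  class, which avoids choosing a representative.\<close>

definition extend :: "'e list set \<Rightarrow> 'e \<Rightarrow> 'e list set" where
  "extend P a = (if \<exists>q. rev_edge a # q \<in> P then {q. rev_edge a # q \<in> P}
                 else \<Union>p\<in>P. pclass (a # p))"

lemma extend_back: "p \<simeq> rev_edge a # q \<Longrightarrow> extend (pclass p) a = pclass q"
proof -
  assume p: "p \<simeq> rev_edge a # q"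
  have "q' \<in> pclass q \<longleftrightarrow> rev_edge a # q' \<in> pclass p" for q'
    unfolding pclass_def mem_Collect_eq
    using p by (metis swaps_Cons swaps_Cons_cancel swaps_sym swaps_trans)
  moreover have "rev_edge a # q \<in> pclass p" using p by (simp add: pclass_def)
  ultimately show ?thesis unfolding extend_def by auto
qed

lemma extend_forward: "\<forall>q. \<not> p \<simeq> rev_edge a # q \<Longrightarrow> extend (pclass p) a = pclass (a # p)"
proof -
  assume p: "\<forall>q. \<not> p \<simeq> rev_edge a # q"
  have "(\<Union>q\<in>pclass p. pclass (a # q)) = pclass (a # p)"
    unfolding pclass_def using swaps_Cons by (fastforce intro: swaps_trans)
  then show ?thesis unfolding extend_def using p by (simp add: pclass_def)
qed

lemma coverE:
  assumes "P \<in> cover u v"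
  obtains p where "P = pclass p" "path u p v" "reduced p"
  using assms by (auto simp: cover_def)

lemma extend_in_cover:
  assumes "a \<in> E" "P \<in> cover u (src a)"
  shows "extend P a \<in> cover u (tgt a)"
proof -
  obtain p where p: "P = pclass p" "path u p (src a)" "reduced p" using assms(2) by (rule coverE)
  show ?thesis
  proof (cases "\<exists>q. p \<simeq> rev_edge a # q")
    case True
    then obtain q where q: "p \<simeq> rev_edge a # q" by blast
    then have "path u (rev_edge a # q) (src a)" using p swaps_path by blast
    then have "path u q (tgt a)" using src_rev assms(1) by auto
    moreover have "reduced q" using reduced_swaps[OF p(3) q] reduced_tl by blast
    ultimately show ?thesis using extend_back[OF q] p unfolding cover_def by auto
  next
    case False
    then have "reduced (a # p)" using reduced_Cons p(3) by blast
    moreover have "path u (a # p) (tgt a)" using p assms by auto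
    ultimately show ?thesis using extend_forward[of p a] False p unfolding cover_def by blast
  qed
qed

lemma extend_rev:
  assumes "P \<in> cover u v"
  shows "extend (extend P a) (rev_edge a) = P"
proof -
  obtain p where p: "P = pclass p" "path u p v" "reduced p" using assms by (rule coverE)
  show ?thesis
  proof (cases "\<exists>q. p \<simeq> rev_edge a # q")
    case True
    then obtain q where q: "p \<simeq> rev_edge a # q" by blast
    then have "reduced (rev_edge a # q)" using p reduced_swaps by blast
    then have "\<forall>r. \<not> q \<simeq> rev_edge (rev_edge a) # r" using reduced_Cons_not by blast
    then have "extend (pclass q) (rev_edge a) = pclass (rev_edge a # q)" by (rule extend_forward)
    also have "\<dots> = P" using q p pclass_eq_iff swaps_sym by blast
    finally show ?thesis using extend_back[OF q] p by simp
  next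
    case False
    then have "extend P a = pclass (a # p)" using p extend_forward by blast
    moreover have "extend (pclass (a # p)) (rev_edge a) = pclass p"
      by (rule extend_back) (simp add: rev_rev)
    ultimately show ?thesis using p by simp
  qed
qed

text \<open>If the path ends in the reverse of \<open>x\<close> and also in the reverse of
  \<open>y\<close>, it ends in the reversed square, and either way round cancels two edges.
  Otherwise one way cancels \<open>x\<close> and appends \<open>a\<close>, while the other appends
  \<open>y\<close> and then, after one swap, cancels \<open>b\<close>.\<close>

lemma extend_square_aux:
  assumes "P \<in> cover u v" "Sq x a y b" "\<exists>q. rev_edge x # q \<in> P"
  shows "extend (extend P x) a = extend (extend P y) b"
proof -
  obtain p where p: "P = pclass p" "path u p v" "reduced p" using assms(1) by (rule coverE)
  obtain q where q: "p \<simeq> rev_edge x # q" using assms(3) p by (auto simp: pclass_def)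
  have Px: "extend P x = pclass q" using extend_back[OF q] p by simp
  have rot: "Sq (rev_edge x) y a (rev_edge b)" using Sq_rot[OF assms(2)] .
  show ?thesis
  proof (cases "\<exists>r. p \<simeq> rev_edge y # r")
    case True
    then obtain r where r: "p \<simeq> rev_edge y # r" by blast
    then have Py: "extend P y = pclass r" using extend_back p by simp
    have "rev_edge x # q \<simeq> rev_edge y # r" using q r swaps_sym swaps_trans by blast
    moreover have "rev_edge x \<noteq> rev_edge y" using Sq_neq[OF assms(2)] rev_rev by metis
    ultimately obtain t c d where t: "Sq c (rev_edge x) d (rev_edge y)" "q \<simeq> c # t" "r \<simeq> d # t"
      using swaps_last_neq by blast
    have "Sq x (rev_edge c) y (rev_edge d)" using Sq_turn[OF t(1)] rev_rev by simp
    then have "rev_edge c = a" "rev_edge d = b" using Sq_unique assms(2) by blast+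
    then have "c = rev_edge a" "d = rev_edge b" using rev_rev by metis+
    then show ?thesis using Px Py extend_back t by simp
  next
    case False
    then have "extend P y = pclass (y # p)" using extend_forward p by blast
    moreover have "y # p \<simeq> rev_edge b # a # q"
      using swaps_Cons[OF q] swaps_here[OF rot] by (rule swaps_trans)
    ultimately have R: "extend (extend P y) b = pclass (a # q)"
      using extend_back by simp
    have "\<not> q \<simeq> rev_edge a # s" for s
    proof
      assume "q \<simeq> rev_edge a # s"
      then have "p \<simeq> rev_edge x # rev_edge a # s" using q swaps_Cons swaps_trans by blast
      moreover have "Sq (rev_edge a) (rev_edge x) (rev_edge b) (rev_edge y)"
        using Sq_turn[OF assms(2)] .
      ultimately have "p \<simeq> rev_edge y # rev_edge b # s" using swaps_here swaps_trans by blast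
      then show False using False by blast
    qed
    then show ?thesis using R Px extend_forward by simp
  qed
qed

text \<open>When neither \<open>x\<close> nor \<open>y\<close> cancels, no later cancellation occurs
  either: if \<open>x # p\<close> ended in the reverse of \<open>a\<close>, a comparison of last
  edges would show that \<open>p\<close> ends in the reverse of \<open>y\<close>.\<close>

lemma extend_square:
  assumes "P \<in> cover u v" "Sq x a y b"
  shows "extend (extend P x) a = extend (extend P y) b"
proof -
  obtain p where p: "P = pclass p" "path u p v" "reduced p" using assms(1) by (rule coverE)
  consider "\<exists>q. rev_edge x # q \<in> P" | "\<exists>q. rev_edge y # q \<in> P"
    | "\<forall>q. \<not> p \<simeq> rev_edge x # q" "\<forall>q. \<not> p \<simeq> rev_edge y # q"
    using p by (auto simp: pclass_def)
  then show ?thesis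
  proof cases
    case 1
    then show ?thesis using extend_square_aux assms by blast
  next
    case 2
    then show ?thesis using extend_square_aux[OF assms(1) Sq_sym[OF assms(2)]] by simp
  next
    case 3
    have *: "\<not> x # p \<simeq> rev_edge a # q"
      if sq: "Sq x a y b" and ny: "\<forall>q. \<not> p \<simeq> rev_edge y # q" for x a y b q
    proof
      assume c: "x # p \<simeq> rev_edge a # q"
      have rot: "Sq (rev_edge x) y a (rev_edge b)" using Sq_rot[OF sq] .
      have "x \<noteq> rev_edge a" using Sq_neq[OF rot] rev_rev by metis
      then obtain t c' d where t: "Sq c' x d (rev_edge a)" "p \<simeq> c' # t"
        using swaps_last_neq[OF c] by blast
      have "Sq (rev_edge x) (rev_edge c') a (rev_edge d)" using Sq_turn[OF t(1)] rev_rev by simp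
      then have "rev_edge c' = y" using rot Sq_unique by blast
      then have "c' = rev_edge y" using rev_rev by metis
      then show False using ny t(2) by blast
    qed
    have "extend (extend P x) a = pclass (a # x # p)"
      using extend_forward 3 p *[OF assms(2)] by simp
    moreover have "extend (extend P y) b = pclass (b # y # p)"
      using extend_forward 3 p *[OF Sq_sym[OF assms(2)]] by simp
    ultimately show ?thesis using pclass_eq_iff swaps_here[OF assms(2)] by blast
  qed
qed

end

text \<open>Simple connectedness enters as the triviality of the monodromy of local systems on the
  vertices. Their fibres consist of path classes because \<open>cover u\<close> is the local system
  to which this is applied.\<close>

locale simply_connected_square_complex = square_complex E src tgt rev_edge Sq
  for E :: "'e set" and src tgt :: "'e \<Rightarrow> 'v" and rev_edge Sq +
  fixes V :: "'v set"
  assumes src_in: "a \<in> E \<Longrightarrow> src a \<in> V"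
    and connected: "u \<in> V \<Longrightarrow> v \<in> V \<Longrightarrow> \<exists>p. path u p v"
    and trivial_monodromy: "\<And>(N :: 'v \<Rightarrow> 'e list set set) act p q.
      (\<And>a P. a \<in> E \<Longrightarrow> P \<in> N (src a) \<Longrightarrow> act P a \<in> N (tgt a)) \<Longrightarrow>
      (\<And>a P. a \<in> E \<Longrightarrow> P \<in> N (src a) \<Longrightarrow> act (act P a) (rev_edge a) = P) \<Longrightarrow>
      (\<And>x a y b P. Sq x a y b \<Longrightarrow> P \<in> N (src x) \<Longrightarrow> act (act P x) a = act (act P y) b) \<Longrightarrow>
      u \<in> V \<Longrightarrow> path u p v \<Longrightarrow> path u q v \<Longrightarrow> P \<in> N u \<Longrightarrow>
      foldr (\<lambda>a P. act P a) p P = foldr (\<lambda>a P. act P a) q P"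
begin

lemma foldr_extend_reduced: "reduced p \<Longrightarrow> foldr (\<lambda>a P. extend P a) p (pclass []) = pclass p"
proof (induction p)
  case (Cons a p)
  then have "foldr (\<lambda>a P. extend P a) p (pclass []) = pclass p" using reduced_tl by blast
  moreover have "\<forall>q. \<not> p \<simeq> rev_edge a # q" using Cons.prems reduced_Cons_not by blast
  ultimately show ?case using extend_forward by simp
qed simp

text \<open>In the local system \<open>cover u\<close>, transport of the empty path along a reduced
  path yields the class of that path. Trivial monodromy therefore identifies the two
  classes.\<close>

lemma reduced_paths_swaps:
  assumes "u \<in> V" "path u p v" "path u q v" "reduced p" "reduced q"
  shows "p \<simeq> q"
proof -
  have "pclass [] \<in> cover u u" using reduced_Nil by (auto simp: cover_def intro!: exI[of _ "[]"])
  then have "foldr (\<lambda>a P. extend P a) p (pclass []) = foldr (\<lambda>a P. extend P a) q (pclass [])"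
    by (intro trivial_monodromy[where N = "cover u"])
      (use extend_in_cover extend_rev extend_square assms in auto)
  then show ?thesis using foldr_extend_reduced assms pclass_eq_iff by simp
qed

section \<open>The combinatorial metric on the vertices\<close>

lemma tgt_in: "a \<in> E \<Longrightarrow> tgt a \<in> V"
  using src_in[OF rev_in] src_rev by metis

definition gdist :: "'v \<Rightarrow> 'v \<Rightarrow> nat" where
  "gdist u v = (LEAST n. \<exists>p. path u p v \<and> length p = n)"

lemma gdist_le: "path u p v \<Longrightarrow> gdist u v \<le> length p"
  unfolding gdist_def by (rule Least_le) auto

lemma gdist_path:
  assumes "u \<in> V" "v \<in> V"
  obtains p where "path u p v" "length p = gdist u v"
proof -
  have "\<exists>n p. path u p v \<and> length p = n" using connected[OF assms] by auto
  then have "\<exists>p. path u p v \<and> length p = gdist u v" unfolding gdist_def by (rule LeastI_ex)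
  then show ?thesis using that by blast
qed

lemma path_remove_backtrack: "path u (s @ c # rev_edge c # t) v \<Longrightarrow> path u (s @ t) v"
proof (induction s arbitrary: v)
  case Nil
  then show ?case by auto (metis rev_in rev_rev src_rev)
qed auto

lemma geodesic_reduced:
  assumes "path u p v" "length p = gdist u v"
  shows "reduced p"
  unfolding reduced_def
proof (intro allI notI)
  fix s c t assume *: "p \<simeq> s @ c # rev_edge c # t"
  then have "path u (s @ t) v" using assms swaps_path path_remove_backtrack by blast
  then have "gdist u v \<le> length (s @ t)" by (rule gdist_le)
  then show False using swaps_length[OF *] assms by simp
qed

lemma reduced_length:
  assumes "u \<in> V" "path u p v" "reduced p" "v \<in> V"
  shows "length p = gdist u v"
proof -
  obtain q where q: "path u q v" "length q = gdist u v" using gdist_path[OF assms(1,4)] .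
  then have "p \<simeq> q" using reduced_paths_swaps[OF assms(1,2)] geodesic_reduced assms(3) by blast
  then show ?thesis using swaps_length q by simp
qed

lemma gdist_sym_le:
  assumes "u \<in> V" "v \<in> V"
  shows "gdist u v \<le> gdist v u"
proof -
  obtain p where p: "path v p u" "length p = gdist v u" using gdist_path[OF assms(2,1)] .
  then show ?thesis using gdist_le[OF path_rev[OF p(1)]] by simp
qed

lemma gdist_sym: "u \<in> V \<Longrightarrow> v \<in> V \<Longrightarrow> gdist u v = gdist v u"
  by (simp add: gdist_sym_le le_antisym)

lemma gdist_triangle:
  assumes "u \<in> V" "v \<in> V" "w \<in> V"
  shows "gdist u w \<le> gdist u v + gdist v w"
proof -
  obtain p where p: "path u p v" "length p = gdist u v" using gdist_path[OF assms(1,2)] .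
  obtain q where q: "path v q w" "length q = gdist v w" using gdist_path[OF assms(2,3)] .
  show ?thesis using gdist_le[OF path_append[OF p(1) q(1)]] p q by simp
qed

lemma gdist_eq_0:
  assumes "u \<in> V" "v \<in> V"
  shows "gdist u v = 0 \<longleftrightarrow> u = v"
proof
  obtain p where p: "path u p v" "length p = gdist u v" using gdist_path[OF assms] .
  assume "gdist u v = 0"
  then show "u = v" using p by simp
next
  assume "u = v"
  then show "gdist u v = 0" using gdist_le[of u "[]" v] by simp
qed

text \<open>Up to swaps a geodesic to the start of \<open>a\<close> either ends in the reverse of
  \<open>a\<close>, which can be removed, or stays reduced when \<open>a\<close> is appended;
  reduced paths are geodesics.\<close>

lemma gdist_step:
  assumes "u \<in> V" "a \<in> E"
  shows "gdist u (tgt a) = gdist u (src a) + 1 \<or> gdist u (src a) = gdist u (tgt a) + 1"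
proof -
  obtain p where p: "path u p (src a)" "length p = gdist u (src a)"
    using gdist_path[OF assms(1) src_in[OF assms(2)]] .
  have r: "reduced p" using geodesic_reduced p by blast
  show ?thesis
  proof (cases "\<exists>q. p \<simeq> rev_edge a # q")
    case True
    then obtain q where q: "p \<simeq> rev_edge a # q" by blast
    then have "path u q (tgt a)" using p swaps_path src_rev assms(2) by fastforce
    moreover have "reduced q" using r reduced_swaps[OF r q] reduced_tl by blast
    ultimately have "length q = gdist u (tgt a)" using reduced_length assms tgt_in by blast
    then show ?thesis using swaps_length[OF q] p by simp
  next
    case False
    then have "reduced (a # p)" using reduced_Cons r by blast
    moreover have "path u (a # p) (tgt a)" using p assms by auto
    ultimately have "length (a # p) = gdist u (tgt a)"
      using assms reduced_length tgt_in by blast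
    then show ?thesis using p by simp
  qed
qed

text \<open>Both edges complete geodesics from \<open>u\<close> to the same vertex. These are swap
  equivalent, so their different last edges bound a square.\<close>

lemma gdist_quadrangle:
  assumes "u \<in> V" "a \<in> E" "b \<in> E" "tgt a = tgt b" "a \<noteq> b"
    and "gdist u (tgt a) = gdist u (src a) + 1" "gdist u (tgt b) = gdist u (src b) + 1"
  obtains x y where "Sq x a y b" "gdist u (src a) = gdist u (src x) + 1"
proof -
  obtain p where p: "path u p (src a)" "length p = gdist u (src a)"
    using gdist_path[OF assms(1) src_in[OF assms(2)]] .
  obtain q where q: "path u q (src b)" "length q = gdist u (src b)"
    using gdist_path[OF assms(1) src_in[OF assms(3)]] .
  have "path u (a # p) (tgt a)" "path u (b # q) (tgt a)" using p q assms by auto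
  moreover have "reduced (a # p)" "reduced (b # q)"
    using geodesic_reduced[of u "a # p" "tgt a"] geodesic_reduced[of u "b # q" "tgt b"]
      p q assms by auto
  ultimately have "a # p \<simeq> b # q" using reduced_paths_swaps assms(1) by blast
  then obtain t x y where t: "Sq x a y b" "p \<simeq> x # t" using swaps_last_neq assms(5) by blast
  have pt: "path u (x # t) (src a)" using t p swaps_path by blast
  have r: "reduced t" using t geodesic_reduced p reduced_swaps reduced_tl by blast
  have "length t = gdist u (src x)"
    using pt reduced_length[OF assms(1) _ r] src_in by auto
  then show ?thesis using that t swaps_length[OF t(2)] p by simp
qed

definition adj :: "'v \<Rightarrow> 'v \<Rightarrow> bool" where "adj u v \<longleftrightarrow> (\<exists>a\<in>E. src a = u \<and> tgt a = v)"

lemma gdist_adj: "adj u v \<Longrightarrow> gdist u v = 1"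
proof -
  assume "adj u v"
  then obtain a where a: "a \<in> E" "src a = u" "tgt a = v" by (auto simp: adj_def)
  then show ?thesis using gdist_step[of u a] gdist_eq_0[of u u] src_in by auto
qed

text \<open>By parity the opposite corners have distance 2, so both ways round are geodesics, hence
  equivalent; for paths of length 2 with different last edges this means a single square.\<close>

lemma square_of_4cycle:
  assumes "x \<in> E" "a \<in> E" "y \<in> E" "b \<in> E" "src x = src y" "tgt x = src a" "tgt y = src b"
    "tgt a = tgt b" "a \<noteq> b" "src x \<noteq> tgt a"
  shows "Sq x a y b"
proof -
  have V: "src x \<in> V" "tgt a \<in> V" using assms src_in tgt_in by auto
  have p: "path (src x) [a, x] (tgt a)" "path (src x) [b, y] (tgt a)" using assms by auto
  have "adj (src x) (src a)" using assms by (auto simp: adj_def)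
  then have "gdist (src x) (tgt a) = 2"
    using gdist_step[OF V(1) assms(2)] gdist_adj assms gdist_eq_0[OF V] by auto
  then have "reduced [a, x]" "reduced [b, y]" using geodesic_reduced p by auto
  then have "a # [x] \<simeq> b # [y]" using reduced_paths_swaps p V by blast
  then obtain t x' y' where t: "Sq x' a y' b" "[x] \<simeq> x' # t" "[y] \<simeq> y' # t"
    using swaps_last_neq assms(9) by blast
  then have "t = []" using swaps_length[OF t(2)] by simp
  then have "x = x'" "y = y'" using t swaps_last[of x "[]" x' "[]"] swaps_last[of y "[]" y' "[]"]
    by (auto dest: swaps_length)
  then show ?thesis using t by simp
qed

lemma adj_sym: "adj u v \<Longrightarrow> adj v u"
  unfolding adj_def using rev_in src_rev tgt_rev by metis

lemma adj_in: "adj u v \<Longrightarrow> u \<in> V" "adj u v \<Longrightarrow> v \<in> V"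
  unfolding adj_def using src_in tgt_in by auto

lemma adj_bipartite: "u \<in> V \<Longrightarrow> adj v w \<Longrightarrow> gdist u w = gdist u v + 1 \<or> gdist u v = gdist u w + 1"
  unfolding adj_def using gdist_step by auto

lemma adj_quadrangle:
  assumes "u \<in> V" "adj p v" "adj q v" "p \<noteq> q"
    and "gdist u v = gdist u p + 1" "gdist u v = gdist u q + 1"
  shows "\<exists>r. adj r p \<and> adj r q \<and> gdist u p = gdist u r + 1"
proof -
  obtain a b where ab: "a \<in> E" "src a = p" "tgt a = v" "b \<in> E" "src b = q" "tgt b = v"
    using assms by (auto simp: adj_def)
  obtain x y where xy: "Sq x a y b" "gdist u (src a) = gdist u (src x) + 1"
    using gdist_quadrangle[of u a b] assms ab by auto
  have "adj (src x) p" "adj (src x) q"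
    using xy(1) Sq_in Sq_in[OF Sq_sym] Sq_mid Sq_src Sq_mid[OF Sq_sym] ab
    unfolding adj_def by metis+
  then show ?thesis using xy ab by auto
qed

text \<open>Two squares with the sides \<open>x1\<close> and \<open>a1\<close> in common span the
  same two edges at the vertex \<open>v1\<close> and therefore coincide.\<close>

lemma adj_no_K23:
  assumes "adj u v1" "adj u v2" "adj u v3" "adj v1 w" "adj v2 w" "adj v3 w" "u \<noteq> w"
    and "v1 \<noteq> v2" "v1 \<noteq> v3"
  shows "v2 = v3"
proof (rule ccontr)
  assume "v2 \<noteq> v3"
  obtain x1 x2 x3 a1 a2 a3 where e: "x1 \<in> E" "x2 \<in> E" "x3 \<in> E" "a1 \<in> E" "a2 \<in> E" "a3 \<in> E"
    "src x1 = u" "src x2 = u" "src x3 = u" "tgt x1 = v1" "tgt x2 = v2" "tgt x3 = v3"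
    "src a1 = v1" "src a2 = v2" "src a3 = v3" "tgt a1 = w" "tgt a2 = w" "tgt a3 = w"
    using assms unfolding adj_def by metis
  have "a1 \<noteq> a2" "a1 \<noteq> a3" using e assms by auto
  then have "Sq x1 a1 x2 a2" "Sq x1 a1 x3 a3"
    using square_of_4cycle[of x1 a1 x2 a2] square_of_4cycle[of x1 a1 x3 a3] e assms by auto
  then have "x2 = x3" using Sq_rot Sq_unique by blast
  then show False using e \<open>v2 \<noteq> v3\<close> by auto
qed

lemma gdist_neighbour:
  assumes "u \<in> V" "v \<in> V" "u \<noteq> v"
  shows "\<exists>w. adj w v \<and> gdist u v = gdist u w + 1"
proof -
  obtain p where p: "path u p v" "length p = gdist u v" using gdist_path[OF assms(1,2)] .
  then obtain a q where q: "p = a # q" using assms by (cases p) auto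
  then have a: "adj (src a) v" using p by (auto simp: adj_def)
  have "gdist u (src a) \<le> length q" using p q gdist_le by auto
  then show ?thesis using adj_bipartite[OF assms(1) a] p q a by auto
qed

end

section \<open>Median graphs\<close>

text \<open>Bipartite graphs with the quadrangle condition and without the complete bipartite graph
  K(2,3): a standard characterisation of median graphs. The medians themselves are obtained in
  \<open>median_exists_dist\<close>.\<close>

locale median_graph =
  fixes V :: "'v set" and adj :: "'v \<Rightarrow> 'v \<Rightarrow> bool" and d :: "'v \<Rightarrow> 'v \<Rightarrow> nat"
  assumes adj_sym: "adj u v \<Longrightarrow> adj v u"
    and adj_in: "adj u v \<Longrightarrow> u \<in> V"
    and d_adj: "adj u v \<Longrightarrow> d u v = 1"
    and d_sym: "u \<in> V \<Longrightarrow> v \<in> V \<Longrightarrow> d u v = d v u"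
    and d_triangle: "u \<in> V \<Longrightarrow> v \<in> V \<Longrightarrow> w \<in> V \<Longrightarrow> d u w \<le> d u v + d v w"
    and d_eq_0: "u \<in> V \<Longrightarrow> v \<in> V \<Longrightarrow> d u v = 0 \<longleftrightarrow> u = v"
    and neighbour: "u \<in> V \<Longrightarrow> v \<in> V \<Longrightarrow> u \<noteq> v \<Longrightarrow> \<exists>w. adj w v \<and> d u v = d u w + 1"
    and bipartite: "u \<in> V \<Longrightarrow> adj v w \<Longrightarrow> d u w = d u v + 1 \<or> d u v = d u w + 1"
    and quadrangle: "u \<in> V \<Longrightarrow> adj p v \<Longrightarrow> adj q v \<Longrightarrow> p \<noteq> q \<Longrightarrow> d u v = d u p + 1 \<Longrightarrow>
      d u v = d u q + 1 \<Longrightarrow> \<exists>r. adj r p \<and> adj r q \<and> d u p = d u r + 1"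
    and no_K23: "adj u v1 \<Longrightarrow> adj u v2 \<Longrightarrow> adj u v3 \<Longrightarrow> adj v1 w \<Longrightarrow> adj v2 w \<Longrightarrow> adj v3 w \<Longrightarrow>
      u \<noteq> w \<Longrightarrow> v1 \<noteq> v2 \<Longrightarrow> v1 \<noteq> v3 \<Longrightarrow> v2 = v3"
begin

lemma adj_in2: "adj u v \<Longrightarrow> v \<in> V"
  using adj_sym adj_in by blast

section \<open>Half-spaces of a median graph\<close>

definition halfspace :: "'v \<Rightarrow> 'v \<Rightarrow> 'v set" where
  "halfspace u v = {z \<in> V. d z u < d z v}"

lemma halfspace_cases:
  "adj u v \<Longrightarrow> z \<in> V \<Longrightarrow>
    (z \<in> halfspace u v \<and> d z v = d z u + 1) \<or> (z \<notin> halfspace u v \<and> d z u = d z v + 1)"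
  using bipartite[of z u v] by (auto simp: halfspace_def)

lemma halfspace_compl: "adj u v \<Longrightarrow> V - halfspace u v = halfspace v u"
  using bipartite[of _ u v] by (force simp: halfspace_def)

text \<open>If \<open>z\<close> were nearer to \<open>u\<close> than to \<open>v\<close> but nearer
  to \<open>v'\<close> than to \<open>u'\<close>, then \<open>u\<close> and \<open>v'\<close> would
  be two neighbours of \<open>v\<close> nearer to \<open>z\<close>. The quadrangle condition would
  give a common neighbour \<open>r\<close> of them, and \<open>v\<close>, \<open>u'\<close>,
  \<open>r\<close> together with \<open>u\<close>, \<open>v'\<close> would form a K(2,3).\<close>

lemma halfspace_square_subset:
  assumes "adj u v" "adj v v'" "adj v' u'" "adj u' u" "u \<noteq> v'" "v \<noteq> u'"
  shows "halfspace u v \<subseteq> halfspace u' v'"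
proof
  fix z assume z: "z \<in> halfspace u v"
  then have zV: "z \<in> V" by (simp add: halfspace_def)
  have 1: "d z v = d z u + 1" using z halfspace_cases[OF assms(1) zV] by auto
  show "z \<in> halfspace u' v'"
  proof (rule ccontr)
    assume "z \<notin> halfspace u' v'"
    then have 2: "d z u' = d z v' + 1" using halfspace_cases[OF adj_sym[OF assms(3)] zV] by auto
    have "d z u' = d z u + 1 \<or> d z u = d z u' + 1" using bipartite[OF zV assms(4)] by auto
    moreover have "d z v' = d z v + 1 \<or> d z v = d z v' + 1" using bipartite[OF zV assms(2)] by auto
    ultimately have 3: "d z v' = d z u" using 1 2 by arith
    obtain r where r: "adj r u" "adj r v'" "d z u = d z r + 1"
      using quadrangle[OF zV assms(1) adj_sym[OF assms(2)] assms(5)] 1 3 by metis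
    have "d z r \<noteq> d z v" "d z r \<noteq> d z u'" using r(3) 1 2 3 by arith+
    then have "r \<noteq> v" "r \<noteq> u'" by auto
    then show False
      using no_K23[of u v u' r v'] assms r adj_sym by blast
  qed
qed

lemma halfspace_square:
  assumes "adj u v" "adj v v'" "adj v' u'" "adj u' u" "u \<noteq> v'" "v \<noteq> u'"
  shows "halfspace u v = halfspace u' v'"
  using halfspace_square_subset[OF assms] halfspace_square_subset[of u' v' v u] assms adj_sym
  by blast

text \<open>A ladder of squares leads from the edge \<open>u v\<close> to the edge
  \<open>s t\<close>, and opposite sides of a square have equal half-spaces. One rung of the ladder
  is found by a step \<open>v1\<close> from \<open>v\<close> towards \<open>t\<close>, completed to
  a square by the quadrangle condition seen from \<open>s\<close>.\<close>

lemma halfspace_crossing: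
  "adj u v \<Longrightarrow> adj s t \<Longrightarrow> s \<in> halfspace u v \<Longrightarrow> t \<notin> halfspace u v \<Longrightarrow>
    halfspace s t = halfspace u v"
proof (induction "d s u" arbitrary: u v)
  case 0
  have V: "s \<in> V" "t \<in> V" "u \<in> V" "v \<in> V" using 0 adj_in adj_in2 by auto
  have "s = u" using 0 d_eq_0 V by auto
  moreover have "d t u = d t v + 1" using halfspace_cases[OF 0(2) V(2)] 0 by auto
  moreover have "d t u = 1" using d_adj[OF adj_sym[OF 0(3)]] calculation by simp
  ultimately have "d t v = 0" "s = u" by auto
  then show ?case using d_eq_0 V by auto
next
  case (Suc k)
  have V: "s \<in> V" "t \<in> V" "u \<in> V" "v \<in> V" using Suc adj_in adj_in2 by auto
  have s: "d s v = d s u + 1" using halfspace_cases[OF Suc(3) V(1)] Suc by auto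
  have t: "d t u = d t v + 1" using halfspace_cases[OF Suc(3) V(2)] Suc by auto
  have st: "d s t = 1" "d t s = 1" using d_adj[OF Suc(4)] d_adj[OF adj_sym[OF Suc(4)]] by auto
  have tv: "d t v = d s u" using s t st d_triangle[of s t v] d_triangle[of t s u] V by auto
  then have "d t v \<noteq> 0" using Suc(2) by simp
  then have "t \<noteq> v" using d_eq_0[OF V(2,4)] by simp
  then obtain v1 where v1: "adj v1 v" "d t v = d t v1 + 1" using neighbour V by blast
  have v1V: "v1 \<in> V" using v1 adj_in by blast
  have sv1: "d s v1 = d s u"
    using bipartite[OF V(1) v1(1)] d_triangle[OF V(1,2) v1V] s st(1) v1(2) tv by arith
  have "v1 \<noteq> u"
  proof
    assume "v1 = u"
    then show False using v1(2) t by simp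
  qed
  then obtain u1 where u1: "adj u1 u" "adj u1 v1" "d s u = d s u1 + 1"
    using quadrangle[OF V(1) Suc(3) v1(1)] s sv1 by metis
  have u1V: "u1 \<in> V" using u1 adj_in by blast
  have tu: "d t u1 \<ge> d t v" using d_triangle[OF V(2) u1V V(3)] d_adj[OF u1(1)] t by arith
  have "d s u1 \<noteq> d s v" using u1(3) s by arith
  then have "u1 \<noteq> v" by auto
  then have eq: "halfspace u v = halfspace u1 v1"
    using halfspace_square[of u v v1 u1] Suc(3) v1 u1 adj_sym \<open>v1 \<noteq> u\<close> by blast
  have "halfspace s t = halfspace u1 v1"
    using Suc(1)[of u1 v1] Suc(2) u1 Suc(4,5,6) eq by (metis Suc_eq_plus1 nat.inject)
  then show ?case using eq by simp
qed

definition halfspaces :: "'v set set" where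
  "halfspaces = {halfspace u v | u v. adj u v}"

lemma halfspaces_compl: "h \<in> halfspaces \<Longrightarrow> V - h \<in> halfspaces"
  unfolding halfspaces_def using halfspace_compl adj_sym by blast

lemma halfspaces_subset: "h \<in> halfspaces \<Longrightarrow> h \<subseteq> V"
  unfolding halfspaces_def halfspace_def by blast

text \<open>One further edge on a geodesic contributes at most its own half-space, by
  \<open>halfspace_crossing\<close>.\<close>

lemma finite_separating:
  "x \<in> V \<Longrightarrow> y \<in> V \<Longrightarrow> finite {h \<in> halfspaces. x \<in> h \<and> y \<notin> h}"
proof (induction "d x y" arbitrary: y)
  case 0
  then have "x = y" using d_eq_0 by auto
  then show ?case by auto
next
  case (Suc n)
  then have "x \<noteq> y" using d_eq_0[of x y] by auto
  then obtain w where w: "adj w y" "d x y = d x w + 1" using neighbour Suc by blast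
  have "finite {h \<in> halfspaces. x \<in> h \<and> w \<notin> h}"
    using Suc w adj_in by auto
  moreover have "{h \<in> halfspaces. x \<in> h \<and> y \<notin> h} \<subseteq>
      insert (halfspace w y) {h \<in> halfspaces. x \<in> h \<and> w \<notin> h}"
    using halfspace_crossing[OF _ w(1)] by (auto simp: halfspaces_def)
  ultimately show ?case by (meson finite_insert finite_subset)
qed

lemma halfspaces_separate:
  assumes "x \<in> V" "y \<in> V" "x \<noteq> y"
  shows "\<exists>h\<in>halfspaces. x \<in> h \<and> y \<notin> h"
proof -
  obtain w where w: "adj w x" "d y x = d y w + 1" using neighbour assms by metis
  have "x \<in> halfspace x w" using assms w d_eq_0 d_adj[OF adj_sym[OF w(1)]]
    by (auto simp: halfspace_def)
  moreover have "y \<notin> halfspace x w" using w by (auto simp: halfspace_def)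
  ultimately show ?thesis using adj_sym[OF w(1)] by (auto simp: halfspaces_def)
qed

lemma exit_edge:
  assumes "x \<in> V" "x \<in> h"
  shows "m \<in> V \<Longrightarrow> m \<notin> h \<Longrightarrow>
    \<exists>s t. adj s t \<and> s \<in> h \<and> t \<notin> h \<and> d x t = d x s + 1 \<and> d x t + d t m = d x m"
proof (induction "d x m" arbitrary: m)
  case 0
  then show ?case using d_eq_0 assms by auto
next
  case (Suc n)
  then have "x \<noteq> m" using assms by auto
  then obtain w where w: "adj w m" "d x m = d x w + 1" using neighbour Suc assms by blast
  have V: "w \<in> V" using w adj_in by blast
  show ?case
  proof (cases "w \<in> h")
    case True
    have "d m m = 0" using d_eq_0 Suc by auto
    then show ?thesis using True w Suc by (intro exI[of _ w] exI[of _ m]) auto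
  next
    case False
    then obtain s t where st: "adj s t" "s \<in> h" "t \<notin> h" "d x t = d x s + 1" "d x t + d t w = d x w"
      using Suc(1)[of w] Suc(2) w V by auto
    have tV: "t \<in> V" using st adj_in2 by blast
    have "d t m \<le> d t w + 1" using d_triangle[OF tV V Suc(3)] d_adj[OF w(1)] by simp
    moreover have "d x m \<le> d x t + d t m" using d_triangle[OF assms(1) tV Suc(3)] .
    ultimately show ?thesis using st w by (intro exI[of _ s] exI[of _ t]) auto
  qed
qed

text \<open>A geodesic from \<open>x\<close> to \<open>m\<close> would leave \<open>h\<close> over
  an edge \<open>s t\<close> whose half-space is \<open>h\<close>. Then \<open>y\<close> is nearer
  to \<open>s\<close> than to \<open>t\<close>, and the way from \<open>x\<close> to
  \<open>y\<close> over \<open>s\<close> is shorter than the geodesic through \<open>t\<close> and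
  \<open>m\<close>.\<close>

lemma halfspaces_convex:
  assumes "h \<in> halfspaces" "x \<in> h" "y \<in> h" "m \<in> V" "d x m + d m y = d x y"
  shows "m \<in> h"
proof (rule ccontr)
  assume m: "m \<notin> h"
  have V: "x \<in> V" "y \<in> V" using assms halfspaces_subset by auto
  obtain s t where st: "adj s t" "s \<in> h" "t \<notin> h" "d x t = d x s + 1" "d x t + d t m = d x m"
    using exit_edge[OF V(1) assms(2,4) m] by auto
  have stV: "s \<in> V" "t \<in> V" using st adj_in adj_in2 by auto
  obtain u v where uv: "adj u v" "h = halfspace u v" using assms(1) by (auto simp: halfspaces_def)
  then have "h = halfspace s t" using st halfspace_crossing by blast
  then have "d y s < d y t" using assms(3) by (auto simp: halfspace_def)
  moreover have "d t y \<le> d t m + d m y" using d_triangle[OF stV(2) assms(4) V(2)] .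
  moreover have "d x y \<le> d x s + d s y" using d_triangle[OF V(1) stV(1) V(2)] .
  moreover have "d s y = d y s" "d t y = d y t" using d_sym V stV by auto
  ultimately show False using st assms(5) by simp
qed

text \<open>Induction on the distance of \<open>x\<close> and \<open>y\<close>. The aim is a
  neighbour of \<open>x\<close> that is nearer to both \<open>y\<close> and \<open>z\<close>; if a
  step towards \<open>y\<close> leads away from \<open>z\<close>, either \<open>x\<close> is itself
  the median or the quadrangle condition corrects the step.\<close>

lemma median_exists_dist:
  "x \<in> V \<Longrightarrow> y \<in> V \<Longrightarrow> z \<in> V \<Longrightarrow>
    \<exists>m\<in>V. d x m + d m y = d x y \<and> d x m + d m z = d x z \<and> d y m + d m z = d y z"
proof (induction "d x y" arbitrary: x)
  case 0
  then have "x = y" using d_eq_0 by auto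
  moreover have "d x x = 0" using d_eq_0 0 by auto
  ultimately show ?case using 0 by (intro bexI[of _ x]) auto
next
  case (Suc n)
  \<comment> \<open>If some neighbour of x is closer to both y and z, its median works for x as well.\<close>
  have towards: ?case if w: "adj w x" "d x y = d w y + 1" "d x z = d w z + 1" for w
  proof -
    have wV: "w \<in> V" using w adj_in by blast
    obtain m where m: "m \<in> V" "d w m + d m y = d w y" "d w m + d m z = d w z" "d y m + d m z = d y z"
      using Suc(1)[of w] Suc(2) w wV Suc by auto
    have "d x m \<le> 1 + d w m" using d_triangle[OF Suc(3) wV m(1)] d_adj[OF adj_sym[OF w(1)]] by simp
    moreover have "d x y \<le> d x m + d m y" "d x z \<le> d x m + d m z"
      using d_triangle Suc m by auto
    ultimately show ?thesis using m w by (intro bexI[of _ m]) auto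
  qed
  have "x \<noteq> y" using Suc d_eq_0[of x y] by auto
  then obtain w where w: "adj w x" "d y x = d y w + 1" using neighbour Suc by metis
  have wV: "w \<in> V" using w adj_in by blast
  have wy: "d x y = d w y + 1" using w d_sym Suc wV by simp
  show ?case
  proof (cases "d x z = d w z + 1")
    case True
    then show ?thesis using towards w wy by blast
  next
    case False
    then have wz: "d w z = d x z + 1"
      using bipartite[OF Suc(5) w(1)] d_sym[of z w] d_sym[of z x] Suc wV by auto
    obtain m where m: "m \<in> V" "d w m + d m y = d w y" "d w m + d m z = d w z" "d y m + d m z = d y z"
      using Suc(1)[of w] Suc(2) wy wV Suc by auto
    show ?thesis
    proof (cases "m = w")
      case True
      \<comment> \<open>Here \<open>w\<close> lies between \<open>y\<close> and \<open>z\<close>,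
        and \<open>x\<close> follows \<open>w\<close> on the way to \<open>z\<close>; hence
        \<open>x\<close> lies between them as well.\<close>
      have "d x x = 0" using d_eq_0 Suc by auto
      moreover have "d y w = d w y" "d y x = d x y" using d_sym wV Suc by auto
      ultimately show ?thesis using True m wz wy Suc by (intro bexI[of _ x]) auto
    next
      case False
      \<comment> \<open>A step \<open>v\<close> from \<open>w\<close> towards \<open>m\<close> comes
        nearer to both \<open>y\<close> and \<open>z\<close>. Seen from \<open>z\<close>, both
        \<open>v\<close> and \<open>x\<close> are nearer than \<open>w\<close>, and the corner
        \<open>r\<close> opposite to \<open>w\<close> is the desired neighbour of
        \<open>x\<close>.\<close>
      then obtain v where v: "adj v w" "d m w = d m v + 1" using neighbour m wV by metis
      have vV: "v \<in> V" using v adj_in by blast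
      have mv: "d w m = d v m + 1" using v d_sym m wV vV by simp
      have vw: "d w v = 1" using d_adj[OF adj_sym[OF v(1)]] .
      have vz: "d w z = d v z + 1"
        using m mv vw d_triangle[OF wV vV Suc(5)] d_triangle[OF vV m(1) Suc(5)] by auto
      have vy: "d w y = d v y + 1"
        using m mv vw d_triangle[OF wV vV Suc(4)] d_triangle[OF vV m(1) Suc(4)] by auto
      have "v \<noteq> x" using vy wy by auto
      then obtain r where r: "adj r v" "adj r x" "d z v = d z r + 1"
        using quadrangle[OF Suc(5) v(1) adj_sym[OF w(1)]] vz wz d_sym Suc vV wV by auto
      have rV: "r \<in> V" using r adj_in by blast
      have "d r y \<le> d r v + d v y" using d_triangle rV vV Suc by auto
      moreover have "d r v = 1" using d_adj[OF r(1)] .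
      moreover have "d r y = d x y + 1 \<or> d x y = d r y + 1"
        using bipartite[OF Suc(4) r(2)] d_sym Suc rV by auto
      ultimately have "d x y = d r y + 1" using vy wy by auto
      moreover have "d x z = d r z + 1" using r vz wz d_sym rV vV Suc by auto
      ultimately show ?thesis using towards r by blast
    qed
  qed
qed

text \<open>The median belongs to each half-space by majority vote: convexity gives one direction,
  and convexity of the complement the other.\<close>

lemma median_exists:
  assumes "x \<in> V" "y \<in> V" "z \<in> V"
  shows "\<exists>m\<in>V. \<forall>h\<in>halfspaces.
    m \<in> h \<longleftrightarrow> (x \<in> h \<and> y \<in> h) \<or> (x \<in> h \<and> z \<in> h) \<or> (y \<in> h \<and> z \<in> h)"
proof -
  obtain m where m: "m \<in> V" "d x m + d m y = d x y" "d x m + d m z = d x z" "d y m + d m z = d y z"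
    using median_exists_dist[OF assms] by blast
  have maj: "m \<in> h" if "h \<in> halfspaces"
      "(x \<in> h \<and> y \<in> h) \<or> (x \<in> h \<and> z \<in> h) \<or> (y \<in> h \<and> z \<in> h)" for h
    using that m halfspaces_convex by blast
  show ?thesis
  proof (intro bexI[OF _ m(1)] ballI iffI)
    fix h assume h: "h \<in> halfspaces" "m \<in> h"
    then have "m \<notin> V - h" by simp
    then show "(x \<in> h \<and> y \<in> h) \<or> (x \<in> h \<and> z \<in> h) \<or> (y \<in> h \<and> z \<in> h)"
      using maj[OF halfspaces_compl[OF h(1)]] assms by blast
  qed (use maj in blast)
qed

end

context simply_connected_square_complex
begin

lemma median_graph: "median_graph V adj gdist"
  by unfold_locales
    (fact adj_sym adj_in gdist_adj gdist_sym gdist_triangle gdist_eq_0 gdist_neighbour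
      adj_bipartite adj_quadrangle adj_no_K23)+

end

section \<open>Proper actions on wall spaces\<close>

locale wall_space =
  fixes X :: "'v set" and \<H> :: "'v set set"
  assumes wall_subset: "h \<in> \<H> \<Longrightarrow> h \<subseteq> X"
    and wall_compl: "h \<in> \<H> \<Longrightarrow> X - h \<in> \<H>"
    and wall_finite: "x \<in> X \<Longrightarrow> y \<in> X \<Longrightarrow> finite {h \<in> \<H>. x \<in> h \<and> y \<notin> h}"
    and wall_separates: "x \<in> X \<Longrightarrow> y \<in> X \<Longrightarrow> x \<noteq> y \<Longrightarrow> \<exists>h\<in>\<H>. x \<in> h \<and> y \<notin> h"
    and wall_median: "x \<in> X \<Longrightarrow> y \<in> X \<Longrightarrow> z \<in> X \<Longrightarrow> \<exists>m\<in>X. \<forall>h\<in>\<H>.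
      m \<in> h \<longleftrightarrow> (x \<in> h \<and> y \<in> h) \<or> (x \<in> h \<and> z \<in> h) \<or> (y \<in> h \<and> z \<in> h)"
begin

text \<open>Both sides of a wall belong to \<open>\<H>\<close>, so for two points of
  \<open>X\<close> the cardinality is twice the number of walls between them.\<close>

definition wsep :: "'v \<Rightarrow> 'v \<Rightarrow> 'v set set" where
  "wsep x y = {h \<in> \<H>. (x \<in> h) \<noteq> (y \<in> h)}"

lemma finite_wsep: "x \<in> X \<Longrightarrow> y \<in> X \<Longrightarrow> finite (wsep x y)"
  by (rule finite_subset[of _ "{h \<in> \<H>. x \<in> h \<and> y \<notin> h} \<union> {h \<in> \<H>. y \<in> h \<and> x \<notin> h}"])
    (auto simp: wsep_def wall_finite)

lemma wsep_sym: "wsep x y = wsep y x"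
  by (auto simp: wsep_def)

lemma card_wsep_triangle:
  assumes "x \<in> X" "y \<in> X" "z \<in> X"
  shows "card (wsep x z) \<le> card (wsep x y) + card (wsep y z)"
proof -
  have "wsep x z \<subseteq> wsep x y \<union> wsep y z" by (auto simp: wsep_def)
  then have "card (wsep x z) \<le> card (wsep x y \<union> wsep y z)"
    by (intro card_mono) (auto simp: finite_wsep assms)
  also have "\<dots> \<le> card (wsep x y) + card (wsep y z)" by (rule card_Un_le)
  finally show ?thesis .
qed

end

lemma int_periodic:
  fixes f :: "int \<Rightarrow> 'b"
  assumes "\<And>i. f (i + p) = f i"
  shows "f (i + k * p) = f i"
proof (induction k rule: int_induct[of _ 0])
  case (step1 k)
  then show ?case using assms[of "i + k * p"] by (simp add: algebra_simps)
next
  case (step2 k)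
  then show ?case using assms[of "i + (k - 1) * p"] by (simp add: algebra_simps)
qed simp

lemma int_ultimately_constant:
  fixes f :: "int \<Rightarrow> bool"
  assumes "finite {i. f i \<noteq> f (i + 1)}"
  obtains M b c where "\<And>i. i \<ge> M \<Longrightarrow> f i = b" "\<And>i. i \<le> - M \<Longrightarrow> f i = c"
proof -
  obtain M where M: "\<And>i. f i \<noteq> f (i + 1) \<Longrightarrow> \<bar>i\<bar> < M"
  proof -
    have "finite (abs ` {i. f i \<noteq> f (i + 1)})" using assms by simp
    then have "\<And>i. f i \<noteq> f (i + 1) \<Longrightarrow> \<bar>i\<bar> < Max (insert 0 (abs ` {i. f i \<noteq> f (i + 1)})) + 1"
      by (intro zle_add1_eq_le[THEN iffD2] Max_ge) auto
    then show ?thesis using that by blast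
  qed
  have up: "f i = f (max M 0)" if "i \<ge> max M 0" for i
    using that
  proof (induction i rule: int_ge_induct)
    case (step i)
    then show ?case using M[of i] by auto
  qed simp
  have down: "f i = f (- max M 0)" if "i \<le> - max M 0" for i
    using that
  proof (induction i rule: int_le_induct)
    case (step i)
    then show ?case using M[of "i - 1"] by (cases "f (i - 1)"; cases "f i") auto
  qed simp
  show ?thesis using that[of "max M 0"] up down by blast
qed

locale wall_flow = wall_space X \<H> for X :: "'v set" and \<H> +
  fixes \<rho> :: "int \<Rightarrow> 'v \<Rightarrow> 'v"
  assumes flow_in: "y \<in> X \<Longrightarrow> \<rho> i y \<in> X"
    and flow_add: "y \<in> X \<Longrightarrow> \<rho> (i + j) y = \<rho> i (\<rho> j y)"
    and flow_0: "y \<in> X \<Longrightarrow> \<rho> 0 y = y"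
    and flow_wall: "h \<in> \<H> \<Longrightarrow> \<rho> i ` h \<in> \<H>"
begin

lemma flow_neg: "y \<in> X \<Longrightarrow> \<rho> (- i) (\<rho> i y) = y" "y \<in> X \<Longrightarrow> \<rho> i (\<rho> (- i) y) = y"
  using flow_add[of y "-i" i] flow_add[of y i "-i"] flow_0 by auto

lemma flow_image_add: "h \<in> \<H> \<Longrightarrow> \<rho> (i + j) ` h = \<rho> i ` \<rho> j ` h"
  unfolding image_image by (intro image_cong refl flow_add) (use wall_subset in blast)

lemma flow_image_0: "h \<in> \<H> \<Longrightarrow> \<rho> 0 ` h = h"
  using image_cong[of h h "\<rho> 0" "\<lambda>x. x"] flow_0 wall_subset[of h] by (simp add: subset_iff)

lemma flow_mem_image: "h \<in> \<H> \<Longrightarrow> y \<in> X \<Longrightarrow> y \<in> \<rho> i ` h \<longleftrightarrow> \<rho> (- i) y \<in> h"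
  using flow_neg[of _ i] wall_subset[of h] by (force simp: image_iff)

definition stays :: "'v \<Rightarrow> 'v set \<Rightarrow> int \<Rightarrow> bool" where "stays x h i \<longleftrightarrow> \<rho> i x \<in> h"

lemma stays_shift: "h \<in> \<H> \<Longrightarrow> x \<in> X \<Longrightarrow> stays x (\<rho> j ` h) i = stays x h (i - j)"
  unfolding stays_def using flow_mem_image[of h "\<rho> i x" j] flow_in flow_add[of x "-j" i] by simp

text \<open>A half-space whose membership sequence has different limits at the two ends has
  n translates separating x from its n-th translate, one for each residue modulo n.\<close>

lemma wsep_flow_large:
  assumes h: "h \<in> \<H>" and x: "x \<in> X"
    and lim: "\<And>i. i \<ge> M \<Longrightarrow> stays x h i = b" "\<And>i. i \<le> - M \<Longrightarrow> stays x h i = (\<not> b)"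
  shows "n \<le> card (wsep x (\<rho> (int n) x))"
proof (cases "n = 0")
  case False
  \<comment> \<open>A period would carry the value at one end to the other end, where it is
    different. This makes translates by different amounts distinct.\<close>
  have nonper: "\<exists>i. stays x h (i + p) \<noteq> stays x h i" if "p \<noteq> 0" for p
  proof (rule ccontr)
    assume "\<not> ?thesis"
    then have per: "stays x h (i + k * p) = stays x h i" for i k
      using int_periodic[of "stays x h" p] by blast
    have "stays x h (- \<bar>M\<bar>) = (\<not> b)" using lim by auto
    moreover have "- \<bar>M\<bar> + (2 * \<bar>M\<bar> * sgn p) * p \<ge> M"
    proof -
      have "sgn p * p \<ge> 1" using that by (simp add: sgn_if)
      then have "2 * \<bar>M\<bar> * (sgn p * p) \<ge> 2 * \<bar>M\<bar> * 1" by (intro mult_left_mono) auto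
      then show ?thesis by (simp add: mult.assoc) 
    qed
    ultimately show False using per lim(1) by blast
  qed
  \<comment> \<open>Along each residue class modulo \<open>n\<close> the sequence has the same two
    limits, so it changes between some neighbours \<open>int r + k * int n\<close> and
    \<open>int r + (k + 1) * int n\<close>. Translated back by the first index, the half-space
    separates \<open>x\<close> from its \<open>n\<close>-th translate.\<close>
  have "\<exists>k. stays x h (int r + k * int n) \<noteq> stays x h (int r + (k + 1) * int n)" for r
  proof (rule ccontr)
    assume "\<not> ?thesis"
    then have eq: "stays x h (int r + k * int n) = stays x h (int r + (k + 1) * int n)" for k by blast
    have "stays x h (int r + k * int n) = stays x h (int r)" for k
      using int_periodic[of "\<lambda>k. stays x h (int r + k * int n)" 1 0 k] eq by (simp add: add.commute)
    then have "stays x h (int r + (\<bar>M\<bar> + int r) * int n) = stays x h (int r + (- (\<bar>M\<bar> + int r)) * int n)"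
      by blast
    moreover have "(\<bar>M\<bar> + int r) * int n \<ge> (\<bar>M\<bar> + int r) * 1"
      using False by (intro mult_left_mono) auto
    then have g: "(\<bar>M\<bar> + int r) * int n \<ge> \<bar>M\<bar> + int r" by simp
    have "int r + (\<bar>M\<bar> + int r) * int n \<ge> M" using g by linarith
    moreover have "int r + (- (\<bar>M\<bar> + int r)) * int n \<le> - M"
      unfolding mult_minus_left using g by linarith
    ultimately show False using lim by blast
  qed
  then obtain k where k: "\<And>r. stays x h (int r + k r * int n) \<noteq> stays x h (int r + (k r + 1) * int n)"
    by metis
  define j where "j r = int r + k r * int n" for r
  have jmod: "j r mod int n = int r" if "r < n" for r
    using that by (simp add: j_def)
  have inj: "inj_on (\<lambda>r. \<rho> (- j r) ` h) {..<n}"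
  proof (rule inj_onI)
    fix r r' assume r: "r \<in> {..<n}" "r' \<in> {..<n}" and e: "\<rho> (- j r) ` h = \<rho> (- j r') ` h"
    have "stays x h (i + j r) = stays x h (i + j r')" for i
      using stays_shift[OF h x, of "- j r" i] stays_shift[OF h x, of "- j r'" i] e by simp
    from this[of "i - j r" for i] have "stays x h (i + (j r' - j r)) = stays x h i" for i
      by (simp add: algebra_simps)
    then have "j r' = j r" using nonper[of "j r' - j r"] by auto
    then show "r = r'" using jmod r by (metis lessThan_iff of_nat_eq_iff)
  qed
  have "(\<lambda>r. \<rho> (- j r) ` h) ` {..<n} \<subseteq> wsep x (\<rho> (int n) x)"
  proof (rule image_subsetI)
    fix r
    have "stays x (\<rho> (- j r) ` h) 0 \<noteq> stays x (\<rho> (- j r) ` h) (int n)"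
      using k[of r] stays_shift[OF h x] by (simp add: j_def algebra_simps)
    then show "\<rho> (- j r) ` h \<in> wsep x (\<rho> (int n) x)"
      using flow_wall[OF h] flow_0[OF x] by (auto simp: wsep_def stays_def)
  qed
  then have "card ((\<lambda>r. \<rho> (- j r) ` h) ` {..<n}) \<le> card (wsep x (\<rho> (int n) x))"
    by (intro card_mono finite_wsep x flow_in)
  then show ?thesis using inj by (simp add: card_image)
qed simp

text \<open>If the separation does not grow linearly, some power fixes the median of three points of the orbit that are far apart.\<close>

lemma flow_large_or_fixed:
  assumes x: "x \<in> X"
  shows "(\<forall>n. n \<le> card (wsep x (\<rho> (int n) x))) \<or> (\<exists>N>0. \<exists>y\<in>X. \<rho> (int N) y = y)"
proof (rule disjCI)
  assume fixd: "\<not> (\<exists>N>0. \<exists>y\<in>X. \<rho> (int N) y = y)"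
  define s where "s = stays x"
  \<comment> \<open>By \<open>change\<close>, every half-space that separates two consecutive orbit
    points is a translate of a member of the finite set \<open>T\<close>.\<close>
  define T where "T = wsep x (\<rho> 1 x)"
  have finT: "finite T" unfolding T_def by (intro finite_wsep x flow_in)
  have T: "h \<in> T \<longleftrightarrow> h \<in> \<H> \<and> s h 0 \<noteq> s h 1" for h
    by (auto simp: T_def wsep_def s_def stays_def flow_0 x)
  have shift: "s (\<rho> j ` h) i = s h (i - j)" if "h \<in> \<H>" for h i j
    unfolding s_def using stays_shift that x by blast
  have change: "\<rho> (- i) ` h \<in> T" if "h \<in> \<H>" "s h i \<noteq> s h (i + 1)" for h i
    using that shift flow_wall by (simp add: T add.commute)
  have shift_back: "\<rho> i ` \<rho> (- i) ` h = h" if "h \<in> \<H>" for h i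
    using flow_image_add[OF that, of i "- i"] flow_image_0[OF that] by simp
  define per where "per h \<longleftrightarrow> (\<exists>p>0. \<rho> (int p) ` h = h)" for h
  show "\<forall>n. n \<le> card (wsep x (\<rho> (int n) x))"
  proof (rule ccontr)
    assume small: "\<not> ?thesis"
    have nolim: False if "h \<in> \<H>" "\<And>i. i \<ge> M \<Longrightarrow> s h i = b" "\<And>i. i \<le> - M \<Longrightarrow> s h i = (\<not> b)" for h M b
      using wsep_flow_large[OF that(1) x, of M b] that small unfolding s_def by blast
    obtain p where p: "\<And>h. per h \<Longrightarrow> p h > 0 \<and> \<rho> (int (p h)) ` h = h"
    proof -
      define p where "p h = (SOME p. p > 0 \<and> \<rho> (int p) ` h = h)" for h
      have "p h > 0 \<and> \<rho> (int (p h)) ` h = h" if "per h" for h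
        using that unfolding per_def p_def by (rule someI_ex)
      then show ?thesis using that by blast
    qed
    \<comment> \<open>A common multiple of the periods of the periodic members of \<open>T\<close>;
      the \<open>N\<close>-th power preserves these and all their translates.\<close>
    define N where "N = (\<Prod>h\<in>{h\<in>T. per h}. p h)"
    have N: "N > 0" unfolding N_def using p by (intro prod_pos) auto
    have perN: "\<rho> (int N) ` h = h" if h: "h \<in> T" "per h" for h
    proof -
      have hH: "h \<in> \<H>" using h T by blast
      have "p h dvd N" unfolding N_def using finT h by (intro dvd_prodI) auto
      then obtain k where k: "N = p h * k" by blast
      have "\<rho> (int (k * p h)) ` h = h" for k
      proof (induction k)
        case (Suc k)
        have "\<rho> (int (Suc k * p h)) ` h = \<rho> (int (p h)) ` \<rho> (int (k * p h)) ` h"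
          using flow_image_add[OF hH, of "int (p h)" "int (k * p h)"] by simp
        then show ?case using Suc p[OF h(2)] by simp
      qed (simp add: flow_image_0 hH)
      then show ?thesis using k by (simp add: mult.commute)
    qed
    \<comment> \<open>A half-space that no positive power preserves has distinct translates, and
      each change of its sequence places one of them into \<open>T\<close>; so it changes finitely
      often. Its two limits agree because different limits would force linear growth, and the
      indices off the limit form a bounded set.\<close>
    have "\<exists>b L. \<forall>i j. s h i \<noteq> b \<and> s h j \<noteq> b \<longrightarrow> \<bar>i - j\<bar> \<le> L" if h: "h \<in> \<H>" "\<not> per h" for h
    proof -
      have "inj_on (\<lambda>i. \<rho> (- i) ` h) {i. s h i \<noteq> s h (i + 1)}"
      proof (rule linorder_inj_onI', rule notI)
        fix i j :: int assume "i < j" and e: "\<rho> (- i) ` h = \<rho> (- j) ` h"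
        have "\<rho> (j - i) ` h = \<rho> j ` \<rho> (- i) ` h" using flow_image_add[OF h(1), of j "- i"] by simp
        also have "\<dots> = h" using e shift_back h by simp
        finally have "\<rho> (int (nat (j - i))) ` h = h" using \<open>i < j\<close> by simp
        then have "per h" unfolding per_def using \<open>i < j\<close> by (intro exI[of _ "nat (j - i)"]) auto
        then show False using h(2) by blast
      qed
      moreover have "(\<lambda>i. \<rho> (- i) ` h) ` {i. s h i \<noteq> s h (i + 1)} \<subseteq> T" using change h by blast
      ultimately have "finite {i. s h i \<noteq> s h (i + 1)}"
        using finT finite_imageD finite_subset by blast
      then obtain M b c where M: "\<And>i. i \<ge> M \<Longrightarrow> s h i = b" "\<And>i. i \<le> - M \<Longrightarrow> s h i = c"
        using int_ultimately_constant by blast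
      have "c = b" using nolim[OF h(1) M(1)] M(2) by (cases b; cases c) auto
      then have lt: "- M < i \<and> i < M" if "s h i \<noteq> b" for i
        using M(1)[of i] M(2)[of i] that by linarith
      have "\<bar>i - j\<bar> \<le> 2 * M" if "s h i \<noteq> b" "s h j \<noteq> b" for i j
        using lt[OF that(1)] lt[OF that(2)] by linarith
      then show ?thesis by blast
    qed
    \<comment> \<open>Limit and window length are chosen together, as one pair for each
      half-space.\<close>
    then have "\<forall>h\<in>{h \<in> T. \<not> per h}. \<exists>f. \<forall>i j. s h i \<noteq> fst f \<and> s h j \<noteq> fst f \<longrightarrow> \<bar>i - j\<bar> \<le> snd f"
      using T by auto
    then obtain f where f: "\<forall>h\<in>{h \<in> T. \<not> per h}. \<forall>i j. s h i \<noteq> fst (f h) \<and> s h j \<noteq> fst (f h) \<longrightarrow>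
        \<bar>i - j\<bar> \<le> snd (f h)"
      by (elim bchoice[THEN exE]) blast
    define b L where "b h = fst (f h)" and "L h = snd (f h)" for h
    have bL: "\<bar>i - j\<bar> \<le> L h" if "h \<in> T" "\<not> per h" "s h i \<noteq> b h" "s h j \<noteq> b h" for h i j
      using f that by (simp add: b_def L_def)
    define L' where "L' = Max (insert 0 (L ` T))"
    have L': "L h \<le> L'" if "h \<in> T" for h
      unfolding L'_def using that finT by (intro Max_ge) auto
    have L'0: "L' \<ge> 0" unfolding L'_def using finT by (intro Max_ge) auto
    \<comment> \<open>The set of indices where the sequence differs from \<open>c\<close> has
      diameter at most \<open>L'\<close>. Shifting the sequence preserves this, so a bound over the
      finite set \<open>T\<close> serves all translates.\<close>
    define good where "good h c \<longleftrightarrow> (\<forall>i j. s h i \<noteq> c \<and> s h j \<noteq> c \<longrightarrow> \<bar>i - j\<bar> \<le> L')" for h c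
    have good_shift: "good (\<rho> k ` h) c" if "h \<in> \<H>" "good h c" for h c k
      unfolding good_def
    proof (intro allI impI)
      fix i j assume "s (\<rho> k ` h) i \<noteq> c \<and> s (\<rho> k ` h) j \<noteq> c"
      then have "\<bar>(i - k) - (j - k)\<bar> \<le> L'" using that shift unfolding good_def by metis
      then show "\<bar>i - j\<bar> \<le> L'" by simp
    qed
    have dich: "\<rho> (int N) ` h = h \<or> (\<exists>c. good h c)" if h: "h \<in> \<H>" for h
    proof (cases "\<exists>i. s h i \<noteq> s h (i + 1)")
      case False
      then have "s h i = s h 0" for i
        using int_periodic[of "s h" 1 0 i] by auto
      then have "good h (s h 0)" unfolding good_def by blast
      then show ?thesis by blast
    next
      case True
      then obtain i where i: "s h i \<noteq> s h (i + 1)" by blast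
      define h' where "h' = \<rho> (- i) ` h"
      have h': "h' \<in> T" "h' \<in> \<H>" using change[OF h i] T by (auto simp: h'_def)
      have hh': "h = \<rho> i ` h'" using shift_back h by (simp add: h'_def)
      show ?thesis
      proof (cases "per h'")
        case True
        have "\<rho> (int N) ` h = \<rho> i ` \<rho> (int N) ` h'"
          using flow_image_add[OF h'(2), of "int N" i] flow_image_add[OF h'(2), of i "int N"] hh'
          by (simp add: add.commute)
        then show ?thesis using perN[OF h'(1) True] hh' by simp
      next
        case False
        then have "good h' (b h')" unfolding good_def using bL[OF h'(1) False] L'[OF h'(1)]
          by (meson order_trans)
        then show ?thesis using good_shift[OF h'(2)] hh' by blast
      qed
    qed
    \<comment> \<open>The indices 0, \<open>a\<close> and \<open>2 * a\<close> are pairwise more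
      than \<open>L'\<close> apart. Hence at most one of them lies in the window of a good
      half-space, and the median takes the limiting value \<open>c\<close>.\<close>
    define a where "a = int N * (L' + 1)"
    have "1 * (L' + 1) \<le> a" unfolding a_def using N L'0 by (intro mult_right_mono) auto
    then have "L' + 1 \<le> a" by (simp only: mult_1)
    then have aL: "a > L'" by linarith
    obtain y where y: "y \<in> X" "\<And>h. h \<in> \<H> \<Longrightarrow>
        y \<in> h \<longleftrightarrow> (s h 0 \<and> s h a) \<or> (s h 0 \<and> s h (2 * a)) \<or> (s h a \<and> s h (2 * a))"
      using wall_median[of "\<rho> 0 x" "\<rho> a x" "\<rho> (2 * a) x"] flow_in[OF x]
      unfolding s_def stays_def by blast
    have ygood: "y \<in> h \<longleftrightarrow> c" if "h \<in> \<H>" "good h c" for h c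
    proof -
      have "\<not> (s h 0 \<noteq> c \<and> s h a \<noteq> c)" "\<not> (s h 0 \<noteq> c \<and> s h (2 * a) \<noteq> c)"
        "\<not> (s h a \<noteq> c \<and> s h (2 * a) \<noteq> c)"
        using that(2)[unfolded good_def, THEN spec, THEN spec, THEN mp] aL L'0 by force+
      then show ?thesis using y(2)[OF that(1)] by blast
    qed
    \<comment> \<open>A half-space separating \<open>y\<close> from its image is not preserved by
      the \<open>N\<close>-th power, hence it is good. Its translate is good with the same limit
      \<open>c\<close>, so both have the same answer for \<open>y\<close>, a contradiction.\<close>
    have "\<rho> (int N) y = y"
    proof (rule ccontr)
      assume "\<rho> (int N) y \<noteq> y"
      then obtain h where h: "h \<in> \<H>" "y \<in> h" "\<rho> (int N) y \<notin> h"
        using wall_separates[of y "\<rho> (int N) y"] y(1) flow_in[OF y(1)] by auto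
      have mem: "y \<in> \<rho> (- int N) ` h \<longleftrightarrow> \<rho> (int N) y \<in> h"
        using flow_mem_image[OF h(1) y(1), of "- int N"] by simp
      have "\<rho> (int N) ` h \<noteq> h"
      proof
        assume "\<rho> (int N) ` h = h"
        then have "\<rho> (- int N) ` h = h" using shift_back[OF h(1), of "- int N"] by simp
        then show False using mem h by simp
      qed
      then obtain c where "good h c" using dich h by blast
      then show False using ygood good_shift h mem flow_wall by blast
    qed
    then show False using fixd N y(1) by blast
  qed
qed

end

context median_graph
begin

lemma wall_space: "wall_space V halfspaces"
  by unfold_locales
    (fact halfspaces_subset halfspaces_compl finite_separating halfspaces_separate median_exists)+

end

locale wall_action = wall_space X \<H> + group G
  for X :: "'v set" and \<H> and G :: "('g, 'm) monoid_scheme" (structure) +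
  fixes \<phi> :: "'g \<Rightarrow> 'v \<Rightarrow> 'v"
  assumes act_in: "g \<in> carrier G \<Longrightarrow> y \<in> X \<Longrightarrow> \<phi> g y \<in> X"
    and act_mult: "g \<in> carrier G \<Longrightarrow> k \<in> carrier G \<Longrightarrow> y \<in> X \<Longrightarrow> \<phi> (g \<otimes> k) y = \<phi> g (\<phi> k y)"
    and act_one: "y \<in> X \<Longrightarrow> \<phi> \<one> y = y"
    and act_wall: "g \<in> carrier G \<Longrightarrow> h \<in> \<H> \<Longrightarrow> \<phi> g ` h \<in> \<H>"
    and act_proper: "y \<in> X \<Longrightarrow> finite {g \<in> carrier G. \<phi> g y = y}"
begin

definition wlength :: "'v \<Rightarrow> 'g \<Rightarrow> nat" where "wlength x g = card (wsep x (\<phi> g x))"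

lemma act_inv: "g \<in> carrier G \<Longrightarrow> y \<in> X \<Longrightarrow> \<phi> (inv g) (\<phi> g y) = y"
  using act_mult[of "inv g" g y] act_one by simp

lemma card_wsep_act_le:
  assumes "g \<in> carrier G" "x \<in> X" "y \<in> X"
  shows "card (wsep x y) \<le> card (wsep (\<phi> g x) (\<phi> g y))"
proof (rule card_inj_on_le[of "\<lambda>h. \<phi> g ` h"])
  have inj: "inj_on (\<phi> g) X" by (metis inj_onI act_inv assms(1))
  then show "inj_on (\<lambda>h. \<phi> g ` h) (wsep x y)"
    by (intro inj_onI) (auto simp: wsep_def inj_on_image_eq_iff[OF _ wall_subset wall_subset])
  show "(\<lambda>h. \<phi> g ` h) ` wsep x y \<subseteq> wsep (\<phi> g x) (\<phi> g y)"
    using act_wall[OF assms(1)] inj_on_image_mem_iff[OF inj _ wall_subset] assms(2,3)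
    unfolding wsep_def by blast
qed (intro finite_wsep act_in assms)

lemma card_wsep_act:
  assumes "g \<in> carrier G" "x \<in> X" "y \<in> X"
  shows "card (wsep (\<phi> g x) (\<phi> g y)) = card (wsep x y)"
  using card_wsep_act_le[OF assms] card_wsep_act_le[of "inv g" "\<phi> g x" "\<phi> g y"]
    act_inv act_in assms by simp

lemma wlength_mult:
  assumes "x \<in> X" "g \<in> carrier G" "k \<in> carrier G"
  shows "wlength x (g \<otimes> k) \<le> wlength x g + wlength x k"
  using card_wsep_triangle[of x "\<phi> g x" "\<phi> g (\<phi> k x)"] card_wsep_act[of g x "\<phi> k x"]
    act_mult[of g k x] act_in assms by (simp add: wlength_def)

lemma wlength_inv:
  assumes "x \<in> X" "g \<in> carrier G"
  shows "wlength x (inv g) = wlength x g"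
  using card_wsep_act[of g x "\<phi> (inv g) x"] act_inv[of "inv g" x] act_in assms wsep_sym
  by (simp add: wlength_def)

text \<open>If a positive power of \<open>g\<close> fixed a point, infinitely many powers of
  \<open>g\<close> would lie in a finite stabiliser; this leaves the alternative of linear
  growth.\<close>

lemma wlength_pow:
  assumes x: "x \<in> X" and g: "g \<in> carrier G" and inf: "\<And>n::nat. n > 0 \<Longrightarrow> g [^] n \<noteq> \<one>"
  shows "n \<le> wlength x (g [^] (n::nat))"
proof -
  interpret F: wall_flow X \<H> "\<lambda>i. \<phi> (g [^] (i::int))"
    by unfold_locales (auto simp: act_in act_wall g int_pow_mult act_mult act_one)
  have "\<not> (\<exists>N>0. \<exists>y\<in>X. \<phi> (g [^] int N) y = y)"
  proof
    assume "\<exists>N>0. \<exists>y\<in>X. \<phi> (g [^] int N) y = y"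
    then obtain N y where N: "N > 0" "y \<in> X" "\<phi> (g [^] (N::nat)) y = y"
      unfolding int_pow_int by blast
    have fixk: "\<phi> ((g [^] N) [^] (k::nat)) y = y" for k
      by (induction k) (use N g act_mult act_one in auto)
    have "inj_on (\<lambda>k::nat. (g [^] N) [^] k) UNIV"
    proof (rule linorder_inj_onI', rule notI)
      fix i j :: nat assume "i < j" "(g [^] N) [^] i = (g [^] N) [^] j"
      then have "(g [^] N) [^] (j - i) = \<one>" using g
        by (metis nat_pow_closed pow_eq_div2)
      then have "g [^] (N * (j - i)) = \<one>" using g by (simp add: nat_pow_pow)
      then show False using inf[of "N * (j - i)"] N \<open>i < j\<close> by simp
    qed
    moreover have "range (\<lambda>k::nat. (g [^] N) [^] k) \<subseteq> {k \<in> carrier G. \<phi> k y = y}"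
      using fixk g by auto
    ultimately show False using act_proper[OF N(2)] 
      by (metis finite_imageD finite_subset infinite_UNIV_nat)
  qed
  then show ?thesis using F.flow_large_or_fixed[OF x] unfolding wlength_def int_pow_int by blast
qed

end

section \<open>Finite index and free abelian subgroups\<close>

text \<open>Finitely many left cosets of \<open>K\<close> cover \<open>H\<close>. The condition is
  expressed in the ambient group, so that chains of subgroups compose without change of
  group.\<close>

definition fin_index :: "('g, 'm) monoid_scheme \<Rightarrow> 'g set \<Rightarrow> 'g set \<Rightarrow> bool" where
  "fin_index G H K \<longleftrightarrow> (\<exists>F. finite F \<and> F \<subseteq> H \<and> (\<forall>h\<in>H. \<exists>f\<in>F. inv\<^bsub>G\<^esub> f \<otimes>\<^bsub>G\<^esub> h \<in> K))"

context group
begin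

text \<open>One representative is taken for each value of an invariant that separates left
  cosets.\<close>

lemma fin_indexI:
  assumes "finite (\<theta> ` H)"
    and "\<And>g k. g \<in> H \<Longrightarrow> k \<in> H \<Longrightarrow> \<theta> g = \<theta> k \<Longrightarrow> inv g \<otimes> k \<in> K"
  shows "fin_index G H K"
  unfolding fin_index_def
proof (intro exI conjI ballI)
  define r where "r c = (SOME g. g \<in> H \<and> \<theta> g = c)" for c
  have r: "r (\<theta> h) \<in> H \<and> \<theta> (r (\<theta> h)) = \<theta> h" if "h \<in> H" for h
    unfolding r_def by (rule someI[of _ h]) (use that in simp)
  show "finite (r ` \<theta> ` H)" using assms(1) by simp
  show "r ` \<theta> ` H \<subseteq> H" using r by auto
  show "\<exists>f\<in>r ` \<theta> ` H. inv f \<otimes> h \<in> K" if "h \<in> H" for h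
    using r[OF that] assms(2) that by auto
qed

lemma mult_cancel_mid:
  assumes "g \<in> carrier G" "f \<in> carrier G" "k \<in> carrier G"
  shows "inv (inv f \<otimes> g) \<otimes> (inv f \<otimes> k) = inv g \<otimes> k"
proof -
  have "inv (inv f \<otimes> g) \<otimes> (inv f \<otimes> k) = inv g \<otimes> (f \<otimes> (inv f \<otimes> k))"
    using assms by (simp add: inv_mult_group m_assoc)
  also have "f \<otimes> (inv f \<otimes> k) = k" using assms by (simp add: m_assoc[symmetric])
  finally show ?thesis .
qed

lemma fin_indexE:
  assumes "fin_index G H K" "subgroup H G" "subgroup K G"
  obtains \<theta> :: "'a \<Rightarrow> 'a" where "finite (\<theta> ` H)"
    "\<And>g k. g \<in> H \<Longrightarrow> k \<in> H \<Longrightarrow> \<theta> g = \<theta> k \<Longrightarrow> inv g \<otimes> k \<in> K"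
proof -
  obtain F where F: "finite F" "F \<subseteq> H" "\<And>h. h \<in> H \<Longrightarrow> \<exists>f\<in>F. inv f \<otimes> h \<in> K"
    using assms(1) unfolding fin_index_def by blast
  define \<theta> where "\<theta> h = (SOME f. f \<in> F \<and> inv f \<otimes> h \<in> K)" for h
  have \<theta>: "\<theta> h \<in> F \<and> inv (\<theta> h) \<otimes> h \<in> K" if "h \<in> H" for h
    unfolding \<theta>_def by (rule someI_ex) (use F(3)[OF that] in blast)
  show ?thesis
  proof
    show "finite (\<theta> ` H)" using \<theta> F(1) by (meson finite_subset image_subsetI)
    fix g k assume gk: "g \<in> H" "k \<in> H" "\<theta> g = \<theta> k"
    have c: "g \<in> carrier G" "k \<in> carrier G" "\<theta> g \<in> carrier G"
      using gk \<theta> F(2) subgroup.mem_carrier[OF assms(2)] by blast+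
    have "inv (inv (\<theta> g) \<otimes> g) \<otimes> (inv (\<theta> g) \<otimes> k) \<in> K"
      using \<theta>[OF gk(1)] \<theta>[OF gk(2)] gk(3) subgroup.m_closed[OF assms(3)]
        subgroup.m_inv_closed[OF assms(3)] by simp
    then show "inv g \<otimes> k \<in> K" using mult_cancel_mid c by simp
  qed
qed

lemma fin_index_trans:
  assumes "fin_index G H K" "fin_index G K L" "subgroup H G" "subgroup K G" "K \<subseteq> H"
  shows "fin_index G H L"
proof -
  obtain F where F: "finite F" "F \<subseteq> H" "\<And>h. h \<in> H \<Longrightarrow> \<exists>f\<in>F. inv f \<otimes> h \<in> K"
    using assms(1) unfolding fin_index_def by blast
  obtain F' where F': "finite F'" "F' \<subseteq> K" "\<And>h. h \<in> K \<Longrightarrow> \<exists>f\<in>F'. inv f \<otimes> h \<in> L"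
    using assms(2) unfolding fin_index_def by blast
  have car: "H \<subseteq> carrier G" using subgroup.subset assms(3) by blast
  show ?thesis unfolding fin_index_def
  proof (intro exI conjI ballI)
    show "finite ((\<lambda>(f, f'). f \<otimes> f') ` (F \<times> F'))" using F F' by simp
    show "(\<lambda>(f, f'). f \<otimes> f') ` (F \<times> F') \<subseteq> H"
      using F(2) F'(2) assms(5) by (auto intro!: subgroup.m_closed[OF assms(3)])
    fix h assume h: "h \<in> H"
    obtain f where f: "f \<in> F" "inv f \<otimes> h \<in> K" using F(3)[OF h] by blast
    obtain f' where f': "f' \<in> F'" "inv f' \<otimes> (inv f \<otimes> h) \<in> L" using F'(3)[OF f(2)] by blast
    have "f \<in> carrier G" "f' \<in> carrier G" "h \<in> carrier G"
      using f f' h F F' assms(5) car by blast+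
    then have "inv (f \<otimes> f') \<otimes> h \<in> L" using f'(2) by (simp add: inv_mult_group m_assoc)
    then show "\<exists>x\<in>(\<lambda>(f, f'). f \<otimes> f') ` (F \<times> F'). inv x \<otimes> h \<in> L" using f f' by auto
  qed
qed

text \<open>Among the first \<open>c + 1\<close> powers of \<open>h\<close> two lie in the same one
  of at most \<open>c\<close> classes, so some exponent up to \<open>c\<close> works. It depends on
  \<open>h\<close>, since \<open>K\<close> may fail to be normal; the factorial of \<open>c\<close>
  is a common multiple.\<close>

lemma fin_index_pow:
  assumes "fin_index G H K" "subgroup H G" "subgroup K G"
  obtains m :: nat where "m > 0" "\<And>h. h \<in> H \<Longrightarrow> h [^] m \<in> K"
proof -
  obtain \<theta> :: "'a \<Rightarrow> 'a" where \<theta>: "finite (\<theta> ` H)"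
    "\<And>g k. g \<in> H \<Longrightarrow> k \<in> H \<Longrightarrow> \<theta> g = \<theta> k \<Longrightarrow> inv g \<otimes> k \<in> K"
    using fin_indexE[OF assms] by blast
  define c where "c = card (\<theta> ` H)"
  have "h [^] (fact c :: nat) \<in> K" if h: "h \<in> H" for h
  proof -
    have hc: "h \<in> carrier G" using subgroup.mem_carrier[OF assms(2) h] .
    have hp: "h [^] (i::nat) \<in> H" for i
      using h subgroup.one_closed[OF assms(2)] subgroup.m_closed[OF assms(2)] by (induction i) auto
    have "\<not> inj_on (\<lambda>i::nat. \<theta> (h [^] i)) {..c}"
    proof
      assume "inj_on (\<lambda>i::nat. \<theta> (h [^] i)) {..c}"
      then have "card {..c} \<le> card (\<theta> ` H)"
        using hp \<theta>(1) by (intro card_inj_on_le[of "\<lambda>i::nat. \<theta> (h [^] i)"]) auto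
      then show False by (simp add: c_def)
    qed
    then obtain i j where ij: "i < j" "j \<le> c" "\<theta> (h [^] i) = \<theta> (h [^] j)"
      unfolding inj_on_def by (metis atMost_iff linorder_neqE_nat)
    have "inv (h [^] i) \<otimes> h [^] j \<in> K" using \<theta>(2) hp ij by blast
    moreover have "h [^] j = h [^] i \<otimes> h [^] (j - i)" using hc ij by (simp add: nat_pow_mult)
    ultimately have K: "h [^] (j - i) \<in> K" using hc by (simp add: m_assoc[symmetric])
    have "(j - i) dvd fact c" using ij by (intro dvd_fact) auto
    then obtain k where "fact c = (j - i) * k" by blast
    then have "h [^] (fact c :: nat) = (h [^] (j - i)) [^] k" using hc by (simp add: nat_pow_pow)
    moreover have "(h [^] (j - i)) [^] k \<in> K"
      using K subgroup.one_closed[OF assms(3)] subgroup.m_closed[OF assms(3)] by (induction k) auto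
    ultimately show ?thesis by simp
  qed
  then show ?thesis using that[of "fact c"] by simp
qed

lemma fin_index_rcosets:
  assumes "fin_index G (carrier G) H" "subgroup H G"
  shows "finite (rcosets H)"
proof -
  obtain F where F: "finite F" "F \<subseteq> carrier G" "\<And>h. h \<in> carrier G \<Longrightarrow> \<exists>f\<in>F. inv f \<otimes> h \<in> H"
    using assms(1) unfolding fin_index_def by blast
  \<comment> \<open>Inversion exchanges left and right cosets.\<close>
  have "rcosets H \<subseteq> (\<lambda>f. H #> inv f) ` F"
  proof
    fix c assume "c \<in> rcosets H"
    then obtain g where g: "g \<in> carrier G" "c = H #> g" by (auto simp: RCOSETS_def)
    obtain f where f: "f \<in> F" "inv f \<otimes> inv g \<in> H" using F(3)[of "inv g"] g by auto
    have fc: "f \<in> carrier G" using f F by blast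
    have "inv (inv f \<otimes> inv g) \<in> H" using subgroup.m_inv_closed[OF assms(2) f(2)] .
    then have "g \<otimes> f \<in> H" using fc g by (simp add: inv_mult_group)
    moreover have "g = (g \<otimes> f) \<otimes> inv f" using fc g by (simp add: m_assoc)
    ultimately have "g \<in> H #> inv f" unfolding r_coset_def by blast
    then have "c = H #> inv f" using repr_independence[of g H "inv f"] assms(2) g fc by simp
    then show "c \<in> (\<lambda>f. H #> inv f) ` F" using f by blast
  qed
  then show ?thesis using F(1) finite_surj by blast
qed

end

section \<open>Exponent vectors in finitely generated abelian groups\<close>

context comm_group
begin

primrec monomial :: "(nat \<Rightarrow> 'a) \<Rightarrow> nat \<Rightarrow> (nat \<Rightarrow> int) \<Rightarrow> 'a" where
  "monomial a 0 e = \<one>"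
| "monomial a (Suc n) e = monomial a n e \<otimes> a n [^] e n"

lemma monomial_closed: "a ` {..<n} \<subseteq> carrier G \<Longrightarrow> monomial a n e \<in> carrier G"
  by (induction n) (auto simp: lessThan_Suc)

lemma monomial_cong: "(\<And>i. i < n \<Longrightarrow> e i = f i) \<Longrightarrow> monomial a n e = monomial a n f"
  by (induction n) auto

lemma monomial_add:
  "a ` {..<n} \<subseteq> carrier G \<Longrightarrow>
    monomial a n (\<lambda>i. e i + f i) = monomial a n e \<otimes> monomial a n f"
proof (induction n)
  case (Suc n)
  then have "a n \<in> carrier G" "a ` {..<n} \<subseteq> carrier G" by (auto simp: lessThan_Suc)
  then show ?case using Suc monomial_closed[of a n] by (simp add: int_pow_mult m_ac)
qed simp

lemma monomial_zero: "a ` {..<n} \<subseteq> carrier G \<Longrightarrow> monomial a n (\<lambda>i. 0) = \<one>"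
  by (induction n) (auto simp: lessThan_Suc)

lemma monomial_uminus:
  assumes "a ` {..<n} \<subseteq> carrier G"
  shows "monomial a n (\<lambda>i. - e i) = inv (monomial a n e)"
proof -
  have "monomial a n (\<lambda>i. - e i) \<otimes> monomial a n e = \<one>"
    using monomial_add[OF assms, of "\<lambda>i. - e i" e] monomial_zero[OF assms] by simp
  then show ?thesis using inv_equality monomial_closed[OF assms] by metis
qed

lemma monomial_scale:
  "a ` {..<n} \<subseteq> carrier G \<Longrightarrow> monomial a n (\<lambda>i. k * e i) = monomial a n e [^] (k::int)"
proof (induction n)
  case (Suc n)
  then have "a n \<in> carrier G" "a ` {..<n} \<subseteq> carrier G" by (auto simp: lessThan_Suc)
  then show ?case using Suc monomial_closed[of a n]
    by (simp add: int_pow_distrib int_pow_pow mult.commute)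
qed simp

lemma monomial_single:
  "a ` {..<n} \<subseteq> carrier G \<Longrightarrow> i < n \<Longrightarrow> monomial a n (\<lambda>j. if j = i then 1 else 0) = a i"
proof (induction n)
  case (Suc n)
  then have "a n \<in> carrier G" "a ` {..<n} \<subseteq> carrier G" by (auto simp: lessThan_Suc)
  then show ?case using Suc monomial_zero[of a n] monomial_closed[of a n]
      monomial_cong[of n "\<lambda>j. if j = i then 1 else 0" "\<lambda>j. 0" a]
    by (cases "i = n") auto
qed simp

lemma monomial_generate:
  assumes "a ` {..<n} \<subseteq> carrier G" "g \<in> generate G (a ` {..<n})"
  shows "\<exists>e. g = monomial a n e"
  using assms(2)
proof (induction rule: generate.induct)
  case one
  show ?case using monomial_zero[OF assms(1)] by metis
next
  case (incl h)
  then show ?case using monomial_single[OF assms(1)] by (metis imageE lessThan_iff)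
next
  case (inv h)
  then obtain i where "h = a i" "i < n" by auto
  then show ?case using monomial_single[OF assms(1), of i] monomial_uminus[OF assms(1)] by metis
next
  case (eng h1 h2)
  then show ?case using monomial_add[OF assms(1)] by metis
qed

lemma monomial_in_subgroup:
  assumes "subgroup H G" "a ` {..<n} \<subseteq> H"
  shows "monomial a n e \<in> H"
  using assms(2)
proof (induction n)
  case (Suc n)
  then have "a n \<in> H" "a ` {..<n} \<subseteq> H" by (auto simp: lessThan_Suc)
  then show ?case using Suc subgroup_int_pow_closed[OF assms(1)] subgroup.m_closed[OF assms(1)]
    by simp
qed (simp add: subgroup.one_closed[OF assms(1)])

text \<open>Exponents modulo \<open>m\<close> take finitely many values, and two elements with the
  same residues differ by a product of \<open>m\<close>-th powers of generators.\<close>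

lemma fin_index_of_powers:
  assumes S: "finite S" "S \<subseteq> carrier G" "generate G S = carrier G" and H: "subgroup H G"
    and m: "m > 0" "\<And>s. s \<in> S \<Longrightarrow> s [^] (m::nat) \<in> H"
  shows "fin_index G (carrier G) H"
proof -
  obtain a n where a: "S = a ` {..<n::nat}"
    using S(1) finite_imp_nat_seg_image_inj_on by (metis lessThan_def)
  then have aS: "a ` {..<n} \<subseteq> carrier G" using S by simp
  \<comment> \<open>Exponent vectors are not unique in the presence of relations; one is fixed for
    each element.\<close>
  define e where "e g = (SOME e. g = monomial a n e)" for g
  have e: "g = monomial a n (e g)" if "g \<in> carrier G" for g
  proof -
    have "\<exists>e. g = monomial a n e" using monomial_generate[OF aS] that S(3) a by simp
    then show ?thesis unfolding e_def by (rule someI_ex)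
  qed
  define \<theta> where "\<theta> g = (\<lambda>i\<in>{..<n}. e g i mod int m)" for g
  have "\<theta> ` carrier G \<subseteq> {..<n} \<rightarrow>\<^sub>E {0..<int m}" using m(1) by (auto simp: \<theta>_def split: if_splits)
  then have "finite (\<theta> ` carrier G)" by (rule finite_subset) (simp add: finite_PiE)
  then show ?thesis
  proof (rule fin_indexI)
    fix g k assume gk: "g \<in> carrier G" "k \<in> carrier G" "\<theta> g = \<theta> k"
    define f where "f i = (e k i - e g i) div int m" for i
    have "e k i - e g i = int m * f i" if "i < n" for i
    proof -
      have "e g i mod int m = e k i mod int m" using fun_cong[OF gk(3), of i] that by (simp add: \<theta>_def)
      then have "int m dvd e k i - e g i" by (metis mod_eq_dvd_iff)
      then show ?thesis by (simp add: f_def)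
    qed
    then have "monomial a n (\<lambda>i. - e g i + e k i) = monomial a n (\<lambda>i. int m * f i)"
      by (intro monomial_cong) auto
    moreover have "monomial a n (\<lambda>i. int m * f i) = monomial (\<lambda>i. a i [^] m) n f"
      using aS
    proof (induction n)
      case (Suc n)
      then have "a n \<in> carrier G" "a ` {..<n} \<subseteq> carrier G" by (auto simp: lessThan_Suc)
      then show ?case using Suc by (simp add: int_pow_pow int_pow_int[symmetric])
    qed simp
    moreover have "monomial (\<lambda>i. a i [^] m) n f \<in> H"
      using m(2) a by (intro monomial_in_subgroup H) auto
    ultimately show "inv g \<otimes> k \<in> H"
      using monomial_add[OF aS, of "\<lambda>i. - e g i" "e k"] monomial_uminus[OF aS, of "e g"] e gk(1,2)
      by metis
  qed
qed

section \<open>Independent sets and the subgroups that they span\<close>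

definition indep :: "'a set \<Rightarrow> bool" where
  "indep B \<longleftrightarrow> (\<forall>f :: 'a \<Rightarrow> int. (\<Otimes>b\<in>B. b [^] f b) = \<one> \<longrightarrow> (\<forall>b\<in>B. f b = 0))"

definition spanned :: "'a set \<Rightarrow> 'a set" where
  "spanned B = range (\<lambda>f :: 'a \<Rightarrow> int. \<Otimes>b\<in>B. b [^] f b)"

lemma spannedI: "(\<Otimes>b\<in>B. b [^] (f b :: int)) \<in> spanned B"
  by (simp add: spanned_def)

lemma spannedE:
  assumes "x \<in> spanned B"
  obtains f where "x = (\<Otimes>b\<in>B. b [^] (f b :: int))"
  using assms by (auto simp: spanned_def)

lemma powers_closed: "B \<subseteq> carrier G \<Longrightarrow> (\<lambda>b. b [^] (f b :: int)) \<in> B \<rightarrow> carrier G"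
  by auto

lemma finprod_powers_add:
  assumes "B \<subseteq> carrier G"
  shows "(\<Otimes>b\<in>B. b [^] (f b + g b :: int)) = (\<Otimes>b\<in>B. b [^] f b) \<otimes> (\<Otimes>b\<in>B. b [^] g b)"
proof -
  have "(\<Otimes>b\<in>B. b [^] f b \<otimes> b [^] g b) = (\<Otimes>b\<in>B. b [^] f b) \<otimes> (\<Otimes>b\<in>B. b [^] g b)"
    using assms by (intro finprod_multf powers_closed)
  moreover have "(\<Otimes>b\<in>B. b [^] f b \<otimes> b [^] g b) = (\<Otimes>b\<in>B. b [^] (f b + g b))"
    using assms by (intro finprod_cong') (auto simp: int_pow_mult)
  ultimately show ?thesis by simp
qed

lemma finprod_powers_zero: "(\<Otimes>b\<in>B. b [^] (0::int)) = \<one>"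
  by (intro finprod_one_eqI) auto

lemma finprod_powers_uminus:
  assumes "B \<subseteq> carrier G"
  shows "(\<Otimes>b\<in>B. b [^] (- f b :: int)) = inv (\<Otimes>b\<in>B. b [^] f b)"
proof -
  have "(\<Otimes>b\<in>B. b [^] (- f b)) \<otimes> (\<Otimes>b\<in>B. b [^] f b) = \<one>"
    using finprod_powers_add[OF assms, of "\<lambda>b. - f b" f] finprod_powers_zero by simp
  then show ?thesis using inv_equality finprod_closed powers_closed[OF assms] by metis
qed

lemma finprod_powers_scale:
  assumes "B \<subseteq> carrier G"
  shows "(\<Otimes>b\<in>B. b [^] (f b :: int)) [^] (n::nat) = (\<Otimes>b\<in>B. b [^] (int n * f b))"
proof (induction n)
  case 0
  then show ?case using finprod_powers_zero by simp
next
  case (Suc n)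
  then show ?case using finprod_powers_add[OF assms, of "\<lambda>b. int n * f b" f]
    by (simp add: algebra_simps)
qed

lemma subgroup_spanned:
  assumes "B \<subseteq> carrier G"
  shows "subgroup (spanned B) G"
proof (rule subgroupI)
  show "spanned B \<subseteq> carrier G" using powers_closed[OF assms] by (auto simp: spanned_def)
  show "spanned B \<noteq> {}" by (simp add: spanned_def)
  show "inv x \<in> spanned B" if "x \<in> spanned B" for x
    using that by (elim spannedE) (simp add: finprod_powers_uminus[OF assms, symmetric] spannedI)
  show "x \<otimes> y \<in> spanned B" if "x \<in> spanned B" "y \<in> spanned B" for x y
    using that by (elim spannedE) (simp add: finprod_powers_add[OF assms, symmetric] spannedI)
qed

lemma spanned_torsion_free:
  assumes "B \<subseteq> carrier G" "indep B" "x \<in> spanned B" "x [^] (n::nat) = \<one>" "n > 0"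
  shows "x = \<one>"
proof -
  obtain f where f: "x = (\<Otimes>b\<in>B. b [^] (f b :: int))" using assms(3) by (auto simp: spanned_def)
  then have "(\<Otimes>b\<in>B. b [^] (int n * f b)) = \<one>" using assms(4) finprod_powers_scale[OF assms(1)] by simp
  then have "\<forall>b\<in>B. int n * f b = 0"
    using assms(2)[unfolded indep_def, rule_format, of "\<lambda>b. int n * f b"] by blast
  then have "\<forall>b\<in>B. f b = 0" using assms(5) by simp
  then have "x = (\<Otimes>b\<in>B. b [^] (0::int))" unfolding f by (intro finprod_cong') (use assms(1) in auto)
  then show ?thesis using finprod_powers_zero by simp
qed

text \<open>A largest independent subset of a finite generating set does it: each further generator
  satisfies a relation with the subset, so one of its powers lies in the span, and
  \<open>fin_index_of_powers\<close> applies.\<close>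

lemma exists_indep_fin_index:
  assumes S: "finite S" "S \<subseteq> carrier G" "generate G S = carrier G"
  obtains B where "finite B" "B \<subseteq> carrier G" "indep B" "fin_index G (carrier G) (spanned B)"
proof -
  have ind0: "indep {}" by (simp add: indep_def)
  define P where "P B \<longleftrightarrow> B \<subseteq> S \<and> indep B" for B
  have "\<exists>B. P B \<and> (\<forall>C. P C \<longrightarrow> card C \<le> card B)"
    by (rule ex_has_greatest_nat[of P "{}" card "Suc (card S)"])
      (use S(1) ind0 in \<open>auto simp: P_def less_Suc_eq_le intro: card_mono\<close>)
  then obtain B where B: "B \<subseteq> S" "indep B" and max: "\<And>C. C \<subseteq> S \<Longrightarrow> indep C \<Longrightarrow> card C \<le> card B"
    unfolding P_def by blast
  have Bf: "finite B" "B \<subseteq> carrier G" using B S finite_subset by auto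
  have sub: "subgroup (spanned B) G" by (rule subgroup_spanned) fact
  have pow: "\<exists>k>0. s [^] (k::nat) \<in> spanned B" if s: "s \<in> S" for s
  proof (cases "s \<in> B")
    case True
    have "(\<Otimes>b\<in>B. b [^] (if b = s then 1 else 0 :: int)) = s"
    proof -
      have "(\<Otimes>b\<in>B. b [^] (if b = s then 1 else 0 :: int)) = (\<Otimes>b\<in>B. if s = b then b else \<one>)"
        by (intro finprod_cong') (use Bf in auto)
      also have "\<dots> = s" using finprod_singleton[OF True Bf(1), of "\<lambda>b. b"] Bf by auto
      finally show ?thesis .
    qed
    then have "s \<in> spanned B" using spannedI[where f = "\<lambda>b. if b = s then 1 else 0" and B = B] by simp
    then show ?thesis using s S by (intro exI[of _ 1]) auto
  next
    case False
    \<comment> \<open>By maximality there is a relation. Its exponent at \<open>s\<close> is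
      non-zero, since otherwise it would be a relation within \<open>B\<close>.\<close>
    then have "\<not> indep (insert s B)" using max[of "insert s B"] s B Bf by auto
    then obtain f where f: "(\<Otimes>b\<in>insert s B. b [^] (f b :: int)) = \<one>" "\<exists>b\<in>insert s B. f b \<noteq> 0"
      unfolding indep_def by blast
    have sc: "s \<in> carrier G" using s S by blast
    have pc: "(\<Otimes>b\<in>B. b [^] f b) \<in> carrier G" using powers_closed[OF Bf(2)] by (rule finprod_closed)
    have 1: "s [^] f s \<otimes> (\<Otimes>b\<in>B. b [^] f b) = \<one>"
      using f(1) finprod_insert[OF Bf(1) False powers_closed[OF Bf(2)], of f] sc by simp
    have fs: "f s \<noteq> 0"
    proof
      assume "f s = 0"
      then have "(\<Otimes>b\<in>B. b [^] f b) = \<one>" using 1 pc by simp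
      then have "\<forall>b\<in>B. f b = 0" using B(2) unfolding indep_def by blast
      then show False using f(2) \<open>f s = 0\<close> by auto
    qed
    have "s [^] f s = inv (\<Otimes>b\<in>B. b [^] f b)" using inv_equality[OF 1 pc] sc by simp
    then have sB: "s [^] f s \<in> spanned B"
      using subgroup.m_inv_closed[OF sub spannedI] by simp
    have "s [^] nat \<bar>f s\<bar> \<in> spanned B"
    proof (cases "f s \<ge> 0")
      case True
      then show ?thesis using sB by (simp add: int_pow_int[symmetric])
    next
      case False
      then have "s [^] (- f s) \<in> spanned B"
        using subgroup.m_inv_closed[OF sub sB] sc by (simp add: int_pow_neg)
      then show ?thesis using False by (simp add: int_pow_int[symmetric])
    qed
    then show ?thesis using fs by (intro exI[of _ "nat \<bar>f s\<bar>"]) auto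
  qed
  then have "\<forall>s\<in>S. \<exists>k::nat. k > 0 \<and> s [^] k \<in> spanned B" by blast
  then obtain k where k: "\<And>s. s \<in> S \<Longrightarrow> k s > 0 \<and> s [^] (k s :: nat) \<in> spanned B"
    by (elim bchoice[THEN exE]) blast
  define m where "m = (\<Prod>s\<in>S. k s)"
  have "m > 0" unfolding m_def using k by (intro prod_pos) auto
  moreover have "s [^] m \<in> spanned B" if "s \<in> S" for s
  proof -
    have "k s dvd m" unfolding m_def using S(1) that by (intro dvd_prodI) auto
    then obtain j where "m = k s * j" by blast
    then have "s [^] m = (s [^] k s) [^] j" using that S by (simp add: nat_pow_pow subset_iff)
    moreover have "(s [^] k s) [^] j \<in> spanned B"
      using k[OF that] subgroup.one_closed[OF sub] subgroup.m_closed[OF sub] by (induction j) auto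
    ultimately show ?thesis by simp
  qed
  ultimately have "fin_index G (carrier G) (spanned B)"
    using fin_index_of_powers[OF S sub] by blast
  then show ?thesis using that Bf B(2) by blast
qed

lemma spanned_iso_free:
  assumes "finite B" "B \<subseteq> carrier G" "indep B"
  shows "G\<lparr>carrier := spanned B\<rparr> \<cong> free_Abelian_group B"
proof -
  define h where "h c = (\<Otimes>b\<in>B. b [^] Poly_Mapping.lookup c b)" for c :: "'a \<Rightarrow>\<^sub>0 int"
  have hom: "h \<in> hom (free_Abelian_group B) (G\<lparr>carrier := spanned B\<rparr>)"
    by (rule homI) (auto simp: h_def spanned_def lookup_add finprod_powers_add[OF assms(2)])
  have keys: "c = 0" if "\<forall>b\<in>B. Poly_Mapping.lookup c b = 0" "Poly_Mapping.keys c \<subseteq> B"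
    for c :: "'a \<Rightarrow>\<^sub>0 int"
    using that by (intro poly_mapping_eqI) (auto simp: in_keys_iff)
  have "inj_on h (carrier (free_Abelian_group B))"
  proof (rule inj_onI)
    fix c d assume cd: "c \<in> carrier (free_Abelian_group B)" "d \<in> carrier (free_Abelian_group B)" "h c = h d"
    have hd: "h d \<in> carrier G" unfolding h_def using powers_closed[OF assms(2)] by (rule finprod_closed)
    have "(\<Otimes>b\<in>B. b [^] (Poly_Mapping.lookup c b + - Poly_Mapping.lookup d b)) = h c \<otimes> inv (h d)"
      unfolding h_def finprod_powers_add[OF assms(2)] finprod_powers_uminus[OF assms(2)] ..
    also have "\<dots> = \<one>" using cd(3) hd by simp
    finally have "\<forall>b\<in>B. Poly_Mapping.lookup c b + - Poly_Mapping.lookup d b = 0"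
      using assms(3)[unfolded indep_def, rule_format, of "\<lambda>b. Poly_Mapping.lookup c b + - Poly_Mapping.lookup d b"]
      by blast
    then have "c - d = 0" using cd(1,2) keys_diff[of c d]
      by (intro keys) (auto simp: lookup_minus)
    then show "c = d" by simp
  qed
  moreover have "h ` carrier (free_Abelian_group B) = spanned B"
  proof
    show "h ` carrier (free_Abelian_group B) \<subseteq> spanned B" by (auto simp: h_def spanned_def)
    show "spanned B \<subseteq> h ` carrier (free_Abelian_group B)"
    proof
      fix x assume "x \<in> spanned B"
      then obtain f where f: "x = (\<Otimes>b\<in>B. b [^] (f b :: int))" by (auto simp: spanned_def)
      \<comment> \<open>The exponents are cut off outside \<open>B\<close>, which makes the support
        finite.\<close>
      define c where "c = Poly_Mapping.Abs_poly_mapping (\<lambda>b. if b \<in> B then f b else 0)"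
      have look: "Poly_Mapping.lookup c = (\<lambda>b. if b \<in> B then f b else 0)"
        unfolding c_def by (rule Abs_poly_mapping_inverse) (simp add: assms(1))
      have "h c = x" unfolding h_def f look
        using powers_closed[OF assms(2)] by (intro finprod_cong') auto
      moreover have "Poly_Mapping.keys c \<subseteq> B" by (auto simp: in_keys_iff look split: if_splits)
      ultimately show "x \<in> h ` carrier (free_Abelian_group B)" by auto
    qed
  qed
  ultimately have "h \<in> iso (free_Abelian_group B) (G\<lparr>carrier := spanned B\<rparr>)"
    using hom by (simp add: iso_def bij_betw_def)
  then show ?thesis using group.iso_sym[OF group_free_Abelian_group] is_isoI by blast
qed

end

section \<open>Length functions on groups\<close>

lemma (in group) pow_conj:
  assumes "h \<in> carrier G" "k \<in> carrier G"
  shows "(h \<otimes> k \<otimes> inv h) [^] (n::nat) = h \<otimes> k [^] n \<otimes> inv h"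
proof (induction n)
  case (Suc n)
  have "(h \<otimes> k \<otimes> inv h) [^] Suc n = h \<otimes> k [^] n \<otimes> (inv h \<otimes> (h \<otimes> (k \<otimes> inv h)))"
    using Suc assms by (simp add: m_assoc)
  also have "inv h \<otimes> (h \<otimes> (k \<otimes> inv h)) = k \<otimes> inv h"
    using assms by (simp add: m_assoc[symmetric])
  finally show ?case using assms by (simp add: m_assoc)
qed (use assms in simp)

text \<open>The lower bound in \<open>len_pow\<close> has the constant 1 for every element of
  infinite order. This uniformity is what \<open>growth_lt_1\<close> exploits.\<close>

locale length_group = group G for G :: "('g, 'm) monoid_scheme" (structure) +
  fixes len :: "'g \<Rightarrow> nat"
  assumes len_mult: "g \<in> carrier G \<Longrightarrow> k \<in> carrier G \<Longrightarrow> len (g \<otimes> k) \<le> len g + len k"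
    and len_inv: "g \<in> carrier G \<Longrightarrow> len (inv g) = len g"
    and len_pow: "g \<in> carrier G \<Longrightarrow> (\<And>n::nat. n > 0 \<Longrightarrow> g [^] n \<noteq> \<one>) \<Longrightarrow> n \<le> len (g [^] (n::nat))"
begin

text \<open>An upper bound \<open>R\<close> for the stable length, the limit of the length of the
  \<open>n\<close>-th power divided by \<open>n\<close>, expressed without a limit.\<close>

definition growth :: "'g \<Rightarrow> real \<Rightarrow> bool" where
  "growth b R \<longleftrightarrow> (\<exists>C. \<forall>n::nat. real (len (b [^] n)) \<le> R * real n + C)"

lemma len_pow_le: "g \<in> carrier G \<Longrightarrow> len (g [^] (n::nat)) \<le> n * len g + len \<one>"
proof (induction n)
  case (Suc n)
  then show ?case using len_mult[of "g [^] n" g] by simp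
qed simp

lemma growth_len: "g \<in> carrier G \<Longrightarrow> growth g (real (len g))"
proof -
  assume "g \<in> carrier G"
  then have "real (len (g [^] n)) \<le> real (n * len g + len \<one>)" for n :: nat
    using len_pow_le of_nat_mono by blast
  then show ?thesis unfolding growth_def by (intro exI[of _ "real (len \<one>)"]) (simp add: mult.commute)
qed

text \<open>Conjugating a power by \<open>h\<close> costs at most twice the length of
  \<open>h\<close>, independently of the exponent; the constant absorbs it.\<close>

lemma growth_conj:
  assumes "h \<in> carrier G" "g \<in> carrier G" "growth g R"
  shows "growth (h \<otimes> g \<otimes> inv h) R"
proof -
  obtain C where C: "\<And>n::nat. real (len (g [^] n)) \<le> R * real n + C"
    using assms(3) unfolding growth_def by blast
  have "real (len ((h \<otimes> g \<otimes> inv h) [^] n)) \<le> R * real n + (C + 2 * real (len h))" for n :: nat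
  proof -
    have "len (h \<otimes> g [^] n \<otimes> inv h) \<le> len h + len (g [^] n) + len h"
      using len_mult[of "h \<otimes> g [^] n" "inv h"] len_mult[of h "g [^] n"] len_inv[of h] assms by simp
    then show ?thesis using C[of n] pow_conj[OF assms(1,2)] by simp
  qed
  then show ?thesis unfolding growth_def by blast
qed

lemma growth_mult:
  assumes "g \<in> carrier G" "k \<in> carrier G" "g \<otimes> k = k \<otimes> g" "growth g R" "growth k S"
  shows "growth (g \<otimes> k) (R + S)"
proof -
  obtain C where C: "\<And>n::nat. real (len (g [^] n)) \<le> R * real n + C"
    using assms(4) unfolding growth_def by blast
  obtain D where D: "\<And>n::nat. real (len (k [^] n)) \<le> S * real n + D"
    using assms(5) unfolding growth_def by blast
  have "real (len ((g \<otimes> k) [^] n)) \<le> (R + S) * real n + (C + D)" for n :: nat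
  proof -
    have "(g \<otimes> k) [^] n = g [^] n \<otimes> k [^] n" using assms by (intro pow_mult_distrib)
    then have "len ((g \<otimes> k) [^] n) \<le> len (g [^] n) + len (k [^] n)" using len_mult assms by simp
    then show ?thesis using C[of n] D[of n] by (simp add: algebra_simps)
  qed
  then show ?thesis unfolding growth_def by blast
qed

lemma growth_inv:
  assumes "g \<in> carrier G" "growth g R"
  shows "growth (inv g) R"
  using assms len_inv by (simp add: growth_def nat_pow_inv)

lemma growth_pow:
  assumes "g \<in> carrier G" "growth g R"
  shows "growth (g [^] (q::nat)) (real q * R)"
proof -
  obtain C where C: "\<And>n::nat. real (len (g [^] n)) \<le> R * real n + C"
    using assms(2) unfolding growth_def by blast
  have "real (len ((g [^] q) [^] n)) \<le> (real q * R) * real n + C" for n :: nat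
    using C[of "q * n"] assms(1) by (simp add: nat_pow_pow algebra_simps)
  then show ?thesis unfolding growth_def by blast
qed

lemma growth_int_pow:
  assumes "g \<in> carrier G" "growth g R"
  shows "growth (g [^] (i::int)) (\<bar>real_of_int i\<bar> * R)"
proof (cases "i \<ge> 0")
  case True
  then have "g [^] i = g [^] nat i" by (simp add: int_pow_int[symmetric])
  then show ?thesis using growth_pow[OF assms, of "nat i"] True by simp
next
  case False
  then have "g [^] i = inv (g [^] nat (- i))"
    using int_pow_neg[OF assms(1), of "- i"] by (simp add: int_pow_int[symmetric])
  then show ?thesis using growth_inv[OF _ growth_pow[OF assms, of "nat (- i)"]] assms(1) False by simp
qed

text \<open>Division with remainder by \<open>N\<close>: the quotient is governed by the growth of
  the \<open>N\<close>-th power, and finitely many remainders contribute a constant.\<close>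

lemma growth_root:
  assumes g: "g \<in> carrier G" and "growth (g [^] (N::nat)) S" "N > 0" "S \<ge> 0"
  shows "growth g (S / real N)"
proof -
  obtain C where C: "\<And>n::nat. real (len ((g [^] N) [^] n)) \<le> S * real n + C"
    using assms(2) unfolding growth_def by blast
  define D where "D = (\<Sum>r<N. len (g [^] r))"
  have "real (len (g [^] n)) \<le> (S / real N) * real n + (C + real D)" for n :: nat
  proof -
    have "g [^] n = (g [^] N) [^] (n div N) \<otimes> g [^] (n mod N)"
      using g by (simp add: nat_pow_pow nat_pow_mult)
    then have "len (g [^] n) \<le> len ((g [^] N) [^] (n div N)) + len (g [^] (n mod N))"
      using len_mult g by simp
    moreover have "len (g [^] (n mod N)) \<le> D"
      unfolding D_def using assms(3) by (intro member_le_sum) auto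
    moreover have "S * real (n div N) \<le> (S / real N) * real n"
    proof -
      have "real (n div N) \<le> real n / real N" by (rule of_nat_div_le_of_nat)
      then show ?thesis using assms(4) mult_left_mono by fastforce
    qed
    ultimately show ?thesis using C[of "n div N"] by linarith
  qed
  then show ?thesis unfolding growth_def by blast
qed

text \<open>The gap: the lower bound n on the length of n-th powers excludes stable lengths below 1
  for elements of infinite order.\<close>

lemma growth_lt_1:
  assumes "g \<in> carrier G" "growth g R" "R < 1" "\<And>n::nat. n > 0 \<Longrightarrow> g [^] n \<noteq> \<one>"
  shows False
proof -
  obtain C where C: "\<And>n::nat. real (len (g [^] n)) \<le> R * real n + C"
    using assms(2) unfolding growth_def by blast
  have "real n \<le> R * real n + C" for n :: nat
    using C[of n] len_pow[OF assms(1,4), of n] by simp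
  then have n: "real n * (1 - R) \<le> C" for n :: nat by (simp add: algebra_simps)
  obtain n :: nat where "C / (1 - R) < real n" using reals_Archimedean2 by blast
  then show False using n[of n] assms(3) by (simp add: field_simps)
qed

end

locale length_comm_group = length_group G len + comm_group G
  for G :: "('g, 'm) monoid_scheme" (structure) and len +
  assumes torsion_free: "g \<in> carrier G \<Longrightarrow> g [^] (n::nat) = \<one> \<Longrightarrow> n > 0 \<Longrightarrow> g = \<one>"
begin

lemma growth_mono_R: "growth g R \<Longrightarrow> R \<le> S \<Longrightarrow> growth g S"
  unfolding growth_def by (meson add_mono_thms_linordered_semiring(3) mult_right_mono of_nat_0_le_iff order_trans)

lemma growth_monomial:
  "a ` {..<n} \<subseteq> carrier G \<Longrightarrow>
    growth (monomial a n e) (\<Sum>i<n. \<bar>real_of_int (e i)\<bar> * real (len (a i)))"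
proof (induction n)
  case 0
  have "growth \<one> 0" unfolding growth_def by (intro exI[of _ "real (len \<one>)"]) simp
  then show ?case by simp
next
  case (Suc n)
  then have a: "a n \<in> carrier G" "a ` {..<n} \<subseteq> carrier G" by (auto simp: lessThan_Suc)
  have "growth (monomial a n e \<otimes> a n [^] e n)
      ((\<Sum>i<n. \<bar>real_of_int (e i)\<bar> * real (len (a i))) + \<bar>real_of_int (e n)\<bar> * real (len (a n)))"
    using a monomial_closed[OF a(2)] Suc.IH[OF a(2)] growth_int_pow[OF a(1) growth_len[OF a(1)]]
    by (intro growth_mult m_comm) auto
  then show ?case by simp
qed

text \<open>An element of bounded growth has an exponent vector of bounded size: if its smallest
  exponent vector e were large, then Dirichlet approximation would give an integer vector p close
  to a small multiple of the direction of e. The growth of the monomial of p is then less than 1,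
  so p is a relation, and e - p is a smaller exponent vector.\<close>

lemma growth_bounded_exponents:
  assumes a: "a ` {..<n} \<subseteq> carrier G" "generate G (a ` {..<n}) = carrier G" and R: "R \<ge> 0"
  obtains D :: int where "\<And>b. b \<in> carrier G \<Longrightarrow> growth b R \<Longrightarrow>
    \<exists>e. b = monomial a n e \<and> (\<forall>i<n. \<bar>e i\<bar> \<le> D)"
proof -
  \<comment> \<open>\<open>M\<close> makes the rounding contribution \<open>L / M\<close> less than
    1/2, and \<open>Q\<close> is the bound on the multiplier \<open>q\<close> in Dirichlet's
    theorem. Below, \<open>D\<close> ensures both that \<open>q * R / N\<close> is less than 1/2 and
    that \<open>N\<close> is at least \<open>Q\<close>.\<close>
  define L where "L = (\<Sum>i<n. len (a i))"
  define M where "M = 2 * L + 1"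
  define Q where "Q = M ^ n"
  have M: "M > 0" and Q: "Q > 0" by (auto simp: M_def Q_def)
  obtain D :: nat where D: "2 * R * real Q + real Q < real D" using reals_Archimedean2 by blast
  have "\<exists>e. b = monomial a n e \<and> (\<forall>i<n. \<bar>e i\<bar> \<le> int D)"
    if b: "b \<in> carrier G" "growth b R" for b
  proof (rule ccontr)
    assume neg: "\<not> ?thesis"
    \<comment> \<open>\<open>P N\<close> says that \<open>b\<close> has an exponent vector of sup
      norm at most \<open>N\<close>; the contradiction will be with the least such
      \<open>N\<close>.\<close>
    define P where "P N \<longleftrightarrow> (\<exists>e. b = monomial a n e \<and> (\<forall>i<n. \<bar>e i\<bar> \<le> int N))" for N
    obtain e0 where e0: "b = monomial a n e0" using monomial_generate[OF a(1)] a(2) b(1) by blast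
    have "P (\<Sum>i<n. nat \<bar>e0 i\<bar>)" unfolding P_def
    proof (intro exI conjI allI impI)
      fix i assume "i < n"
      then have "nat \<bar>e0 i\<bar> \<le> (\<Sum>i<n. nat \<bar>e0 i\<bar>)"
        by (intro member_le_sum[of i "{..<n}" "\<lambda>i. nat \<bar>e0 i\<bar>"]) auto
      then show "\<bar>e0 i\<bar> \<le> int (\<Sum>i<n. nat \<bar>e0 i\<bar>)" by linarith
    qed (rule e0)
    then have PN: "P (LEAST N. P N)" by (rule LeastI)
    define N where "N = (LEAST N. P N)"
    obtain e where e: "b = monomial a n e" "\<forall>i<n. \<bar>e i\<bar> \<le> int N" using PN unfolding P_def N_def by blast
    have ND: "N > D"
    proof (rule ccontr)
      assume "\<not> N > D"
      then have "\<forall>i<n. \<bar>e i\<bar> \<le> int D" using e(2) by fastforce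
      then show False using neg e(1) by blast
    qed
    have N: "real N > 2 * R * real Q" "N \<ge> Q" "N > 0"
    proof -
      have RQ: "0 \<le> 2 * R * real Q" using R by simp
      have DN: "real D < real N" using ND by simp
      show "real N > 2 * R * real Q" using D DN by linarith
      have "real Q < real N" using D DN RQ by linarith
      then show "N \<ge> Q" by simp
      show "N > 0" using ND by simp
    qed
    obtain q p where q: "0 < q" "q \<le> int (M ^ n)"
      and p: "\<And>i. i < n \<Longrightarrow> \<bar>of_int q * (real_of_int (e i) / real N) - of_int (p i)\<bar> < 1 / real M"
      using Dirichlet_approx_simult[of M n "\<lambda>i. real_of_int (e i) / real N"] M by auto
    have qN: "real_of_int q \<le> real N" using q(2) N(2) unfolding Q_def[symmetric] by linarith
    have bq: "growth (b [^] q) (real_of_int q * R)" using growth_int_pow[OF b, of q] q by simp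
    \<comment> \<open>Up to sign, the rounding errors multiplied by \<open>N\<close>, so each is at
      most \<open>N / M\<close> in absolute value. They express the \<open>N\<close>-th power of the
      monomial of \<open>p\<close> by the \<open>q\<close>-th power of \<open>b\<close> and a small
      monomial.\<close>
    define f where "f i = int N * p i - q * e i" for i
    have pN: "monomial a n p [^] N = b [^] q \<otimes> monomial a n f"
    proof -
      have "monomial a n (\<lambda>i. int N * p i) = monomial a n (\<lambda>i. q * e i + f i)"
        by (simp add: f_def)
      then show ?thesis
        using monomial_add[OF a(1), of "\<lambda>i. q * e i" f] monomial_scale[OF a(1)] e(1)
        by (simp add: int_pow_int)
    qed
    have "(\<Sum>i<n. \<bar>real_of_int (f i)\<bar> * real (len (a i))) \<le> (\<Sum>i<n. (real N / real M) * real (len (a i)))"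
    proof (intro sum_mono mult_right_mono)
      fix i assume "i \<in> {..<n}"
      then have "real N * \<bar>of_int q * (real_of_int (e i) / real N) - of_int (p i)\<bar> \<le> real N * (1 / real M)"
        using p[of i] by (intro mult_left_mono) auto
      moreover have "real N * \<bar>of_int q * (real_of_int (e i) / real N) - of_int (p i)\<bar>
          = \<bar>real N * (of_int q * (real_of_int (e i) / real N) - of_int (p i))\<bar>"
        by (simp add: abs_mult)
      moreover have "real N * (of_int q * (real_of_int (e i) / real N) - of_int (p i)) = - real_of_int (f i)"
        using N(3) by (simp add: f_def field_simps)
      ultimately show "\<bar>real_of_int (f i)\<bar> \<le> real N / real M" by simp
    qed simp
    also have "\<dots> = real N * (real L / real M)" by (simp add: L_def sum_distrib_left sum_divide_distrib)
    finally have fg: "growth (monomial a n f) (real N * (real L / real M))"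
      using growth_mono_R growth_monomial[OF a(1)] by blast
    have mc: "monomial a n x \<in> carrier G" for x using monomial_closed[OF a(1)] .
    have "growth (monomial a n p [^] N) (real_of_int q * R + real N * (real L / real M))"
      unfolding pN using bq fg b(1) mc by (intro growth_mult m_comm) auto
    then have gp: "growth (monomial a n p) ((real_of_int q * R + real N * (real L / real M)) / real N)"
      using q R N(3) mc by (intro growth_root) auto
    have "(real_of_int q * R + real N * (real L / real M)) / real N < 1"
    proof -
      have "real_of_int q \<le> real Q" using q(2) unfolding Q_def[symmetric] by linarith
      then have "real_of_int q * R \<le> real Q * R" using R by (intro mult_right_mono) auto
      moreover have "2 * (real Q * R) < real N" using N(1) by (simp add: ac_simps)
      ultimately have "real_of_int q * R < real N / 2" by linarith
      moreover have "real L / real M < 1 / 2" by (simp add: M_def)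
      then have "real N * (real L / real M) < real N * (1 / 2)"
        using N(3) by (intro mult_strict_left_mono) auto
      ultimately have "real_of_int q * R + real N * (real L / real M) < real N" by linarith
      then show ?thesis using N(3) by (simp only: divide_less_eq_1) simp
    qed
    then have p1: "monomial a n p = \<one>"
      using growth_lt_1[OF mc gp] torsion_free[OF mc[of p]] by blast
    have "P (N - 1)" unfolding P_def
    proof (intro exI conjI allI impI)
      show "b = monomial a n (\<lambda>i. e i + - p i)"
        using monomial_add[OF a(1), of e "\<lambda>i. - p i"] monomial_uminus[OF a(1), of p] p1 e(1) b(1) by simp
      fix i assume i: "i < n"
      have "\<bar>real_of_int (e i)\<bar> \<le> real N" using e(2) i by (metis of_int_abs of_int_le_iff of_int_of_nat_eq)
      then have "\<bar>real_of_int (e i)\<bar> * (1 - real_of_int q / real N) \<le> real N * (1 - real_of_int q / real N)"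
        using qN N(3) by (intro mult_right_mono) (auto simp: divide_simps)
      also have "\<dots> = real N - real_of_int q" using N(3) by (simp add: field_simps)
      finally have 1: "\<bar>real_of_int (e i)\<bar> * (1 - real_of_int q / real N) \<le> real N - real_of_int q" .
      \<comment> \<open>\<open>e - p\<close> is \<open>u + v\<close>: the vector \<open>e\<close>
        shrunk by the factor \<open>1 - q / N\<close>, plus the rounding error. The first is at most
        \<open>N - q\<close>, the second less than 1, and \<open>q\<close> is at least 1; so the
        norm drops below \<open>N\<close>.\<close>
      define u v where "u = real_of_int (e i) * (1 - real_of_int q / real N)"
        and "v = of_int q * (real_of_int (e i) / real N) - of_int (p i)"
      have "\<bar>u\<bar> = \<bar>real_of_int (e i)\<bar> * (1 - real_of_int q / real N)"
        using qN N(3) by (simp add: u_def abs_mult)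
      then have "\<bar>u\<bar> \<le> real N - real_of_int q" using 1 by (simp only:)
      moreover have "\<bar>v\<bar> < 1 / real M" using p[OF i] by (simp only: v_def)
      moreover have "real_of_int (e i) - real_of_int (p i) = u + v"
        by (simp add: u_def v_def algebra_simps)
      moreover have "1 / real M \<le> 1" using M by simp
      ultimately have "\<bar>real_of_int (e i) - real_of_int (p i)\<bar> < real N - real_of_int q + 1"
        by linarith
      then have "\<bar>real_of_int (e i) - real_of_int (p i)\<bar> < real N" using q(1) by linarith
      then have "real_of_int \<bar>e i - p i\<bar> < real_of_int (int N)" by simp
      then have "\<bar>e i - p i\<bar> < int N" by (simp only: of_int_less_iff)
      then show "\<bar>e i + - p i\<bar> \<le> int (N - 1)" using N(3) by simp
    qed
    then have "N \<le> N - 1" unfolding N_def by (rule Least_le)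
    then show False using N(3) by simp
  qed
  then show ?thesis using that by blast
qed

lemma finite_growth:
  assumes "finite S" "S \<subseteq> carrier G" "generate G S = carrier G" "R \<ge> 0"
  shows "finite {b \<in> carrier G. growth b R}"
proof -
  obtain a n where a: "S = a ` {..<n::nat}"
    using assms(1) finite_imp_nat_seg_image_inj_on by (metis lessThan_def)
  obtain D :: int where D: "\<And>b. b \<in> carrier G \<Longrightarrow> growth b R \<Longrightarrow>
    \<exists>e. b = monomial a n e \<and> (\<forall>i<n. \<bar>e i\<bar> \<le> D)"
    using growth_bounded_exponents[of a n R] assms a by blast
  have "{b \<in> carrier G. growth b R} \<subseteq> monomial a n ` ({..<n} \<rightarrow>\<^sub>E {-D..D})"
  proof
    fix b assume "b \<in> {b \<in> carrier G. growth b R}"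
    then obtain e where e: "b = monomial a n e" "\<forall>i<n. \<bar>e i\<bar> \<le> D" using D by blast
    have "b = monomial a n (restrict e {..<n})"
      unfolding e(1) by (rule monomial_cong) simp
    moreover have "restrict e {..<n} \<in> {..<n} \<rightarrow>\<^sub>E {-D..D}" using e(2) by (auto simp: abs_le_iff)
    ultimately show "b \<in> monomial a n ` ({..<n} \<rightarrow>\<^sub>E {-D..D})" by blast
  qed
  then show ?thesis by (rule finite_subset) (simp add: finite_PiE)
qed

end

section \<open>Solvable groups without distorted elements\<close>

text \<open>The relation of the Heisenberg group: moving one \<open>g\<close> past one
  \<open>h\<close> costs one central \<open>z\<close>, and there are \<open>m * n\<close> such
  moves.\<close>

lemma (in group) commuting_pow_commutator:
  assumes gh: "g \<in> carrier G" "h \<in> carrier G" and z: "z \<in> carrier G" "z \<otimes> g = g \<otimes> z" "z \<otimes> h = h \<otimes> z"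
    and comm: "g \<otimes> h = z \<otimes> h \<otimes> g"
  shows "g [^] (m::nat) \<otimes> h [^] (n::nat) = z [^] (m * n) \<otimes> h [^] n \<otimes> g [^] m"
proof -
  have zg: "g \<otimes> z [^] (i::nat) = z [^] i \<otimes> g" for i
    using group_commutes_pow[OF z(2)] z gh by simp
  have 1: "g \<otimes> h [^] n = z [^] n \<otimes> h [^] n \<otimes> g" for n :: nat
  proof (induction n)
    case (Suc n)
    have "g \<otimes> h [^] Suc n = (g \<otimes> h [^] n) \<otimes> h" using gh by (simp add: m_assoc)
    also have "\<dots> = z [^] n \<otimes> h [^] n \<otimes> (g \<otimes> h)" using Suc gh z by (simp add: m_assoc)
    also have "\<dots> = z [^] n \<otimes> (h [^] n \<otimes> z) \<otimes> h \<otimes> g" using comm gh z by (simp add: m_assoc)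
    also have "h [^] n \<otimes> z = z \<otimes> h [^] n"
      using group_commutes_pow[OF z(3)[symmetric]] z gh by simp
    finally show ?case using gh z by (simp add: m_assoc)
  qed (use gh in simp)
  show ?thesis
  proof (induction m)
    case (Suc m)
    have zg': "g [^] m \<otimes> z [^] (i::nat) = z [^] i \<otimes> g [^] m" for i
      using group_commutes_pow[OF zg[of i]] z gh by simp
    have "g [^] Suc m \<otimes> h [^] n = g [^] m \<otimes> (g \<otimes> h [^] n)" using gh by (simp add: m_assoc)
    also have "\<dots> = (g [^] m \<otimes> z [^] n) \<otimes> h [^] n \<otimes> g" using 1 gh z by (simp add: m_assoc)
    also have "\<dots> = z [^] n \<otimes> (g [^] m \<otimes> h [^] n) \<otimes> g" using zg' gh z by (simp add: m_assoc)
    also have "\<dots> = z [^] n \<otimes> z [^] (m * n) \<otimes> h [^] n \<otimes> (g [^] m \<otimes> g)"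
      using Suc gh z by (simp add: m_assoc)
    finally show ?case using gh z by (simp add: nat_pow_mult)
  qed (use gh z in simp)
qed

context length_group
begin

lemma length_comm_subgroup:
  assumes "subgroup A G" "\<And>x y. x \<in> A \<Longrightarrow> y \<in> A \<Longrightarrow> x \<otimes> y = y \<otimes> x"
    and "\<And>x n. x \<in> A \<Longrightarrow> x [^] (n::nat) = \<one> \<Longrightarrow> n > 0 \<Longrightarrow> x = \<one>"
  shows "length_comm_group (G\<lparr>carrier := A\<rparr>) len"
proof -
  have A: "A \<subseteq> carrier G" using subgroup.subset assms(1) by blast
  interpret A: group "G\<lparr>carrier := A\<rparr>" using subgroup_imp_group assms(1) .
  have pow: "x [^]\<^bsub>G\<lparr>carrier := A\<rparr>\<^esub> n = x [^] n" for x and n :: nat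
    using nat_pow_consistent by metis
  show ?thesis
  proof (intro length_comm_group.intro length_group.intro length_group_axioms.intro
      length_comm_group_axioms.intro)
    show "comm_group (G\<lparr>carrier := A\<rparr>)" using assms(2) by (intro A.group_comm_groupI) auto
    show "group (G\<lparr>carrier := A\<rparr>)" by (rule A.is_group)
    fix g k assume g: "g \<in> carrier (G\<lparr>carrier := A\<rparr>)"
    then have gA: "g \<in> A" "g \<in> carrier G" using A by auto
    show "len (inv\<^bsub>G\<lparr>carrier := A\<rparr>\<^esub> g) = len g"
      using gA assms(1) len_inv by simp
    show "g = \<one>\<^bsub>G\<lparr>carrier := A\<rparr>\<^esub>"
      if "g [^]\<^bsub>G\<lparr>carrier := A\<rparr>\<^esub> n = \<one>\<^bsub>G\<lparr>carrier := A\<rparr>\<^esub>" "n > 0" for n :: nat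
      using that assms(3) gA pow by simp
    show "n \<le> len (g [^]\<^bsub>G\<lparr>carrier := A\<rparr>\<^esub> n)"
      if "\<And>n::nat. n > 0 \<Longrightarrow> g [^]\<^bsub>G\<lparr>carrier := A\<rparr>\<^esub> n \<noteq> \<one>\<^bsub>G\<lparr>carrier := A\<rparr>\<^esub>" for n :: nat
      using that len_pow gA pow by simp
    assume "k \<in> carrier (G\<lparr>carrier := A\<rparr>)"
    then show "len (g \<otimes>\<^bsub>G\<lparr>carrier := A\<rparr>\<^esub> k) \<le> len g + len k" using gA A len_mult by auto
  qed
qed

lemma central_commutator_trivial:
  assumes gh: "g \<in> carrier G" "h \<in> carrier G" and z: "z \<in> carrier G" "z \<otimes> g = g \<otimes> z" "z \<otimes> h = h \<otimes> z"
    and comm: "g \<otimes> h = z \<otimes> h \<otimes> g"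
    and inf: "\<And>n::nat. n > 0 \<Longrightarrow> z [^] n \<noteq> \<one>"
  shows False
proof -
  define c where "c = len g + len h"
  have "n * n \<le> 2 * n * c + 4 * len \<one>" for n :: nat
  proof -
    have "g [^] n \<otimes> h [^] n = z [^] (n * n) \<otimes> (h [^] n \<otimes> g [^] n)"
      using commuting_pow_commutator[OF assms(1-6), of n n] gh z by (simp add: m_assoc)
    then have "z [^] (n * n) = g [^] n \<otimes> h [^] n \<otimes> inv (h [^] n \<otimes> g [^] n)"
      using gh z by (simp add: inv_solve_right)
    then have "len (z [^] (n * n)) \<le> len (g [^] n \<otimes> h [^] n) + len (h [^] n \<otimes> g [^] n)"
      using len_mult[of "g [^] n \<otimes> h [^] n" "inv (h [^] n \<otimes> g [^] n)"] len_inv gh by simp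
    also have "\<dots> \<le> 2 * (len (g [^] n) + len (h [^] n))"
      using len_mult[of "g [^] n" "h [^] n"] len_mult[of "h [^] n" "g [^] n"] gh by simp
    also have "\<dots> \<le> 2 * ((n * len g + len \<one>) + (n * len h + len \<one>))"
      using len_pow_le[OF gh(1), of n] len_pow_le[OF gh(2), of n] by simp
    also have "\<dots> = 2 * n * c + 4 * len \<one>" by (simp add: c_def algebra_simps)
    finally show ?thesis using len_pow[OF z(1) inf, of "n * n"] by linarith
  qed
  \<comment> \<open>A value of \<open>n\<close> that exceeds \<open>2 * c\<close> by
    \<open>4 * len \<one> + 1\<close>, so that its square beats the linear bound. The length of the
    identity may be positive and enters once for each of the four powers.\<close>
  from this[of "2 * c + 4 * len \<one> + 1"]
  have "(2 * c + 4 * len \<one> + 1) * (2 * c + 4 * len \<one> + 1) \<le> (2 * c + 4 * len \<one> + 1) * (2 * c) + 4 * len \<one>"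
    by (simp add: mult.assoc mult.commute)
  then have "(2 * c + 4 * len \<one> + 1) * (4 * len \<one> + 1) \<le> 4 * len \<one>"
    by (simp add: add_mult_distrib2)
  then show False by (simp add: add_mult_distrib add_mult_distrib2)
qed

end

locale noetherian_length_group = length_group G len
  for G :: "('g, 'm) monoid_scheme" (structure) and len +
  assumes noetherian: "subgroup H G \<Longrightarrow> \<exists>S. finite S \<and> S \<subseteq> carrier G \<and> generate G S = H"
begin

lemma subgroup_generators:
  assumes "subgroup H G"
  obtains S where "finite S" "S \<subseteq> H" "generate G S = H"
  using noetherian[OF assms] generate.incl by (metis subsetI)

text \<open>The finite-index free abelian subgroup is the span of \<open>B\<close>. The abelian
  group \<open>C\<close> is carried along because independence and span are notions of a commutative
  group.\<close>

definition virt_free :: "'g set \<Rightarrow> 'g set \<Rightarrow> 'g set \<Rightarrow> bool" where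
  "virt_free H C B \<longleftrightarrow> subgroup C G \<and> C \<subseteq> H \<and> comm_group (G\<lparr>carrier := C\<rparr>) \<and>
    finite B \<and> B \<subseteq> C \<and> comm_group.indep (G\<lparr>carrier := C\<rparr>) B \<and>
    fin_index G H (comm_group.spanned (G\<lparr>carrier := C\<rparr>) B)"

lemma inv_restrict: "subgroup C G \<Longrightarrow> F \<subseteq> C \<Longrightarrow> f \<in> F \<Longrightarrow> inv\<^bsub>G\<lparr>carrier := C\<rparr>\<^esub> f = inv f"
  by (auto intro: m_inv_consistent)

lemma fin_index_restrict:
  assumes "subgroup C G" "fin_index (G\<lparr>carrier := C\<rparr>) C K"
  shows "fin_index G C K"
proof -
  obtain F where F: "finite F" "F \<subseteq> C"
      "\<forall>h\<in>C. \<exists>f\<in>F. inv\<^bsub>G\<lparr>carrier := C\<rparr>\<^esub> f \<otimes>\<^bsub>G\<lparr>carrier := C\<rparr>\<^esub> h \<in> K"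
    using assms(2) unfolding fin_index_def by blast
  have "\<exists>f\<in>F. inv f \<otimes> h \<in> K" if h: "h \<in> C" for h
  proof -
    obtain f where "f \<in> F" "inv\<^bsub>G\<lparr>carrier := C\<rparr>\<^esub> f \<otimes> h \<in> K" using F(3) h by auto
    then show ?thesis using inv_restrict[OF assms(1) F(2)] by auto
  qed
  then show ?thesis unfolding fin_index_def using F(1,2) by blast
qed

lemma comm_groupI_subgroup:
  assumes "subgroup C G" "\<And>x y. x \<in> C \<Longrightarrow> y \<in> C \<Longrightarrow> x \<otimes> y = y \<otimes> x"
  shows "comm_group (G\<lparr>carrier := C\<rparr>)"
  using group.group_comm_groupI[OF subgroup_imp_group[OF assms(1)]] assms(2) by simp

lemma virt_freeI:
  assumes H: "subgroup H G" and C: "subgroup C G" "C \<subseteq> H" "\<And>x y. x \<in> C \<Longrightarrow> y \<in> C \<Longrightarrow> x \<otimes> y = y \<otimes> x"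
    and fin: "fin_index G H C"
  shows "\<exists>B. virt_free H C B"
proof -
  interpret C: comm_group "G\<lparr>carrier := C\<rparr>" using comm_groupI_subgroup C by blast
  obtain S where S: "finite S" "S \<subseteq> C" "generate G S = C" using subgroup_generators[OF C(1)] .
  have "generate (G\<lparr>carrier := C\<rparr>) S = carrier (G\<lparr>carrier := C\<rparr>)"
    using generate_consistent[OF S(2) C(1)] S(3) by simp
  then obtain B where B: "finite B" "B \<subseteq> C" "C.indep B"
      "fin_index (G\<lparr>carrier := C\<rparr>) C (C.spanned B)"
    using C.exists_indep_fin_index[of S] S by auto
  have "fin_index G H (C.spanned B)"
    using fin_index_trans[OF fin fin_index_restrict[OF C(1) B(4)] H C(1,2)] .
  then show ?thesis unfolding virt_free_def using B C H C.comm_group_axioms by blast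
qed

lemma virt_freeD:
  assumes "virt_free H C B"
  obtains A where "subgroup A G" "A \<subseteq> H" "\<And>x y. x \<in> A \<Longrightarrow> y \<in> A \<Longrightarrow> x \<otimes> y = y \<otimes> x"
    "\<And>x n. x \<in> A \<Longrightarrow> x [^] (n::nat) = \<one> \<Longrightarrow> n > 0 \<Longrightarrow> x = \<one>" "fin_index G H A"
proof -
  have C: "subgroup C G" "C \<subseteq> H" "comm_group (G\<lparr>carrier := C\<rparr>)" "finite B" "B \<subseteq> C"
    "comm_group.indep (G\<lparr>carrier := C\<rparr>) B"
    "fin_index G H (comm_group.spanned (G\<lparr>carrier := C\<rparr>) B)"
    using assms by (simp_all add: virt_free_def)
  interpret C: comm_group "G\<lparr>carrier := C\<rparr>" by (rule C(3))
  have sub: "subgroup (C.spanned B) (G\<lparr>carrier := C\<rparr>)" using C.subgroup_spanned C(5) by simp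
  have CC: "C.spanned B \<subseteq> C" using subgroup.subset[OF sub] by simp
  show ?thesis
  proof (rule that[of "C.spanned B"])
    show "subgroup (C.spanned B) G" using incl_subgroup[OF C(1) sub] .
    show "C.spanned B \<subseteq> H" using CC C(2) by blast
    show "x \<otimes> y = y \<otimes> x" if "x \<in> C.spanned B" "y \<in> C.spanned B" for x y
      using C.m_comm[of x y] that CC by auto
    show "x = \<one>" if "x \<in> C.spanned B" "x [^] n = \<one>" "n > 0" for x and n :: nat
      using C.spanned_torsion_free[of B x n] C(5,6) that nat_pow_consistent[of x n C] by simp
    show "fin_index G H (C.spanned B)" by fact
  qed
qed

text \<open>The subgroup generated by all \<open>m\<close>-th powers of elements of \<open>K\<close>
  is invariant under conjugation by \<open>H\<close>, as \<open>K\<close> is. For a suitable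
  \<open>m\<close> it lies in \<open>A0\<close>, and it has finite index there because
  \<open>A0\<close> is a finitely generated abelian group.\<close>

lemma normal_power_subgroup:
  assumes H: "subgroup H G" and K: "subgroup K G" "K \<subseteq> H"
    and norm: "\<And>h k. h \<in> H \<Longrightarrow> k \<in> K \<Longrightarrow> h \<otimes> k \<otimes> inv h \<in> K"
    and A0: "subgroup A0 G" "A0 \<subseteq> K" "\<And>x y. x \<in> A0 \<Longrightarrow> y \<in> A0 \<Longrightarrow> x \<otimes> y = y \<otimes> x" "fin_index G K A0"
  obtains A where "subgroup A G" "A \<subseteq> A0" "fin_index G K A"
    "\<And>h a. h \<in> H \<Longrightarrow> a \<in> A \<Longrightarrow> h \<otimes> a \<otimes> inv h \<in> A"
proof -
  have car: "H \<subseteq> carrier G" "K \<subseteq> carrier G" "A0 \<subseteq> carrier G" using subgroup.subset H K A0 by blast+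
  obtain m :: nat where m: "m > 0" "\<And>k. k \<in> K \<Longrightarrow> k [^] m \<in> A0"
    using fin_index_pow[OF A0(4) K(1) A0(1)] by blast
  define P where "P = (\<lambda>k. k [^] m) ` K"
  define A where "A = generate G P"
  have PA0: "P \<subseteq> A0" using m(2) by (auto simp: P_def)
  have Pc: "P \<subseteq> carrier G" using PA0 car by blast
  have A: "subgroup A G" unfolding A_def using Pc by (rule generate_is_subgroup)
  have AA0: "A \<subseteq> A0" unfolding A_def using PA0 A0(1) by (rule generate_subgroup_incl)
  have conj: "h \<otimes> a \<otimes> inv h \<in> A" if h: "h \<in> H" and a: "a \<in> A" for h a
  proof -
    have hc: "h \<in> carrier G" using h car by blast
    have P: "h \<otimes> p \<otimes> inv h \<in> P" if "p \<in> P" for p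
    proof -
      obtain k where k: "k \<in> K" "p = k [^] m" using \<open>p \<in> P\<close> by (auto simp: P_def)
      then have "h \<otimes> p \<otimes> inv h = (h \<otimes> k \<otimes> inv h) [^] m" using pow_conj[OF hc] car by auto
      then show ?thesis using norm[OF h k(1)] by (auto simp: P_def)
    qed
    show ?thesis using a unfolding A_def
    proof (induction a rule: generate.induct)
      case one
      then show ?case using hc generate.one by simp
    next
      case (incl p)
      then show ?case by (intro generate.incl P)
    next
      case (inv p)
      have "inv (h \<otimes> p \<otimes> inv h) = h \<otimes> inv p \<otimes> inv h"
        using inv Pc hc by (auto simp: inv_mult_group m_assoc)
      then show ?case using generate.inv[OF P[OF inv], of G] by simp
    next
      case (eng a b)
      then have c: "a \<in> carrier G" "b \<in> carrier G" using generate_in_carrier[OF Pc] by auto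
      have "h \<otimes> (a \<otimes> b) \<otimes> inv h = (h \<otimes> a \<otimes> inv h) \<otimes> (h \<otimes> b \<otimes> inv h)"
      proof -
        have "(h \<otimes> a \<otimes> inv h) \<otimes> (h \<otimes> b \<otimes> inv h) = h \<otimes> a \<otimes> (inv h \<otimes> (h \<otimes> (b \<otimes> inv h)))"
          using c hc by (simp add: m_assoc)
        also have "inv h \<otimes> (h \<otimes> (b \<otimes> inv h)) = b \<otimes> inv h" using c hc by (simp add: m_assoc[symmetric])
        finally show ?thesis using c hc by (simp add: m_assoc)
      qed
      then show ?case using generate.eng[OF eng(3,4)] by simp
    qed
  qed
  interpret C: comm_group "G\<lparr>carrier := A0\<rparr>" using comm_groupI_subgroup A0 by blast
  obtain S where S: "finite S" "S \<subseteq> A0" "generate G S = A0" using subgroup_generators[OF A0(1)] .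
  have "fin_index (G\<lparr>carrier := A0\<rparr>) (carrier (G\<lparr>carrier := A0\<rparr>)) A"
  proof (rule C.fin_index_of_powers[OF S(1) _ _ _ m(1)])
    show "generate (G\<lparr>carrier := A0\<rparr>) S = carrier (G\<lparr>carrier := A0\<rparr>)"
      using generate_consistent[OF S(2) A0(1)] S(3) by simp
    show "subgroup A (G\<lparr>carrier := A0\<rparr>)" using subgroup_incl[OF A A0(1) AA0] .
    fix s assume "s \<in> S"
    then have "s [^] m \<in> P" using S A0 by (auto simp: P_def)
    then show "s [^]\<^bsub>G\<lparr>carrier := A0\<rparr>\<^esub> m \<in> A"
      using nat_pow_consistent[of s m A0] generate.incl unfolding A_def by metis
  qed (use S in simp)
  then have "fin_index G A0 A" using fin_index_restrict[OF A0(1)] by simp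
  then have "fin_index G K A" using fin_index_trans[OF A0(4) _ K(1) A0(1,2)] by blast
  then show ?thesis using that A AA0 conj by blast
qed

definition commr :: "'g \<Rightarrow> 'g \<Rightarrow> 'g" where "commr g h = g \<otimes> h \<otimes> inv g \<otimes> inv h"

lemma centralizer_fin_index:
  assumes H: "subgroup H G" and A: "subgroup A G" "A \<subseteq> H" "\<And>x y. x \<in> A \<Longrightarrow> y \<in> A \<Longrightarrow> x \<otimes> y = y \<otimes> x"
      "\<And>x n. x \<in> A \<Longrightarrow> x [^] (n::nat) = \<one> \<Longrightarrow> n > 0 \<Longrightarrow> x = \<one>"
    and norm: "\<And>h a. h \<in> H \<Longrightarrow> a \<in> A \<Longrightarrow> h \<otimes> a \<otimes> inv h \<in> A"
  defines "Z \<equiv> {g \<in> H. \<forall>a\<in>A. g \<otimes> a = a \<otimes> g}"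
  shows "subgroup Z G" "fin_index G H Z"
proof -
  have car: "H \<subseteq> carrier G" "A \<subseteq> carrier G" using subgroup.subset H A by blast+
  show "subgroup Z G"
  proof (rule subgroupI)
    show "Z \<subseteq> carrier G" using car by (auto simp: Z_def)
    have "\<one> \<in> Z" using subgroup.one_closed[OF H] car by (auto simp: Z_def)
    then show "Z \<noteq> {}" by blast
    fix g assume g: "g \<in> Z"
    show "inv g \<in> Z" unfolding Z_def
    proof (intro CollectI conjI ballI)
      show "inv g \<in> H" using g subgroup.m_inv_closed[OF H] by (simp add: Z_def)
      fix a assume a: "a \<in> A"
      have c: "g \<in> carrier G" "a \<in> carrier G" using g a car by (auto simp: Z_def)
      have "inv g \<otimes> a \<otimes> g = a"
        using g a c by (simp add: Z_def m_assoc inv_solve_left'[of a g "a \<otimes> g"])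
      then have "inv g \<otimes> a = a \<otimes> inv g"
        using c inv_solve_right[of "inv g \<otimes> a" a g] by simp
      then show "inv g \<otimes> a = a \<otimes> inv g" .
    qed
    fix h assume h: "h \<in> Z"
    show "g \<otimes> h \<in> Z" unfolding Z_def
    proof (intro CollectI conjI ballI)
      show "g \<otimes> h \<in> H" using g h subgroup.m_closed[OF H] by (simp add: Z_def)
      fix a assume a: "a \<in> A"
      have c: "g \<in> carrier G" "h \<in> carrier G" "a \<in> carrier G" using g h a car by (auto simp: Z_def)
      have "g \<otimes> h \<otimes> a = g \<otimes> (a \<otimes> h)" using c h a by (simp add: Z_def m_assoc)
      also have "\<dots> = a \<otimes> g \<otimes> h" using c g a by (simp add: Z_def m_assoc[symmetric])
      finally show "g \<otimes> h \<otimes> a = a \<otimes> (g \<otimes> h)" using c by (simp add: m_assoc)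
    qed
  qed
  obtain S where S: "finite S" "S \<subseteq> A" "generate G S = A" using subgroup_generators[OF A(1)] .
  interpret C: length_comm_group "G\<lparr>carrier := A\<rparr>" len
    using length_comm_subgroup[OF A(1,3,4)] .
  have pow: "x [^]\<^bsub>G\<lparr>carrier := A\<rparr>\<^esub> n = x [^] n" for x and n :: nat
    using nat_pow_consistent by metis
  have growth: "C.growth b R \<longleftrightarrow> growth b R" for b R
    by (simp add: C.growth_def growth_def pow)
  have fin: "finite {b \<in> A. growth b R}" if "R \<ge> 0" for R
    using C.finite_growth[of S R] S that generate_consistent[OF S(2) A(1)] growth by simp
  \<comment> \<open>The tuple of conjugates of the generators of \<open>A\<close>. Conjugation
    preserves growth and \<open>A\<close> has finitely many elements of bounded growth, so few
    tuples occur; equal tuples mean that the quotient commutes with all generators.\<close>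
  define \<theta> where "\<theta> g = (\<lambda>s\<in>S. g \<otimes> s \<otimes> inv g)" for g
  show "fin_index G H Z"
  proof (rule fin_indexI)
    have "\<theta> ` H \<subseteq> (\<Pi>\<^sub>E s\<in>S. {b \<in> A. growth b (real (len s))})"
    proof (rule image_subsetI)
      fix g assume g: "g \<in> H"
      have "g \<otimes> s \<otimes> inv g \<in> {b \<in> A. growth b (real (len s))}" if "s \<in> S" for s
      proof -
        have "s \<in> A" "s \<in> carrier G" "g \<in> carrier G" using that S(2) car g by auto
        then show ?thesis using norm[OF g] growth_conj growth_len by blast
      qed
      then show "\<theta> g \<in> (\<Pi>\<^sub>E s\<in>S. {b \<in> A. growth b (real (len s))})" by (simp add: \<theta>_def)
    qed
    then show "finite (\<theta> ` H)"
      by (rule finite_subset) (intro finite_PiE S(1) fin of_nat_0_le_iff)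
    fix g k assume gk: "g \<in> H" "k \<in> H" "\<theta> g = \<theta> k"
    then have c: "g \<in> carrier G" "k \<in> carrier G" using car by auto
    define w where "w = inv g \<otimes> k"
    have wc: "w \<in> carrier G" using c by (simp add: w_def)
    have ws: "w \<otimes> s = s \<otimes> w" if "s \<in> S" for s
    proof -
      have sc: "s \<in> carrier G" using that S car by auto
      have "g \<otimes> s \<otimes> inv g = k \<otimes> s \<otimes> inv k" using fun_cong[OF gk(3), of s] that by (simp add: \<theta>_def)
      then have "g \<otimes> s = k \<otimes> s \<otimes> inv k \<otimes> g" using c sc inv_solve_right'[of "k \<otimes> s \<otimes> inv k" "g \<otimes> s" g] by simp
      then have "s = inv g \<otimes> (k \<otimes> s \<otimes> inv k \<otimes> g)" using c sc by (simp add: inv_solve_left)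
      also have "\<dots> = w \<otimes> s \<otimes> inv w" using c sc by (simp add: w_def inv_mult_group m_assoc)
      finally show ?thesis using wc sc inv_solve_right[of s "w \<otimes> s" w] by simp
    qed
    have "w \<otimes> a = a \<otimes> w" if "a \<in> A" for a
      using that unfolding S(3)[symmetric]
    proof (induction a rule: generate.induct)
      case (inv s)
      then have sc: "s \<in> carrier G" using S car by auto
      have "s \<otimes> (w \<otimes> inv s) = (w \<otimes> s) \<otimes> inv s" unfolding ws[OF inv] using sc wc by (simp add: m_assoc)
      also have "\<dots> = w" using sc wc by (simp add: m_assoc)
      finally have "s \<otimes> (w \<otimes> inv s) = w" .
      then show ?case using sc wc inv_solve_left[of "w \<otimes> inv s" s w] by simp
    next
      case (eng a b)
      then have c: "a \<in> carrier G" "b \<in> carrier G" using S car by auto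
      have "w \<otimes> (a \<otimes> b) = (w \<otimes> a) \<otimes> b" using c wc by (simp add: m_assoc)
      also have "\<dots> = a \<otimes> (w \<otimes> b)" unfolding eng(3) using c wc by (simp add: m_assoc)
      also have "\<dots> = a \<otimes> b \<otimes> w" unfolding eng(4) using c wc by (simp add: m_assoc)
      finally show ?case .
    qed (use wc ws in auto)
    then show "inv g \<otimes> k \<in> Z"
      using gk subgroup.m_closed[OF H] subgroup.m_inv_closed[OF H] by (simp add: Z_def w_def)
  qed
qed

text \<open>Together with \<open>commr_inv_right\<close> this shows that the elements commuting with
  \<open>x\<close> modulo a normal subgroup form a subgroup.\<close>

lemma commr_mult_right:
  assumes "x \<in> carrier G" "g \<in> carrier G" "h \<in> carrier G"
  shows "commr x (g \<otimes> h) = commr x g \<otimes> (g \<otimes> commr x h \<otimes> inv g)"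
proof -
  have c: "inv g \<otimes> (g \<otimes> y) = y" "inv x \<otimes> (x \<otimes> y) = y" if "y \<in> carrier G" for y
    using assms that by (simp_all add: m_assoc[symmetric])
  show ?thesis using assms c by (simp add: commr_def m_assoc inv_mult_group)
qed

lemma commr_inv_right:
  assumes "x \<in> carrier G" "g \<in> carrier G"
  shows "commr x (inv g) = inv g \<otimes> inv (commr x g) \<otimes> g"
proof -
  have c: "inv g \<otimes> (g \<otimes> y) = y" "inv x \<otimes> (x \<otimes> y) = y" if "y \<in> carrier G" for y
    using assms that by (simp_all add: m_assoc[symmetric])
  show ?thesis using assms c by (simp add: commr_def m_assoc inv_mult_group)
qed

lemma inv_commr: "x \<in> carrier G \<Longrightarrow> g \<in> carrier G \<Longrightarrow> inv (commr x g) = commr g x"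
  by (simp add: commr_def m_assoc inv_mult_group)

text \<open>Used for counting cosets: if the commutators of \<open>k\<close> and of \<open>g\<close>
  with \<open>s\<close> agree modulo a normal subgroup, then \<open>inv g \<otimes> k\<close>
  commutes with \<open>s\<close> modulo it.\<close>

lemma commr_diff:
  assumes "s \<in> carrier G" "g \<in> carrier G" "k \<in> carrier G"
  shows "commr (inv g \<otimes> k) s = (inv g) \<otimes> (commr k s \<otimes> inv (commr g s)) \<otimes> inv (inv g)"
proof -
  have c: "inv g \<otimes> (g \<otimes> y) = y" "inv s \<otimes> (s \<otimes> y) = y" "g \<otimes> (inv g \<otimes> y) = y" if "y \<in> carrier G" for y
    using assms that by (simp_all add: m_assoc[symmetric])
  show ?thesis using assms c by (simp add: commr_def m_assoc inv_mult_group)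
qed

text \<open>\<open>A\<close> is a torsion-free abelian subgroup of finite index in \<open>K\<close>,
  normal in \<open>H\<close>; \<open>Z\<close> is its centraliser, and \<open>W\<close> is the
  preimage in \<open>Z\<close> of the centre of \<open>Z / A\<close>. Commutators of
  \<open>W\<close> lie in \<open>A\<close>, which \<open>Z\<close> centralises, so they are trivial
  by \<open>central_commutator_trivial\<close> and \<open>W\<close> is abelian. It has finite index
  because commutators of \<open>Z\<close> take finitely many values in \<open>K\<close> modulo
  \<open>A\<close>.\<close>

lemma virt_free_step:
  assumes H: "subgroup H G" and K: "subgroup K G" "K \<subseteq> H"
    and norm: "\<And>h k. h \<in> H \<Longrightarrow> k \<in> K \<Longrightarrow> h \<otimes> k \<otimes> inv h \<in> K"
    and comm: "\<And>g h. g \<in> H \<Longrightarrow> h \<in> H \<Longrightarrow> commr g h \<in> K"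
    and vf: "virt_free K C0 B0"
  shows "\<exists>C B. virt_free H C B"
proof -
  obtain A0 where A0: "subgroup A0 G" "A0 \<subseteq> K" "\<And>x y. x \<in> A0 \<Longrightarrow> y \<in> A0 \<Longrightarrow> x \<otimes> y = y \<otimes> x"
    "\<And>x n. x \<in> A0 \<Longrightarrow> x [^] (n::nat) = \<one> \<Longrightarrow> n > 0 \<Longrightarrow> x = \<one>" "fin_index G K A0"
    using virt_freeD[OF vf] by blast
  obtain A where A: "subgroup A G" "A \<subseteq> A0" "fin_index G K A"
    and An: "\<And>h a. h \<in> H \<Longrightarrow> a \<in> A \<Longrightarrow> h \<otimes> a \<otimes> inv h \<in> A"
    using normal_power_subgroup[OF H K norm A0(1-3,5)] by blast
  have AH: "A \<subseteq> H" using A A0 K by blast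
  have Acomm: "x \<otimes> y = y \<otimes> x" if "x \<in> A" "y \<in> A" for x y using that A A0 by blast
  have Atf: "x = \<one>" if "x \<in> A" "x [^] (n::nat) = \<one>" "n > 0" for x n using that A A0 by blast
  define Z where "Z = {g \<in> H. \<forall>a\<in>A. g \<otimes> a = a \<otimes> g}"
  have Z: "subgroup Z G" "fin_index G H Z"
    using centralizer_fin_index[OF H A(1) AH Acomm Atf An] by (simp_all add: Z_def)
  have ZH: "Z \<subseteq> H" by (auto simp: Z_def)
  have car: "H \<subseteq> carrier G" "A \<subseteq> carrier G" "Z \<subseteq> carrier G"
    using subgroup.subset H A Z by blast+
  have A1: "x \<otimes> y \<in> A" "inv x \<in> A" if "x \<in> A" "y \<in> A" for x y
    using that subgroup.m_closed[OF A(1)] subgroup.m_inv_closed[OF A(1)] by auto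
  have Z1: "x \<otimes> y \<in> Z" "inv x \<in> Z" if "x \<in> Z" "y \<in> Z" for x y
    using that subgroup.m_closed[OF Z(1)] subgroup.m_inv_closed[OF Z(1)] by auto
  have H1: "inv x \<in> H" if "x \<in> H" for x using that subgroup.m_inv_closed[OF H] by auto
  have Zx: "subgroup {g \<in> Z. commr x g \<in> A} G" if x: "x \<in> H" for x
  proof (rule subgroupI)
    show "{g \<in> Z. commr x g \<in> A} \<subseteq> carrier G" using car by blast
    have "commr x \<one> = \<one>" using x car by (auto simp: commr_def)
    then have "\<one> \<in> {g \<in> Z. commr x g \<in> A}"
      using subgroup.one_closed[OF Z(1)] subgroup.one_closed[OF A(1)] by simp
    then show "{g \<in> Z. commr x g \<in> A} \<noteq> {}" by blast
    fix g assume g: "g \<in> {g \<in> Z. commr x g \<in> A}"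
    then have gc: "g \<in> Z" "g \<in> H" "g \<in> carrier G" "x \<in> carrier G" "commr x g \<in> A"
      using car x ZH by auto
    have "inv g \<otimes> inv (commr x g) \<otimes> inv (inv g) \<in> A"
      using An[OF H1[OF gc(2)]] A1(2) gc by blast
    then show "inv g \<in> {g \<in> Z. commr x g \<in> A}"
      using commr_inv_right[of x g] gc Z1 by simp
    fix h assume "h \<in> {g \<in> Z. commr x g \<in> A}"
    then have hc: "h \<in> Z" "h \<in> carrier G" "commr x h \<in> A" using car by auto
    show "g \<otimes> h \<in> {g \<in> Z. commr x g \<in> A}"
      using commr_mult_right[of x g h] gc hc Z1 A1(1) An[OF gc(2) hc(3)] by simp
  qed
  obtain S where S: "finite S" "S \<subseteq> Z" "generate G S = Z" using subgroup_generators[OF Z(1)] .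
  define W where "W = {g \<in> Z. \<forall>s\<in>S. commr g s \<in> A}"
  have WZ: "W \<subseteq> Z" by (auto simp: W_def)
  have comm_iff: "commr g h \<in> A \<longleftrightarrow> commr h g \<in> A" if "g \<in> carrier G" "h \<in> carrier G" for g h
    using inv_commr[of g h] inv_commr[of h g] A1(2) that by metis
  have Wall: "commr g h \<in> A" if g: "g \<in> W" and h: "h \<in> Z" for g h
  proof -
    have "S \<subseteq> {h \<in> Z. commr g h \<in> A}" using g S(2) by (auto simp: W_def)
    moreover have "g \<in> H" using g WZ ZH by blast
    ultimately have "generate G S \<subseteq> {h \<in> Z. commr g h \<in> A}" using generate_subgroup_incl Zx by blast
    then show ?thesis using h S(3) by blast
  qed
  \<comment> \<open>Commuting modulo \<open>A\<close> with the generators of \<open>Z\<close> is the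
    same as commuting modulo \<open>A\<close> with all of \<open>Z\<close>. In this form
    \<open>W\<close> is an intersection of subgroups.\<close>
  have Weq: "W = {g \<in> Z. \<forall>h\<in>Z. commr h g \<in> A}"
  proof (rule equalityI; rule subsetI)
    fix g assume g: "g \<in> W"
    then show "g \<in> {g \<in> Z. \<forall>h\<in>Z. commr h g \<in> A}" using Wall[OF g] comm_iff car WZ by blast
  next
    fix g assume g: "g \<in> {g \<in> Z. \<forall>h\<in>Z. commr h g \<in> A}"
    then have "commr g s \<in> A" if "s \<in> S" for s
      using that comm_iff[of g s] car S(2) by blast
    then show "g \<in> W" using g by (simp add: W_def)
  qed
  have W: "subgroup W G"
  proof -
    have "W = (\<Inter>h\<in>Z. {g \<in> Z. commr h g \<in> A})"
      using subgroup.one_closed[OF Z(1)] by (auto simp: Weq)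
    moreover have "subgroup (\<Inter>h\<in>Z. {g \<in> Z. commr h g \<in> A}) G"
      using Zx ZH subgroup.one_closed[OF Z(1)] by (intro subgroups_Inter) auto
    ultimately show ?thesis by simp
  qed
  have finW: "fin_index G Z W"
  proof -
    obtain \<kappa> :: "'g \<Rightarrow> 'g" where \<kappa>: "finite (\<kappa> ` K)"
      "\<And>g k. g \<in> K \<Longrightarrow> k \<in> K \<Longrightarrow> \<kappa> g = \<kappa> k \<Longrightarrow> inv g \<otimes> k \<in> A"
      using fin_indexE[OF A(3) K(1) A(1)] by blast
    \<comment> \<open>\<open>\<kappa>\<close> compares two elements as an inverse times the other.
      Inverting the commutators turns this into the quotient that occurs in
      \<open>commr_diff\<close>.\<close>
    define \<theta> where "\<theta> g = (\<lambda>s\<in>S. \<kappa> (inv (commr g s)))" for g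
    have cK: "inv (commr g s) \<in> K" if "g \<in> Z" "s \<in> S" for g s
      using comm that ZH S(2) subgroup.m_inv_closed[OF K(1)] by blast
    show ?thesis
    proof (rule fin_indexI)
      have "\<theta> ` Z \<subseteq> (\<Pi>\<^sub>E s\<in>S. \<kappa> ` K)" using cK by (auto simp: \<theta>_def)
      then show "finite (\<theta> ` Z)" by (rule finite_subset) (intro finite_PiE S(1) \<kappa>(1))
      fix g k assume gk: "g \<in> Z" "k \<in> Z" "\<theta> g = \<theta> k"
      show "inv g \<otimes> k \<in> W" unfolding W_def
      proof (intro CollectI conjI ballI)
        show "inv g \<otimes> k \<in> Z" using gk Z1 by blast
        fix s assume s: "s \<in> S"
        have c: "s \<in> carrier G" "g \<in> carrier G" "k \<in> carrier G" using s S gk car by auto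
        have "\<kappa> (inv (commr k s)) = \<kappa> (inv (commr g s))"
          using fun_cong[OF gk(3), of s] s by (simp add: \<theta>_def)
        then have "inv (inv (commr k s)) \<otimes> inv (commr g s) \<in> A" using \<kappa>(2) cK gk s by blast
        then have "commr k s \<otimes> inv (commr g s) \<in> A" using c by (simp add: commr_def)
        then show "commr (inv g \<otimes> k) s \<in> A"
          using commr_diff[OF c] An[of "inv g"] H1 gk ZH by auto
      qed
    qed
  qed
  have Wcomm: "g \<otimes> h = h \<otimes> g" if g: "g \<in> W" and h: "h \<in> W" for g h
  proof -
    define z where "z = commr g h"
    have zA: "z \<in> A" unfolding z_def using Wall g h WZ by blast
    have c: "g \<in> carrier G" "h \<in> carrier G" "z \<in> carrier G" using g h WZ zA car by auto
    have gZ: "g \<in> Z" "h \<in> Z" using g h WZ by auto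
    have zc: "z \<otimes> g = g \<otimes> z" "z \<otimes> h = h \<otimes> z" using gZ zA by (auto simp: Z_def)
    have gh: "g \<otimes> h = z \<otimes> h \<otimes> g"
    proof -
      have "inv h \<otimes> (h \<otimes> g) = g" using c by (simp add: m_assoc[symmetric])
      then show ?thesis using c by (simp add: z_def commr_def m_assoc)
    qed
    have "z = \<one>"
    proof (rule ccontr)
      assume "z \<noteq> \<one>"
      then have "\<And>n::nat. n > 0 \<Longrightarrow> z [^] n \<noteq> \<one>" using Atf zA by blast
      then show False using central_commutator_trivial[OF c zc gh] by blast
    qed
    then show ?thesis using gh c by simp
  qed
  have "fin_index G H W" using fin_index_trans[OF Z(2) finW H Z(1) ZH] .
  then have "\<exists>B. virt_free H W B" using virt_freeI[OF H W _ Wcomm] WZ ZH by blast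
  then show ?thesis by blast
qed

lemma solvable_virt_free: "solvable_seq G H \<Longrightarrow> \<exists>C B. virt_free H C B"
proof (induction rule: solvable_seq.induct)
  case unity
  have sub: "subgroup {\<one>} G" using triv_subgroup .
  moreover have "fin_index G {\<one>} {\<one>}" unfolding fin_index_def by (intro exI[of _ "{\<one>}"]) auto
  ultimately show ?case using virt_freeI[OF sub sub] by auto
next
  case (extension K H)
  have H: "subgroup H G" by fact
  interpret H: group "G\<lparr>carrier := H\<rparr>" using subgroup_imp_group[OF H] .
  have KH: "subgroup K (G\<lparr>carrier := H\<rparr>)" using extension(2) by (rule normal_imp_subgroup)
  have K: "subgroup K G" "K \<subseteq> H" using incl_subgroup[OF H KH] subgroup.subset[OF KH] by auto
  obtain C B where vf: "virt_free K C B" using extension by blast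
  show ?case
  proof (rule virt_free_step[OF H K _ _ vf])
    show "h \<otimes> k \<otimes> inv h \<in> K" if "h \<in> H" "k \<in> K" for h k
      using normal.inv_op_closed2[OF extension(2), of h k] that H by simp
    show "commr g h \<in> K" if "g \<in> H" "h \<in> H" for g h
    proof -
      have "commr g h \<in> derived G H"
        unfolding derived_def commr_def using that by (intro generate.incl) blast
      then show ?thesis using derived_of_subgroup_minimal[OF extension(2,3,4)] by blast
    qed
  qed
qed

theorem solvable_virtually_free_abelian:
  assumes "solvable G"
  shows "virtually_free_abelian G"
proof -
  obtain C B where "virt_free (carrier G) C B"
    using solvable_virt_free assms unfolding solvable_def by blast
  then have C: "subgroup C G" "comm_group (G\<lparr>carrier := C\<rparr>)" "finite B" "B \<subseteq> C"
    "comm_group.indep (G\<lparr>carrier := C\<rparr>) B"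
    "fin_index G (carrier G) (comm_group.spanned (G\<lparr>carrier := C\<rparr>) B)"
    by (simp_all add: virt_free_def)
  interpret C: comm_group "G\<lparr>carrier := C\<rparr>" by (rule C(2))
  have "subgroup (C.spanned B) (G\<lparr>carrier := C\<rparr>)" using C.subgroup_spanned C(4) by simp
  then have sub: "subgroup (C.spanned B) G" using incl_subgroup[OF C(1)] by blast
  have "G\<lparr>carrier := C.spanned B\<rparr> \<cong> free_Abelian_group B"
    using C.spanned_iso_free[of B] C by simp
  then show ?thesis unfolding virtually_free_abelian_def
    using sub fin_index_rcosets[OF C(6) sub] by blast
qed

end

section \<open>Local systems and lifts of homotopies\<close>

text \<open>Continuity on a segment in pointwise form, which restricts to subsegments at
  once.\<close>

definition path_on :: "'a topology \<Rightarrow> (real \<Rightarrow> 'a) \<Rightarrow> real \<Rightarrow> real \<Rightarrow> bool" where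
  "path_on X c a b \<longleftrightarrow> (\<forall>t\<in>{a..b}. c t \<in> topspace X \<and>
    (\<forall>W. openin X W \<and> c t \<in> W \<longrightarrow> (\<exists>d>0. \<forall>u\<in>{a..b}. \<bar>u - t\<bar> < d \<longrightarrow> c u \<in> W)))"

lemma path_on_continuous_map:
  assumes "continuous_map (top_of_set {a..b}) X c"
  shows "path_on X c a b"
  unfolding path_on_def
proof (intro ballI conjI allI impI)
  fix t assume t: "t \<in> {a..b}"
  then show "c t \<in> topspace X" using assms unfolding continuous_map_def by auto
  fix W assume W: "openin X W \<and> c t \<in> W"
  have "openin (top_of_set {a..b}) {u \<in> {a..b}. c u \<in> W}"
    using assms W unfolding continuous_map_def by auto
  then obtain e where "e > 0" "\<forall>u\<in>{a..b}. dist u t < e \<longrightarrow> u \<in> {u \<in> {a..b}. c u \<in> W}"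
    using t W unfolding openin_euclidean_subtopology_iff by (metis (no_types, lifting) mem_Collect_eq)
  then show "\<exists>d>0. \<forall>u\<in>{a..b}. \<bar>u - t\<bar> < d \<longrightarrow> c u \<in> W" by (auto simp: dist_real_def)
qed

lemma path_on_subset: "path_on X c a b \<Longrightarrow> a \<le> a' \<Longrightarrow> b' \<le> b \<Longrightarrow> path_on X c a' b'"
  unfolding path_on_def by (meson atLeastAtMost_iff order_trans)

text \<open>A covering given by its fibres alone: \<open>tr k k'\<close> identifies the fibre over
  \<open>k\<close> with the fibre over a point \<open>k'\<close> of the chart around
  \<open>k\<close>. The total space carries no topology; path lifts are defined directly as locally
  constant sections.\<close>

locale local_system =
  fixes X :: "'a topology" and \<Gamma> :: "'a \<Rightarrow> 's set" and U :: "'a \<Rightarrow> 'a set"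
    and tr :: "'a \<Rightarrow> 'a \<Rightarrow> 's \<Rightarrow> 's"
  assumes U_open: "k \<in> topspace X \<Longrightarrow> openin X (U k)"
    and U_self: "k \<in> topspace X \<Longrightarrow> k \<in> U k"
    and tr_in: "k \<in> topspace X \<Longrightarrow> k' \<in> U k \<Longrightarrow> s \<in> \<Gamma> k \<Longrightarrow> tr k k' s \<in> \<Gamma> k'"
    and tr_inj: "k \<in> topspace X \<Longrightarrow> k' \<in> U k \<Longrightarrow> s \<in> \<Gamma> k \<Longrightarrow> s' \<in> \<Gamma> k \<Longrightarrow> tr k k' s = tr k k' s' \<Longrightarrow> s = s'"
    and tr_surj: "k \<in> topspace X \<Longrightarrow> k' \<in> U k \<Longrightarrow> s' \<in> \<Gamma> k' \<Longrightarrow> \<exists>s\<in>\<Gamma> k. tr k k' s = s'"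
    and tr_self: "k \<in> topspace X \<Longrightarrow> s \<in> \<Gamma> k \<Longrightarrow> tr k k s = s"
    and tr_cocycle: "k\<^sub>0 \<in> topspace X \<Longrightarrow> k\<^sub>1 \<in> U k\<^sub>0 \<Longrightarrow> k \<in> U k\<^sub>0 \<Longrightarrow> k \<in> U k\<^sub>1 \<Longrightarrow> s \<in> \<Gamma> k\<^sub>0 \<Longrightarrow>
      tr k\<^sub>1 k (tr k\<^sub>0 k\<^sub>1 s) = tr k\<^sub>0 k s"
begin

definition lift :: "(real \<Rightarrow> 'a) \<Rightarrow> (real \<Rightarrow> 's) \<Rightarrow> real \<Rightarrow> real \<Rightarrow> bool" where
  "lift c s a b \<longleftrightarrow> (\<forall>t\<in>{a..b}. s t \<in> \<Gamma> (c t) \<and>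
    (\<exists>d>0. \<forall>u\<in>{a..b}. \<bar>u - t\<bar> < d \<longrightarrow> c u \<in> U (c t) \<and> s u = tr (c t) (c u) (s t)))"

lemma lift_subset: "lift c s a b \<Longrightarrow> a \<le> a' \<Longrightarrow> b' \<le> b \<Longrightarrow> lift c s a' b'"
  unfolding lift_def by (meson atLeastAtMost_iff order_trans)

lemma lift_in: "lift c s a b \<Longrightarrow> a \<le> t \<Longrightarrow> t \<le> b \<Longrightarrow> s t \<in> \<Gamma> (c t)"
  unfolding lift_def by auto

lemma lift_local:
  assumes c: "path_on X c a b" and k: "k \<in> topspace X" "\<And>u. u \<in> {a..b} \<Longrightarrow> c u \<in> U k" and s: "s \<in> \<Gamma> k"
  shows "lift c (\<lambda>u. tr k (c u) s) a b"
  unfolding lift_def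
proof (intro ballI conjI)
  fix t assume t: "t \<in> {a..b}"
  show "tr k (c t) s \<in> \<Gamma> (c t)" using tr_in k t s by blast
  have ct: "c t \<in> topspace X" using c t unfolding path_on_def by blast
  then obtain d where d: "d > 0" "\<forall>u\<in>{a..b}. \<bar>u - t\<bar> < d \<longrightarrow> c u \<in> U (c t)"
    using c t U_open[OF ct] U_self[OF ct] unfolding path_on_def by blast
  show "\<exists>d>0. \<forall>u\<in>{a..b}. \<bar>u - t\<bar> < d \<longrightarrow> c u \<in> U (c t) \<and> tr k (c u) s = tr (c t) (c u) (tr k (c t) s)"
    using d tr_cocycle[OF k(1)] k(2) t s by (intro exI[of _ d]) metis
qed

lemma lift_unique:
  assumes "a \<le> b" "path_on X c a b" "lift c s a b" "lift c s' a b"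
  shows "s a = s' a \<longleftrightarrow> s b = s' b"
proof -
  \<comment> \<open>\<open>Bolzano\<close> speaks about all short intervals around a point, also
    those that leave the segment, so the predicate itself carries the bounds. The local case holds
    because near a point both lifts are determined by their values there.\<close>
  have "a \<le> a \<and> b \<le> b \<longrightarrow> (s a = s' a \<longleftrightarrow> s b = s' b)"
    using assms(1)
  proof (induction rule: Bolzano[where P = "\<lambda>u v. a \<le> u \<and> v \<le> b \<longrightarrow> (s u = s' u \<longleftrightarrow> s v = s' v)"])
    case (trans u v w)
    then show ?case by auto
  next
    case (local x)
    then have x: "x \<in> {a..b}" by auto
    obtain d where d: "d > 0"
      "\<forall>u\<in>{a..b}. \<bar>u - x\<bar> < d \<longrightarrow> c u \<in> U (c x) \<and> s u = tr (c x) (c u) (s x)"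
      using assms(3) x unfolding lift_def by blast
    obtain d' where d': "d' > 0"
      "\<forall>u\<in>{a..b}. \<bar>u - x\<bar> < d' \<longrightarrow> c u \<in> U (c x) \<and> s' u = tr (c x) (c u) (s' x)"
      using assms(4) x unfolding lift_def by blast
    have cx: "c x \<in> topspace X" "s x \<in> \<Gamma> (c x)" "s' x \<in> \<Gamma> (c x)"
      using assms x unfolding path_on_def lift_def by auto
    have eq: "s u = s' u \<longleftrightarrow> s x = s' x" if "u \<in> {a..b}" "\<bar>u - x\<bar> < min d d'" for u
    proof -
      have "c u \<in> U (c x)" "s u = tr (c x) (c u) (s x)" "s' u = tr (c x) (c u) (s' x)"
        using d(2) d'(2) that by auto
      then show ?thesis using tr_inj[OF cx(1) _ cx(2,3), of "c u"] by auto
    qed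
    show ?case
    proof (intro exI[of _ "min d d'"] conjI allI impI)
      fix u v assume uv: "u \<le> x \<and> x \<le> v \<and> v - u < min d d'" "a \<le> u \<and> v \<le> b"
      then have "u \<in> {a..b}" "\<bar>u - x\<bar> < min d d'" "v \<in> {a..b}" "\<bar>v - x\<bar> < min d d'" by auto
      then show "s u = s' u \<longleftrightarrow> s v = s' v" using eq by blast
    qed (use d d' in simp)
  qed
  then show ?thesis by simp
qed

lemma lift_glue:
  assumes s: "lift c s a b" and s': "lift c s' b e" and eq: "s b = s' b" and "a \<le> b" "b \<le> e"
  shows "lift c (\<lambda>t. if t \<le> b then s t else s' t) a e"
  unfolding lift_def
proof (intro ballI conjI)
  fix t assume t: "t \<in> {a..e}"
  let ?s = "\<lambda>t. if t \<le> b then s t else s' t"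
  show "?s t \<in> \<Gamma> (c t)" using t lift_in[OF s, of t] lift_in[OF s', of t] by auto
  have L: "\<exists>d>0. \<forall>u\<in>{a..b}. \<bar>u - t\<bar> < d \<longrightarrow> c u \<in> U (c t) \<and> s u = tr (c t) (c u) (s t)" if "t \<le> b"
    using s that t unfolding lift_def by auto
  have R: "\<exists>d>0. \<forall>u\<in>{b..e}. \<bar>u - t\<bar> < d \<longrightarrow> c u \<in> U (c t) \<and> s' u = tr (c t) (c u) (s' t)" if "t \<ge> b"
    using s' that t unfolding lift_def by auto
  consider "t < b" | "t = b" | "t > b" by linarith
  then show "\<exists>d>0. \<forall>u\<in>{a..e}. \<bar>u - t\<bar> < d \<longrightarrow> c u \<in> U (c t) \<and> ?s u = tr (c t) (c u) (?s t)"
  proof cases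
    case 1
    then obtain d where d: "d > 0" "\<forall>u\<in>{a..b}. \<bar>u - t\<bar> < d \<longrightarrow> c u \<in> U (c t) \<and> s u = tr (c t) (c u) (s t)"
      using L by (meson less_imp_le)
    show ?thesis
    proof (intro exI[of _ "min d (b - t)"] conjI ballI impI)
      fix u assume "u \<in> {a..e}" "\<bar>u - t\<bar> < min d (b - t)"
      then have u: "u \<in> {a..b}" "\<bar>u - t\<bar> < d" by auto
      then show "c u \<in> U (c t)" "?s u = tr (c t) (c u) (?s t)" using d(2) 1 by auto
    qed (use d 1 in auto)
  next
    case 2
    then obtain d where d: "d > 0" "\<forall>u\<in>{a..b}. \<bar>u - t\<bar> < d \<longrightarrow> c u \<in> U (c t) \<and> s u = tr (c t) (c u) (s t)"
      using L by blast
    obtain d' where d': "d' > 0" "\<forall>u\<in>{b..e}. \<bar>u - t\<bar> < d' \<longrightarrow> c u \<in> U (c t) \<and> s' u = tr (c t) (c u) (s' t)"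
      using R 2 by blast
    show ?thesis
    proof (intro exI[of _ "min d d'"] conjI ballI impI)
      fix u assume u: "u \<in> {a..e}" "\<bar>u - t\<bar> < min d d'"
      have "c u \<in> U (c t) \<and> ?s u = tr (c t) (c u) (?s t)"
      proof (cases "u \<le> b")
        case True
        then have "u \<in> {a..b}" "\<bar>u - t\<bar> < d" using u by auto
        then show ?thesis using d(2)[rule_format, of u] True 2 by simp
      next
        case False
        then have "u \<in> {b..e}" "\<bar>u - t\<bar> < d'" using u by auto
        then show ?thesis using d'(2)[rule_format, of u] False 2 eq by simp
      qed
      then show "c u \<in> U (c t)" "?s u = tr (c t) (c u) (?s t)" by auto
    qed (use d d' in auto)
  next
    case 3
    then obtain d where d: "d > 0" "\<forall>u\<in>{b..e}. \<bar>u - t\<bar> < d \<longrightarrow> c u \<in> U (c t) \<and> s' u = tr (c t) (c u) (s' t)"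
      using R by (meson less_imp_le)
    show ?thesis
    proof (intro exI[of _ "min d (t - b)"] conjI ballI impI)
      fix u assume "u \<in> {a..e}" "\<bar>u - t\<bar> < min d (t - b)"
      then have u: "u \<in> {b..e}" "\<bar>u - t\<bar> < d" "u > b" by auto
      then show "c u \<in> U (c t)" "?s u = tr (c t) (c u) (?s t)" using d(2) 3 by auto
    qed (use d 3 in auto)
  qed
qed

lemma lift_exists:
  assumes "a \<le> b" "path_on X c a b" "s\<^sub>0 \<in> \<Gamma> (c a)"
  shows "\<exists>s. lift c s a b \<and> s a = s\<^sub>0"
proof -
  have "a \<le> a \<and> b \<le> b \<and> a \<le> b \<longrightarrow> (\<forall>s\<^sub>0\<in>\<Gamma> (c a). \<exists>s. lift c s a b \<and> s a = s\<^sub>0)"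
    using assms(1)
  proof (induction rule: Bolzano[where P = "\<lambda>u v. a \<le> u \<and> v \<le> b \<and> u \<le> v \<longrightarrow>
      (\<forall>s\<^sub>0\<in>\<Gamma> (c u). \<exists>s. lift c s u v \<and> s u = s\<^sub>0)"])
    case (trans u v w)
    show ?case
    proof (intro impI ballI)
      fix s\<^sub>0 assume uw: "a \<le> u \<and> w \<le> b \<and> u \<le> w" and s0: "s\<^sub>0 \<in> \<Gamma> (c u)"
      then obtain s where s: "lift c s u v" "s u = s\<^sub>0" using trans by force
      have "s v \<in> \<Gamma> (c v)" using lift_in[OF s(1)] trans by simp
      then obtain s' where s': "lift c s' v w" "s' v = s v" using trans uw by force
      then show "\<exists>s. lift c s u w \<and> s u = s\<^sub>0"
        using lift_glue[OF s(1) s'(1)] s trans by (intro exI[of _ "\<lambda>t. if t \<le> v then s t else s' t"]) auto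
    qed
  next
    case (local x)
    then have x: "x \<in> {a..b}" by auto
    then have cx: "c x \<in> topspace X" using assms unfolding path_on_def by auto
    obtain d where d: "d > 0" "\<forall>u\<in>{a..b}. \<bar>u - x\<bar> < d \<longrightarrow> c u \<in> U (c x)"
      using assms(2) x U_open[OF cx] U_self[OF cx] unfolding path_on_def by blast
    show ?case
    proof (intro exI[of _ d] conjI allI impI ballI)
      fix u v s\<^sub>0 assume uv: "u \<le> x \<and> x \<le> v \<and> v - u < d" "a \<le> u \<and> v \<le> b \<and> u \<le> v" and s0: "s\<^sub>0 \<in> \<Gamma> (c u)"
      have U: "c w \<in> U (c x)" if "w \<in> {u..v}" for w
        using d(2) that uv by auto
      obtain p where p: "p \<in> \<Gamma> (c x)" "tr (c x) (c u) p = s\<^sub>0"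
        using tr_surj[OF cx U[of u] s0] uv by auto
      have "path_on X c u v" using path_on_subset[OF assms(2)] uv by auto
      then show "\<exists>s. lift c s u v \<and> s u = s\<^sub>0"
        using lift_local[OF _ cx U p(1)] p(2) by (intro exI[of _ "\<lambda>w. tr (c x) (c w) p"]) auto
    qed (use d in auto)
  qed
  then show ?thesis using assms by blast
qed

text \<open>Inside one chart a lift is the transport of a single element of the central
  fibre.\<close>

lemma lift_in_chart:
  assumes "u \<le> v" "path_on X c u v" "k \<in> topspace X" "\<And>w. w \<in> {u..v} \<Longrightarrow> c w \<in> U k" "lift c s u v"
  obtains p where "p \<in> \<Gamma> k" "s u = tr k (c u) p" "s v = tr k (c v) p"
proof -
  have "s u \<in> \<Gamma> (c u)" using lift_in[OF assms(5)] assms(1) by simp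
  then obtain p where p: "p \<in> \<Gamma> k" "tr k (c u) p = s u" using tr_surj[OF assms(3), of "c u"] assms(1,4) by auto
  have l: "lift c (\<lambda>w. tr k (c w) p) u v" using lift_local[OF assms(2,3,4) p(1)] .
  have "s v = tr k (c v) p" using lift_unique[OF assms(1,2,5) l] p(2) by simp
  then show ?thesis using that p by simp
qed

section \<open>Lifting homotopies\<close>

context
  fixes H :: "real \<times> real \<Rightarrow> 'a"
  assumes cont: "continuous_map (top_of_set ({0..1} \<times> {0..1})) X H"
begin

lemma homotopy_in: "t \<in> {0..1} \<Longrightarrow> u \<in> {0..1} \<Longrightarrow> H (t, u) \<in> topspace X"
  using cont unfolding continuous_map_def by auto

lemma homotopy_box:
  assumes "t \<in> {0..1}" "u \<in> {0..1}"
  obtains d where "d > 0" "\<And>t' u'. t' \<in> {0..1} \<Longrightarrow> u' \<in> {0..1} \<Longrightarrow> \<bar>t' - t\<bar> < d \<Longrightarrow> \<bar>u' - u\<bar> < d \<Longrightarrow>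
    H (t', u') \<in> U (H (t, u))"
proof -
  let ?S = "{0..1} \<times> {0..1} :: (real \<times> real) set"
  have k: "H (t, u) \<in> topspace X" using homotopy_in assms .
  have "openin (top_of_set ?S) {q \<in> ?S. H q \<in> U (H (t, u))}"
    using cont U_open[OF k] unfolding continuous_map_def by auto
  moreover have "(t, u) \<in> {q \<in> ?S. H q \<in> U (H (t, u))}" using assms U_self[OF k] by auto
  ultimately obtain e where e: "e > 0" "\<forall>q\<in>?S. dist q (t, u) < e \<longrightarrow> H q \<in> U (H (t, u))"
    unfolding openin_euclidean_subtopology_iff by (metis (no_types, lifting) mem_Collect_eq)
  show ?thesis
  proof (rule that[of "e / 2"])
    fix t' u' assume *: "t' \<in> {0..1::real}" "u' \<in> {0..1::real}" "\<bar>t' - t\<bar> < e / 2" "\<bar>u' - u\<bar> < e / 2"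
    have "dist (t', u') (t, u) \<le> \<bar>t' - t\<bar> + \<bar>u' - u\<bar>"
      using sqrt_sum_squares_le_sum_abs[of "dist t' t" "dist u' u"] by (simp add: dist_Pair_Pair dist_real_def)
    then have "dist (t', u') (t, u) < e" using * by linarith
    then show "H (t', u') \<in> U (H (t, u))" using e(2) * by auto
  qed (use e in simp)
qed

lemma homotopy_path_on:
  assumes "t \<in> {0..1}"
  shows "path_on X (\<lambda>u. H (t, u)) 0 1"
proof (rule path_on_continuous_map)
  have "continuous_map (top_of_set {0..1}) (top_of_set ({0..1} \<times> {0..1})) (\<lambda>u::real. (t, u))"
    using assms by (auto intro!: continuous_intros)
  then show "continuous_map (top_of_set {0..1}) X (\<lambda>u. H (t, u))"
    using continuous_map_compose[OF _ cont, of "top_of_set {0..1}" "\<lambda>u. (t, u)"] by (simp add: o_def)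
qed

text \<open>The first coordinate of \<open>H\<close> is the homotopy parameter. The claim is proved
  for short pieces of the path, each inside one chart, and pieces are joined by
  \<open>Bolzano\<close>; the width \<open>d\<close> in the homotopy direction shrinks finitely
  often.\<close>

lemma lift_homotopy_near:
  assumes x: "x \<in> {0..1}"
  shows "\<exists>d>0. \<forall>t\<in>{0..1}. \<bar>t - x\<bar> < d \<longrightarrow> H (t, 0) \<in> U (H (x, 0)) \<and> H (t, 1) \<in> U (H (x, 1)) \<and>
    (\<forall>s s'. lift (\<lambda>u. H (x, u)) s 0 1 \<and> lift (\<lambda>u. H (t, u)) s' 0 1 \<and>
      s' 0 = tr (H (x, 0)) (H (t, 0)) (s 0) \<longrightarrow> s' 1 = tr (H (x, 1)) (H (t, 1)) (s 1))"
proof -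
  define Q where "Q u v d \<longleftrightarrow> (\<forall>t\<in>{0..1}. \<bar>t - x\<bar> < d \<longrightarrow> H (t, u) \<in> U (H (x, u)) \<and> H (t, v) \<in> U (H (x, v)) \<and>
    (\<forall>s s'. lift (\<lambda>u. H (x, u)) s u v \<and> lift (\<lambda>u. H (t, u)) s' u v \<and>
      s' u = tr (H (x, u)) (H (t, u)) (s u) \<longrightarrow> s' v = tr (H (x, v)) (H (t, v)) (s v)))" for u v d
  have "0 \<le> (0::real) \<and> (1::real) \<le> 1 \<and> (0::real) \<le> 1 \<longrightarrow> (\<exists>d>0. Q 0 1 d)"
    using zero_le_one
  proof (induction rule: Bolzano[where P = "\<lambda>u v. 0 \<le> u \<and> v \<le> 1 \<and> u \<le> v \<longrightarrow> (\<exists>d>0. Q u v d)"])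
    case (trans u v w)
    show ?case
    proof
      assume uw: "0 \<le> u \<and> w \<le> 1 \<and> u \<le> w"
      then obtain d d' where d: "d > 0" "d' > 0" "Q u v d" "Q v w d'" using trans by force
      have "Q u w (min d d')" unfolding Q_def
      proof (intro ballI impI)
        fix t assume t: "t \<in> {0..1}" "\<bar>t - x\<bar> < min d d'"
        have 1: "H (t, u) \<in> U (H (x, u)) \<and> H (t, v) \<in> U (H (x, v)) \<and>
          (\<forall>s s'. lift (\<lambda>u. H (x, u)) s u v \<and> lift (\<lambda>u. H (t, u)) s' u v \<and>
          s' u = tr (H (x, u)) (H (t, u)) (s u) \<longrightarrow> s' v = tr (H (x, v)) (H (t, v)) (s v))"
          using d(3) t unfolding Q_def by simp
        have 2: "H (t, v) \<in> U (H (x, v)) \<and> H (t, w) \<in> U (H (x, w)) \<and>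
          (\<forall>s s'. lift (\<lambda>u. H (x, u)) s v w \<and> lift (\<lambda>u. H (t, u)) s' v w \<and>
          s' v = tr (H (x, v)) (H (t, v)) (s v) \<longrightarrow> s' w = tr (H (x, w)) (H (t, w)) (s w))"
          using d(4) t unfolding Q_def by simp
        show "H (t, u) \<in> U (H (x, u)) \<and> H (t, w) \<in> U (H (x, w)) \<and>
          (\<forall>s s'. lift (\<lambda>u. H (x, u)) s u w \<and> lift (\<lambda>u. H (t, u)) s' u w \<and>
          s' u = tr (H (x, u)) (H (t, u)) (s u) \<longrightarrow> s' w = tr (H (x, w)) (H (t, w)) (s w))"
          using 1 2 lift_subset[of _ _ u w u v] lift_subset[of _ _ u w v w] trans(3,4)
          by (meson order_refl)
      qed
      then show "\<exists>d>0. Q u w d" using d by (intro exI[of _ "min d d'"]) auto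
    qed
  next
    case (local u)
    then have u: "u \<in> {0..1}" by auto
    have k: "H (x, u) \<in> topspace X" using homotopy_in[OF x u] .
    obtain d0 where d0: "d0 > 0" "\<And>t' u'. t' \<in> {0..1} \<Longrightarrow> u' \<in> {0..1} \<Longrightarrow> \<bar>t' - x\<bar> < d0 \<Longrightarrow>
      \<bar>u' - u\<bar> < d0 \<Longrightarrow> H (t', u') \<in> U (H (x, u))"
      using homotopy_box[OF x u] by blast
    show ?case
    proof (rule exI[of _ d0], intro conjI allI impI)
      fix v w assume "v \<le> u \<and> u \<le> w \<and> w - v < d0" "0 \<le> v \<and> w \<le> 1 \<and> v \<le> w"
      then have vw: "v \<in> {0..1}" "w \<in> {0..1}" "v \<le> u" "u \<le> w" "w - v < d0" "v \<le> w" by auto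
      obtain d1 where d1: "d1 > 0" "\<And>t' u'. t' \<in> {0..1} \<Longrightarrow> u' \<in> {0..1} \<Longrightarrow> \<bar>t' - x\<bar> < d1 \<Longrightarrow>
        \<bar>u' - v\<bar> < d1 \<Longrightarrow> H (t', u') \<in> U (H (x, v))" using homotopy_box[OF x vw(1)] by blast
      obtain d2 where d2: "d2 > 0" "\<And>t' u'. t' \<in> {0..1} \<Longrightarrow> u' \<in> {0..1} \<Longrightarrow> \<bar>t' - x\<bar> < d2 \<Longrightarrow>
        \<bar>u' - w\<bar> < d2 \<Longrightarrow> H (t', u') \<in> U (H (x, w))" using homotopy_box[OF x vw(2)] by blast
      define d where "d = min d0 (min d1 d2)"
      have "Q v w d" unfolding Q_def
      proof (intro ballI impI)
        fix t assume t: "t \<in> {0..1}" "\<bar>t - x\<bar> < d"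
        have U1: "H (t, v) \<in> U (H (x, v))" using d1 t vw by (auto simp: d_def)
        have U2: "H (t, w) \<in> U (H (x, w))" using d2 t vw by (auto simp: d_def)
        have "s' w = tr (H (x, w)) (H (t, w)) (s w)"
          if *: "lift (\<lambda>u. H (x, u)) s v w \<and> lift (\<lambda>u. H (t, u)) s' v w \<and>
            s' v = tr (H (x, v)) (H (t, v)) (s v)" for s s'
        proof -
        have pth: "path_on X (\<lambda>u. H (y, u)) v w" if "y \<in> {0..1}" for y
          using path_on_subset[OF homotopy_path_on[OF that]] vw by auto
        have inU: "H (y, r) \<in> U (H (x, u))" if "y \<in> {0..1}" "\<bar>y - x\<bar> < d" "r \<in> {v..w}" for y r
          using d0(2)[of y r] that vw by (auto simp: d_def)
        have xx: "\<bar>x - x\<bar> < d" using d0 d1 d2 by (simp add: d_def)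
        have l: "lift (\<lambda>u. H (x, u)) s v w" "lift (\<lambda>u. H (t, u)) s' v w" using * by auto
        \<comment> \<open>Both lifts are read in the chart at \<open>H (x, u)\<close>. The cocycle
          condition compares this chart with those at the two ends of the piece.\<close>
        obtain p where p: "p \<in> \<Gamma> (H (x, u))" "s v = tr (H (x, u)) (H (x, v)) p" "s w = tr (H (x, u)) (H (x, w)) p"
          using lift_in_chart[OF vw(6) pth[OF x] k inU[OF x xx] l(1)] by blast
        obtain p' where p': "p' \<in> \<Gamma> (H (x, u))" "s' v = tr (H (x, u)) (H (t, v)) p'" "s' w = tr (H (x, u)) (H (t, w)) p'"
          using lift_in_chart[OF vw(6) pth[OF t(1)] k inU[OF t] l(2)] by blast
        have "tr (H (x, u)) (H (t, v)) p' = tr (H (x, v)) (H (t, v)) (tr (H (x, u)) (H (x, v)) p)"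
          using * p p' by simp
        also have "\<dots> = tr (H (x, u)) (H (t, v)) p"
          using tr_cocycle[OF k inU[OF x xx] inU[OF t] U1 p(1)] vw by auto
        finally have eq: "tr (H (x, u)) (H (t, v)) p' = tr (H (x, u)) (H (t, v)) p" .
        have "p' = p" using tr_inj[OF k inU[OF t, of v] p'(1) p(1) eq] vw by simp
        moreover have "tr (H (x, w)) (H (t, w)) (tr (H (x, u)) (H (x, w)) p) = tr (H (x, u)) (H (t, w)) p"
          using tr_cocycle[OF k inU[OF x xx] inU[OF t] U2 p(1)] vw by auto
        ultimately show ?thesis using p p' by simp
        qed
        then show "H (t, v) \<in> U (H (x, v)) \<and> H (t, w) \<in> U (H (x, w)) \<and>
          (\<forall>s s'. lift (\<lambda>u. H (x, u)) s v w \<and> lift (\<lambda>u. H (t, u)) s' v w \<and>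
          s' v = tr (H (x, v)) (H (t, v)) (s v) \<longrightarrow> s' w = tr (H (x, w)) (H (t, w)) (s w))"
          using U1 U2 by blast
      qed
      then show "\<exists>d>0. Q v w d" using d0(1) d1(1) d2(1) by (intro exI[of _ d]) (simp add: d_def)
    qed (use d0 in simp)
  qed
  then show ?thesis unfolding Q_def by simp
qed

text \<open>As the end points do not move, transport between them is the identity, and
  correspondence of nearby lifts means equality at the ends. A second use of \<open>Bolzano\<close>,
  now in the homotopy parameter, passes from 0 to 1.\<close>

lemma lift_homotopy:
  assumes ends: "\<And>t. t \<in> {0..1} \<Longrightarrow> H (t, 0) = v \<and> H (t, 1) = w"
    and s: "lift (\<lambda>u. H (0, u)) s 0 1" "lift (\<lambda>u. H (1, u)) s' 0 1" "s 0 = s' 0"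
  shows "s 1 = s' 1"
proof -
  have vw: "v \<in> topspace X" "w \<in> topspace X" using homotopy_in[of 0 0] homotopy_in[of 0 1] ends by auto
  have "0 \<le> (0::real) \<and> (1::real) \<le> 1 \<longrightarrow>
    (\<forall>s s'. lift (\<lambda>u. H (0, u)) s 0 1 \<and> lift (\<lambda>u. H (1, u)) s' 0 1 \<and> s 0 = s' 0 \<longrightarrow> s 1 = s' 1)"
    using zero_le_one
  proof (induction rule: Bolzano[where P = "\<lambda>t t'. 0 \<le> t \<and> t' \<le> 1 \<longrightarrow>
      (\<forall>s s'. lift (\<lambda>u. H (t, u)) s 0 1 \<and> lift (\<lambda>u. H (t', u)) s' 0 1 \<and> s 0 = s' 0 \<longrightarrow> s 1 = s' 1)"])
    case (trans t1 t2 t3)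
    show ?case
    proof (intro impI allI)
      fix s s' assume t: "0 \<le> t1 \<and> t3 \<le> 1"
        and *: "lift (\<lambda>u. H (t1, u)) s 0 1 \<and> lift (\<lambda>u. H (t3, u)) s' 0 1 \<and> s 0 = s' 0"
      have t2: "t2 \<in> {0..1}" "t1 \<in> {0..1}" using t trans(3,4) by auto
      have "s 0 \<in> \<Gamma> (H (t2, 0))" using lift_in[of _ s 0 1 0] * ends t2 by fastforce
      then obtain r where r: "lift (\<lambda>u. H (t2, u)) r 0 1" "r 0 = s 0"
        using lift_exists[OF zero_le_one homotopy_path_on[OF t2(1)]] by blast
      then have "s 1 = r 1" using trans(1) * t t2 by auto
      moreover have "r 1 = s' 1" using trans(2) r * t t2 by auto
      ultimately show "s 1 = s' 1" by simp
    qed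
  next
    case (local x)
    then have x: "x \<in> {0..1}" by auto
    from lift_homotopy_near[OF x] obtain d where d: "d > 0" "\<And>t s s'. t \<in> {0..1} \<Longrightarrow> \<bar>t - x\<bar> < d \<Longrightarrow>
      lift (\<lambda>u. H (x, u)) s 0 1 \<Longrightarrow> lift (\<lambda>u. H (t, u)) s' 0 1 \<Longrightarrow>
      s' 0 = tr (H (x, 0)) (H (t, 0)) (s 0) \<Longrightarrow> s' 1 = tr (H (x, 1)) (H (t, 1)) (s 1)" by blast
    have near: "s' 1 = r 1" if "t \<in> {0..1}" "\<bar>t - x\<bar> < d" "lift (\<lambda>u. H (x, u)) r 0 1"
        "lift (\<lambda>u. H (t, u)) s' 0 1" "s' 0 = r 0" for t r s'
    proof -
      have "r 0 \<in> \<Gamma> v" "r 1 \<in> \<Gamma> w"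
        using lift_in[OF that(3), of 0] lift_in[OF that(3), of 1] ends[OF x] by auto
      then show ?thesis
        using d(2)[OF that(1,2,3,4)] ends[OF x] ends[OF that(1)] that(5) tr_self vw by simp
    qed
    show ?case
    proof (intro exI[of _ d] conjI allI impI)
      fix t1 t2 s s' assume t: "t1 \<le> x \<and> x \<le> t2 \<and> t2 - t1 < d" "0 \<le> t1 \<and> t2 \<le> 1"
        and *: "lift (\<lambda>u. H (t1, u)) s 0 1 \<and> lift (\<lambda>u. H (t2, u)) s' 0 1 \<and> s 0 = s' 0"
      have t': "t1 \<in> {0..1}" "t2 \<in> {0..1}" "\<bar>t1 - x\<bar> < d" "\<bar>t2 - x\<bar> < d" using t x by auto
      have "s 0 \<in> \<Gamma> (H (x, 0))" using lift_in[of _ s 0 1 0] * ends t' x by fastforce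
      then obtain r where r: "lift (\<lambda>u. H (x, u)) r 0 1" "r 0 = s 0"
        using lift_exists[OF zero_le_one homotopy_path_on[OF x]] by blast
      then show "s 1 = s' 1" using near[OF t'(1,3) r(1)] near[OF t'(2,4) r(1)] * by metis
    qed (use d in auto)
  qed
  then show ?thesis using s by blast
qed

end

lemma lift_null_homotopic:
  assumes "simply_connected_space X" "pathin X \<gamma>" "\<gamma> 0 = \<gamma> 1" "lift \<gamma> s 0 1"
  shows "s 1 = s 0"
proof -
  have "homotopic_with (\<lambda>\<delta>. \<delta> 0 = \<gamma> 0 \<and> \<delta> 1 = \<gamma> 0) (top_of_set {0..1}) X \<gamma> (\<lambda>_. \<gamma> 0)"
    using assms(1-3) unfolding simply_connected_space_def by blast
  then have "\<exists>H. continuous_map (prod_topology (top_of_set {0..1::real}) (top_of_set {0..1::real})) X H \<and>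
    (\<forall>u. H (0, u) = \<gamma> u) \<and> (\<forall>u. H (1, u) = \<gamma> 0) \<and> (\<forall>t\<in>{0..1}. H (t, 0) = \<gamma> 0 \<and> H (t, 1) = \<gamma> 0)"
    unfolding homotopic_with_def .
  then obtain H where H': "continuous_map (prod_topology (top_of_set {0..1::real}) (top_of_set {0..1::real})) X H \<and>
    (\<forall>u. H (0, u) = \<gamma> u) \<and> (\<forall>u. H (1, u) = \<gamma> 0) \<and> (\<forall>t\<in>{0..1}. H (t, 0) = \<gamma> 0 \<and> H (t, 1) = \<gamma> 0)"
    by (rule exE)
  then have H: "continuous_map (prod_topology (top_of_set {0..1::real}) (top_of_set {0..1::real})) X H"
    "\<And>u. H (0, u) = \<gamma> u" "\<And>u. H (1, u) = \<gamma> 0"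
    "\<And>t. t \<in> {0..1} \<Longrightarrow> H (t, 0) = \<gamma> 0 \<and> H (t, 1) = \<gamma> 0"
    by blast+
  have "prod_topology (top_of_set {0..1::real}) (top_of_set {0..1::real}) = top_of_set ({0..1::real} \<times> {0..1::real})"
    by simp
  then have cont: "continuous_map (top_of_set ({0..1} \<times> {0..1})) X H" using H(1) by simp
  have top: "\<gamma> 0 \<in> topspace X" using assms(2) by (auto simp: pathin_def continuous_map_def)
  have s0: "s 0 \<in> \<Gamma> (\<gamma> 0)" using lift_in[OF assms(4)] by simp
  have "lift (\<lambda>u. H (1, u)) (\<lambda>_. s 0) 0 1"
    unfolding lift_def using H(3) s0 U_self[OF top] tr_self[OF top s0] by (auto intro: zero_less_one)
  moreover have "lift (\<lambda>u. H (0, u)) s 0 1" using assms(4) H(2) by simp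
  ultimately show ?thesis using lift_homotopy[OF cont H(4)] by blast
qed

end

section \<open>Face maps of unit cubes\<close>

abbreviation zero_corner :: "nat \<Rightarrow> real" where "zero_corner \<equiv> \<lambda>_. 0"

abbreviation flip :: "(nat \<Rightarrow> real) \<Rightarrow> nat \<Rightarrow> nat \<Rightarrow> real" where
  "flip c i \<equiv> c(i := 1 - c i)"

lemma cube_corners_iff:
  "c \<in> cube_corners n \<longleftrightarrow> (\<forall>i<n. c i = 0 \<or> c i = 1) \<and> (\<forall>i\<ge>n. c i = 0)"
  unfolding cube_corners_def unit_cube_def by auto

lemma cube_corners_value: "c \<in> cube_corners n \<Longrightarrow> c i = 0 \<or> c i = 1"
  unfolding cube_corners_iff by (metis linorder_not_le)

lemma cube_corners_unit: "c \<in> cube_corners n \<Longrightarrow> c \<in> unit_cube n"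
  by (simp add: cube_corners_def)

lemma open_cube_unit: "y \<in> open_cube n \<Longrightarrow> y \<in> unit_cube n"
  by (auto simp: open_cube_def unit_cube_def intro: less_imp_le)

lemma zero_corner_in: "zero_corner \<in> cube_corners n"
  by (simp add: cube_corners_iff)

lemma flip_in: "c \<in> cube_corners n \<Longrightarrow> i < n \<Longrightarrow> flip c i \<in> cube_corners n"
  by (auto simp: cube_corners_iff)

lemma flip_flip: "flip (flip c i) i = c"
  by auto

lemma flip_commute: "i \<noteq> j \<Longrightarrow> flip (flip c i) j = flip (flip c j) i"
  by auto

lemma corner_move_unit:
  "c \<in> cube_corners n \<Longrightarrow> i < n \<Longrightarrow> 0 \<le> t \<Longrightarrow> t \<le> 1 \<Longrightarrow> c(i := \<bar>c i - t\<bar>) \<in> unit_cube n"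
  by (auto simp: cube_corners_iff unit_cube_def)

text \<open>Any corner is reached from any other by flipping the coordinates in which they differ,
  one at a time.\<close>

lemma corner_induct [consumes 2, case_names base flip]:
  assumes c: "c \<in> cube_corners n" and c': "c' \<in> cube_corners n"
    and P: "P c" and step: "\<And>d i. d \<in> cube_corners n \<Longrightarrow> i < n \<Longrightarrow> P d \<Longrightarrow> P (flip d i)"
  shows "P c'"
  using c'
proof (induction "card {i. i < n \<and> c i \<noteq> c' i}" arbitrary: c')
  case 0
  then have "\<forall>i<n. c i = c' i" by auto
  then have "c i = c' i" for i using c 0 by (cases "i < n") (auto simp: cube_corners_iff)
  then have "c' = c" by auto
  then show ?case using P by simp
next
  case (Suc m)
  then have "{i. i < n \<and> c i \<noteq> c' i} \<noteq> {}" by (metis card.empty nat.distinct(1))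
  then obtain i where i: "i < n" "c i \<noteq> c' i" by auto
  have fi: "flip c' i \<in> cube_corners n" using flip_in Suc i by blast
  have "flip c' i i = c i"
    using cube_corners_value[OF c, of i] cube_corners_value[OF Suc.prems, of i] i by auto
  then have "{j. j < n \<and> c j \<noteq> flip c' i j} = {j. j < n \<and> c j \<noteq> c' j} - {i}" by auto
  then have "card {j. j < n \<and> c j \<noteq> flip c' i j} = m" using Suc.hyps(2) i by simp
  then have "P (flip c' i)" using Suc.hyps(1) fi by blast
  then have "P (flip (flip c' i) i)" using step fi i by blast
  then show ?case by (simp only: flip_flip)
qed

text \<open>The coordinate form of an isometry onto a face: coordinate \<open>i\<close> goes to
  coordinate \<open>\<sigma> i\<close>, reflected exactly if the bit of \<open>b\<close> there is 1,
  and all other coordinates are frozen at \<open>b\<close>, the image of the zero corner.\<close>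

definition face_map ::
    "nat \<Rightarrow> nat \<Rightarrow> (nat \<Rightarrow> nat) \<Rightarrow> (nat \<Rightarrow> real) \<Rightarrow> ((nat \<Rightarrow> real) \<Rightarrow> nat \<Rightarrow> real) \<Rightarrow> bool" where
  "face_map m n \<sigma> b h \<longleftrightarrow> inj_on \<sigma> {..<m} \<and> \<sigma> ` {..<m} \<subseteq> {..<n} \<and> b \<in> cube_corners n \<and>
     (\<forall>w\<in>unit_cube m. (\<forall>i<m. h w (\<sigma> i) = \<bar>b (\<sigma> i) - w i\<bar>) \<and> (\<forall>j. j \<notin> \<sigma> ` {..<m} \<longrightarrow> h w j = b j))"

lemma face_mapD:
  assumes "face_map m n \<sigma> b h"
  shows "inj_on \<sigma> {..<m}" "i < m \<Longrightarrow> \<sigma> i < n" "b \<in> cube_corners n"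
    "w \<in> unit_cube m \<Longrightarrow> i < m \<Longrightarrow> h w (\<sigma> i) = \<bar>b (\<sigma> i) - w i\<bar>"
    "w \<in> unit_cube m \<Longrightarrow> j \<notin> \<sigma> ` {..<m} \<Longrightarrow> h w j = b j"
  using assms unfolding face_map_def by auto

lemma unit_cube_bounds: "w \<in> unit_cube m \<Longrightarrow> 0 \<le> w i \<and> w i \<le> 1"
  unfolding unit_cube_def by (cases "i < m") auto

lemma unit_cube_out: "w \<in> unit_cube m \<Longrightarrow> i \<ge> m \<Longrightarrow> w i = 0"
  unfolding unit_cube_def by auto

lemma face_map_unit:
  assumes "face_map m n \<sigma> b h" "w \<in> unit_cube m"
  shows "h w \<in> unit_cube n"
proof -
  have "0 \<le> h w j \<and> h w j \<le> 1" for j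
  proof (cases "j \<in> \<sigma> ` {..<m}")
    case True
    then obtain i where "j = \<sigma> i" "i < m" by auto
    then show ?thesis using face_mapD(4)[OF assms, of i] unit_cube_bounds[OF assms(2), of i]
        cube_corners_value[OF face_mapD(3)[OF assms(1)], of j] by auto
  next
    case False
    then show ?thesis using face_mapD(5)[OF assms False]
        cube_corners_value[OF face_mapD(3)[OF assms(1)], of j] by auto
  qed
  moreover have "h w j = 0" if "j \<ge> n" for j
  proof -
    have "j \<notin> \<sigma> ` {..<m}" using face_mapD(2)[OF assms(1)] that by fastforce
    then show ?thesis using face_mapD(5)[OF assms] face_mapD(3)[OF assms(1)] that
      by (simp add: cube_corners_iff)
  qed
  ultimately show ?thesis by (simp add: unit_cube_def)
qed

lemma face_map_corner:
  assumes "face_map m n \<sigma> b h" "c \<in> cube_corners m"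
  shows "h c \<in> cube_corners n"
proof -
  have u: "c \<in> unit_cube m" using assms(2) by (rule cube_corners_unit)
  have "h c j = 0 \<or> h c j = 1" for j
  proof (cases "j \<in> \<sigma> ` {..<m}")
    case True
    then obtain i where "j = \<sigma> i" "i < m" by auto
    then show ?thesis using face_mapD(4)[OF assms(1) u, of i] cube_corners_value[OF assms(2), of i]
        cube_corners_value[OF face_mapD(3)[OF assms(1)], of j] by auto
  next
    case False
    then show ?thesis using face_mapD(5)[OF assms(1) u False]
        cube_corners_value[OF face_mapD(3)[OF assms(1)], of j] by auto
  qed
  then show ?thesis using face_map_unit[OF assms(1) u] by (simp add: cube_corners_def)
qed

lemma face_map_zero:
  assumes "face_map m n \<sigma> b h"
  shows "h zero_corner = b"
proof
  fix j
  have u: "zero_corner \<in> unit_cube m" by (simp add: unit_cube_def)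
  show "h zero_corner j = b j"
  proof (cases "j \<in> \<sigma> ` {..<m}")
    case True
    then obtain i where "j = \<sigma> i" "i < m" by auto
    then show ?thesis using face_mapD(4)[OF assms u, of i]
        cube_corners_value[OF face_mapD(3)[OF assms], of j] by auto
  qed (use face_mapD(5)[OF assms u] in auto)
qed

lemma face_map_move:
  assumes fm: "face_map m n \<sigma> b h" and c: "c \<in> cube_corners m" "i < m" and t: "0 \<le> t" "t \<le> 1"
  shows "h (c(i := \<bar>c i - t\<bar>)) = (h c)(\<sigma> i := \<bar>h c (\<sigma> i) - t\<bar>)"
proof
  fix j
  have u: "c \<in> unit_cube m" "c(i := \<bar>c i - t\<bar>) \<in> unit_cube m"
    using cube_corners_unit corner_move_unit assms by auto
  note D = face_mapD[OF fm]
  show "h (c(i := \<bar>c i - t\<bar>)) j = ((h c)(\<sigma> i := \<bar>h c (\<sigma> i) - t\<bar>)) j"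
  proof (cases "j \<in> \<sigma> ` {..<m}")
    case True
    then obtain l where l: "j = \<sigma> l" "l < m" by auto
    show ?thesis
    proof (cases "l = i")
      case True
      then show ?thesis using D(4)[OF u(1) c(2)] D(4)[OF u(2) c(2)] l t
          cube_corners_value[OF D(3), of j] cube_corners_value[OF c(1), of i] by auto
    next
      case False
      then have "\<sigma> l \<noteq> \<sigma> i" using D(1) l c by (auto simp: inj_on_def)
      then show ?thesis using D(4)[OF u(1) l(2)] D(4)[OF u(2) l(2)] l False by auto
    qed
  next
    case False
    then have "j \<noteq> \<sigma> i" using c by auto
    then show ?thesis using D(5)[OF u(1) False] D(5)[OF u(2) False] by simp
  qed
qed

lemma face_map_flip:
  assumes "face_map m n \<sigma> b h" "c \<in> cube_corners m" "i < m"
  shows "h (flip c i) = flip (h c) (\<sigma> i)"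
proof -
  have "flip c i = c(i := \<bar>c i - 1\<bar>)" using cube_corners_value[OF assms(2), of i] by auto
  moreover have "flip (h c) (\<sigma> i) = (h c)(\<sigma> i := \<bar>h c (\<sigma> i) - 1\<bar>)"
    using cube_corners_value[OF face_map_corner[OF assms(1,2)], of "\<sigma> i"] by auto
  ultimately show ?thesis using face_map_move[OF assms, of 1] by simp
qed

definition near :: "nat \<Rightarrow> real \<Rightarrow> (nat \<Rightarrow> real) \<Rightarrow> (nat \<Rightarrow> real) \<Rightarrow> bool" where
  "near n r x y \<longleftrightarrow> (\<forall>i<n. \<bar>x i - y i\<bar> < r)"

lemma face_map_near:
  assumes fm: "face_map m n \<sigma> b h" and w: "w \<in> unit_cube m" "w' \<in> unit_cube m" and r: "r > 0"
  shows "near n r (h w) (h w') \<longleftrightarrow> near m r w w'"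
proof -
  note D = face_mapD[OF fm]
  have eq: "\<bar>h w (\<sigma> i) - h w' (\<sigma> i)\<bar> = \<bar>w i - w' i\<bar>" if "i < m" for i
    using D(4)[OF w(1) that] D(4)[OF w(2) that] cube_corners_value[OF D(3), of "\<sigma> i"]
      unit_cube_bounds[OF w(1), of i] unit_cube_bounds[OF w(2), of i] by auto
  have "\<bar>h w j - h w' j\<bar> < r" if "near m r w w'" "j < n" for j
  proof (cases "j \<in> \<sigma> ` {..<m}")
    case True
    then show ?thesis using eq that by (auto simp: near_def)
  next
    case False
    then show ?thesis using D(5)[OF w(1) False] D(5)[OF w(2) False] r by simp
  qed
  then show ?thesis using eq D(2) by (force simp: near_def)
qed

lemma near_sym: "near n r x y \<Longrightarrow> near n r y x"
  by (simp add: near_def abs_minus_commute)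

lemma near_triangle: "near n r x y \<Longrightarrow> near n s y z \<Longrightarrow> near n (r + s) x z"
  unfolding near_def
proof (intro allI impI)
  fix i assume *: "\<forall>i<n. \<bar>x i - y i\<bar> < r" "\<forall>i<n. \<bar>y i - z i\<bar> < s" and "i < n"
  then have "\<bar>x i - y i\<bar> < r" "\<bar>y i - z i\<bar> < s" by auto
  then show "\<bar>x i - z i\<bar> < r + s" by linarith
qed

lemma near_mono: "near n r x y \<Longrightarrow> r \<le> s \<Longrightarrow> near n s x y"
  unfolding near_def by fastforce

lemma face_map_comp:
  assumes fm: "face_map m n \<sigma> b h" and gm: "face_map k m \<tau> a g"
  shows "face_map k n (\<sigma> \<circ> \<tau>) (h a) (h \<circ> g)"
proof -
  note D = face_mapD[OF fm] and D' = face_mapD[OF gm]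
  have au: "a \<in> unit_cube m" using D'(3) by (rule cube_corners_unit)
  have \<tau>m: "\<tau> ` {..<k} \<subseteq> {..<m}" using D'(2) by auto
  have inj: "inj_on (\<sigma> \<circ> \<tau>) {..<k}" using comp_inj_on[OF D'(1) inj_on_subset[OF D(1) \<tau>m]] .
  show ?thesis unfolding face_map_def
  proof (intro conjI ballI allI impI)
    show "(\<sigma> \<circ> \<tau>) ` {..<k} \<subseteq> {..<n}" using D(2) D'(2) by auto
    show "h a \<in> cube_corners n" using face_map_corner[OF fm D'(3)] .
    fix w assume w: "w \<in> unit_cube k"
    have gw: "g w \<in> unit_cube m" using face_map_unit[OF gm w] .
    show "(h \<circ> g) w ((\<sigma> \<circ> \<tau>) i) = \<bar>h a ((\<sigma> \<circ> \<tau>) i) - w i\<bar>" if i: "i < k" for i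
      using D(4)[OF gw D'(2)[OF i]] D(4)[OF au D'(2)[OF i]] D'(4)[OF w i]
        cube_corners_value[OF D(3), of "\<sigma> (\<tau> i)"] cube_corners_value[OF D'(3), of "\<tau> i"]
        unit_cube_bounds[OF w, of i] by auto
    fix j assume j: "j \<notin> (\<sigma> \<circ> \<tau>) ` {..<k}"
    show "(h \<circ> g) w j = h a j"
    proof (cases "j \<in> \<sigma> ` {..<m}")
      case True
      then obtain l where l: "j = \<sigma> l" "l < m" by auto
      then have "l \<notin> \<tau> ` {..<k}" using j by auto
      then show ?thesis using D(4)[OF gw l(2)] D(4)[OF au l(2)] D'(5)[OF w] l by simp
    next
      case False
      then show ?thesis using D(5)[OF gw False] D(5)[OF au False] by simp
    qed
  qed (use inj in auto)
qed

lemma face_map_surj: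
  assumes fm: "face_map m n \<sigma> b h" and x: "x \<in> unit_cube n" "\<And>j. j < n \<Longrightarrow> j \<notin> \<sigma> ` {..<m} \<Longrightarrow> x j = b j"
  obtains w where "w \<in> unit_cube m" "h w = x" "\<And>i. i < m \<Longrightarrow> w i = \<bar>b (\<sigma> i) - x (\<sigma> i)\<bar>"
proof -
  note D = face_mapD[OF fm]
  define w where "w i = (if i < m then \<bar>b (\<sigma> i) - x (\<sigma> i)\<bar> else 0)" for i
  have v: "b j = 0 \<or> b j = 1" "0 \<le> x j" "x j \<le> 1" for j
    using cube_corners_value[OF D(3), of j] unit_cube_bounds[OF x(1), of j] by auto
  have w: "w \<in> unit_cube m"
    unfolding unit_cube_def w_def using v by (auto simp: abs_if; smt (verit))
  have "h w j = x j" for j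
  proof (cases "j \<in> \<sigma> ` {..<m}")
    case True
    then obtain i where i: "j = \<sigma> i" "i < m" by auto
    then show ?thesis using D(4)[OF w i(2)] v[of j] by (auto simp: w_def)
  next
    case False
    then show ?thesis using D(5)[OF w False] x unit_cube_out[OF x(1), of j] D(3)
      by (cases "j < n") (auto simp: cube_corners_iff)
  qed
  then show ?thesis using that[OF w] by (auto simp: w_def)
qed

lemma card_eq_sum_le_one:
  fixes f :: "nat \<Rightarrow> real"
  assumes "finite J" "\<And>j. j \<in> J \<Longrightarrow> f j \<le> 1" "sum f J = real (card J)" "j \<in> J"
  shows "f j = 1"
proof (rule ccontr)
  assume "f j \<noteq> 1"
  then have "f j < 1" using assms by force
  then have "sum f J < sum (\<lambda>_. 1) J" using assms by (intro sum_strict_mono_ex1) auto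
  then show False using assms(3) by simp
qed

text \<open>An isometry onto a face maps pairs of points at the maximal distance, that is, pairs of
  opposite corners, to such pairs, hence corners to corners and edges to edges. The distances from
  a point to the corner 0 and to its i-th neighbour determine its i-th coordinate.\<close>

lemma cube_isometry_face_map:
  assumes iso: "cube_isometry m (unit_cube m) n F h"
    and F: "F = {x \<in> unit_cube n. \<forall>i\<in>I. x i = \<epsilon> i}" "I \<subseteq> {..<n}" "\<epsilon> \<in> I \<rightarrow> {0, 1}"
  obtains \<sigma> b where "face_map m n \<sigma> b h" "\<sigma> ` {..<m} = {..<n} - I" "\<And>i. i \<in> I \<Longrightarrow> b i = \<epsilon> i"
proof -
  define J where "J = {..<n} - I"
  have J: "finite J" "J \<subseteq> {..<n}" by (auto simp: J_def)
  have bij: "bij_betw h (unit_cube m) F" using iso by (simp add: cube_isometry_def)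
  have hF: "h x \<in> F" if "x \<in> unit_cube m" for x using bij that by (auto simp: bij_betw_def)
  have dist: "(\<Sum>j<n. (h x j - h y j)\<^sup>2) = (\<Sum>i<m. (x i - y i)\<^sup>2)"
    if "x \<in> unit_cube m" "y \<in> unit_cube m" for x y
  proof -
    have "sqrt (\<Sum>j<n. (h x j - h y j)\<^sup>2) = sqrt (\<Sum>i<m. (x i - y i)\<^sup>2)"
      using iso that unfolding cube_isometry_def L2_set_def by blast
    then show ?thesis by simp
  qed
  have FJ: "(\<Sum>j<n. (u j - v j)\<^sup>2) = (\<Sum>j\<in>J. (u j - v j)\<^sup>2)" if "u \<in> F" "v \<in> F" for u v
    by (rule sum.mono_neutral_right) (use that in \<open>auto simp: J_def F\<close>)
  have distJ: "(\<Sum>j\<in>J. (h x j - h y j)\<^sup>2) = (\<Sum>i<m. (x i - y i)\<^sup>2)"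
    if "x \<in> unit_cube m" "y \<in> unit_cube m" for x y
    using dist[OF that] FJ[OF hF hF] that by simp
  have le1: "(x i - y i)\<^sup>2 \<le> 1" if "x \<in> unit_cube k" "y \<in> unit_cube k" for x y i k
  proof -
    have "\<bar>x i - y i\<bar> \<le> 1" using unit_cube_bounds[OF that(1), of i] unit_cube_bounds[OF that(2), of i] by linarith
    then show ?thesis by (simp add: abs_square_le_1)
  qed
  have Fu: "x \<in> unit_cube n" if "x \<in> F" for x using that F by simp
  \<comment> \<open>The opposite corner, the only point at maximal distance from a given
    corner.\<close>
  define anti where "anti x = (\<lambda>i. if i < m then 1 - x i else 0 :: real)" for x :: "nat \<Rightarrow> real"
  have anti: "anti x \<in> unit_cube m" "(\<Sum>i<m. (x i - anti x i)\<^sup>2) = real m" if x: "x \<in> cube_corners m" for x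
  proof -
    show "anti x \<in> unit_cube m" using x by (auto simp: anti_def unit_cube_def cube_corners_iff)
    have "(x i - anti x i)\<^sup>2 = 1" if "i < m" for i
      using cube_corners_value[OF x, of i] that by (auto simp: anti_def)
    then show "(\<Sum>i<m. (x i - anti x i)\<^sup>2) = real m" by simp
  qed
  \<comment> \<open>The squared diameters of the cube and of the face are their dimensions.\<close>
  have mJ: "m = card J"
  proof (rule antisym)
    have "real m = (\<Sum>j\<in>J. (h zero_corner j - h (anti zero_corner) j)\<^sup>2)"
      using distJ[of zero_corner "anti zero_corner"] anti[OF zero_corner_in] cube_corners_unit[OF zero_corner_in]
      by simp
    also have "\<dots> \<le> (\<Sum>j\<in>J. 1)"
      using le1[OF Fu[OF hF] Fu[OF hF]] anti[OF zero_corner_in] cube_corners_unit[OF zero_corner_in]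
      by (intro sum_mono) auto
    finally show "m \<le> card J" by simp
    define u v where "u j = (if j \<in> I then \<epsilon> j else 0)"
      and "v j = (if j \<in> I then \<epsilon> j else if j < n then 1 else 0)" for j
    have \<epsilon>: "\<epsilon> i = 0 \<or> \<epsilon> i = 1" "i < n" if "i \<in> I" for i using that F(2,3) by auto
    have "0 \<le> u i \<and> u i \<le> 1" "0 \<le> v i \<and> v i \<le> 1" "i \<ge> n \<Longrightarrow> u i = 0" "i \<ge> n \<Longrightarrow> v i = 0" for i
      using \<epsilon>[of i] by (auto simp: u_def v_def)
    then have "u \<in> unit_cube n" "v \<in> unit_cube n" by (simp_all add: unit_cube_def)
    then have "u \<in> F" "v \<in> F" by (auto simp: F u_def v_def)
    then obtain x y where xy: "x \<in> unit_cube m" "y \<in> unit_cube m" "h x = u" "h y = v"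
      using bij unfolding bij_betw_def by blast
    have "real (card J) = (\<Sum>j\<in>J. (h x j - h y j)\<^sup>2)"
      by (auto simp: xy u_def v_def J_def)
    also have "\<dots> = (\<Sum>i<m. (x i - y i)\<^sup>2)" by (rule distJ[OF xy(1,2)])
    also have "\<dots> \<le> (\<Sum>i<m. 1)" using le1[OF xy(1,2)] by (intro sum_mono)
    finally show "card J \<le> m" by simp
  qed
  have hI: "h x i = \<epsilon> i" if "x \<in> unit_cube m" "i \<in> I" for x i using hF[OF that(1)] that F by auto
  have corner: "h x \<in> cube_corners n" if x: "x \<in> cube_corners m" for x
  proof -
    have xu: "x \<in> unit_cube m" using x by (rule cube_corners_unit)
    have "(h x j - h (anti x) j)\<^sup>2 = 1" if "j \<in> J" for j
      using card_eq_sum_le_one[OF J(1), of "\<lambda>j. (h x j - h (anti x) j)\<^sup>2" j] le1[OF Fu[OF hF] Fu[OF hF]]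
        distJ[OF xu anti(1)[OF x]] anti[OF x] xu that mJ by simp
    then have "h x j - h (anti x) j = 1 \<or> h x j - h (anti x) j = - 1" if "j \<in> J" for j
      using that power2_eq_1_iff by blast
    then have "h x j = 0 \<or> h x j = 1" if "j \<in> J" for j
      using that unit_cube_bounds[OF Fu[OF hF[OF xu]], of j] unit_cube_bounds[OF Fu[OF hF[OF anti(1)[OF x]]], of j]
      by fastforce
    moreover have "h x j = 0 \<or> h x j = 1" if "j \<in> I" for j using hI[OF xu that] F(3) that by auto
    ultimately show ?thesis using Fu[OF hF[OF xu]] by (auto simp: cube_corners_def J_def)
  qed
  define b where "b = h zero_corner"
  have zu: "zero_corner \<in> unit_cube m" by (simp add: unit_cube_def)
  have b: "b \<in> cube_corners n" using corner[OF zero_corner_in] by (simp add: b_def)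
  define e :: "nat \<Rightarrow> nat \<Rightarrow> real" where "e i = flip zero_corner i" for i
  have e: "e i \<in> cube_corners m" "e i \<in> unit_cube m" if "i < m" for i
    using flip_in[OF zero_corner_in that] cube_corners_unit unfolding e_def by blast+
  have "\<exists>s\<in>J. h (e i) = flip b s" if i: "i < m" for i
  proof -
    have he: "h (e i) \<in> cube_corners n" using corner[OF e(1)[OF i]] .
    have "(\<Sum>j\<in>J. (h (e i) j - b j)\<^sup>2) = (\<Sum>l<m. (e i l - 0)\<^sup>2)"
      using distJ[OF e(2)[OF i] zu] by (simp add: b_def)
    also have "\<dots> = (\<Sum>l<m. if l = i then 1 else 0)" by (intro sum.cong) (auto simp: e_def)
    also have "\<dots> = 1" using i by simp
    finally have s1: "(\<Sum>j\<in>J. (h (e i) j - b j)\<^sup>2) = 1" .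
    have sq: "(h (e i) j - b j)\<^sup>2 = (if h (e i) j \<noteq> b j then 1 else 0)" for j
      using cube_corners_value[OF he, of j] cube_corners_value[OF b, of j] by auto
    \<comment> \<open>Between corners the squared distance counts the coordinates that differ; the
      images of 0 and of its neighbour differ in exactly one.\<close>
    have "real (card {j\<in>J. h (e i) j \<noteq> b j}) = 1"
      using s1 J(1) unfolding sq by (simp add: sum.If_cases Int_def)
    then have "card {j\<in>J. h (e i) j \<noteq> b j} = 1" by simp
    then obtain s where s: "{j\<in>J. h (e i) j \<noteq> b j} = {s}" by (rule card_1_singletonE)
    have "h (e i) j = flip b s j" for j
    proof (cases "j \<in> J")
      case True
      then show ?thesis using s cube_corners_value[OF he, of j] cube_corners_value[OF b, of j] by fastforce
    next
      case False
      then have "j \<noteq> s" using s by blast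
      moreover have "h (e i) j = b j"
      proof (cases "j \<in> I")
        case True
        then show ?thesis using hI[OF e(2)[OF i]] hI[OF zu] by (simp add: b_def)
      next
        case False
        then have "j \<ge> n" using \<open>j \<notin> J\<close> by (auto simp: J_def)
        then show ?thesis using he b by (simp add: cube_corners_iff)
      qed
      ultimately show ?thesis by simp
    qed
    then show ?thesis using s by (intro bexI[of _ s]) auto
  qed
  then obtain \<sigma> where \<sigma>: "\<And>i. i < m \<Longrightarrow> \<sigma> i \<in> J \<and> h (e i) = flip b (\<sigma> i)" by metis
  have coord: "h w (\<sigma> i) = \<bar>b (\<sigma> i) - w i\<bar>" if w: "w \<in> unit_cube m" and i: "i < m" for w i
  proof -
    have hw: "h w \<in> unit_cube n" using Fu[OF hF[OF w]] .
    \<comment> \<open>Polarisation: the difference of the squared distances to two neighbouring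
      corners is linear in the single coordinate in which they differ.\<close>
    have 1: "(\<Sum>j\<in>J. (h w j - flip b (\<sigma> i) j)\<^sup>2) - (\<Sum>j\<in>J. (h w j - b j)\<^sup>2)
        = (\<Sum>l<m. (w l - e i l)\<^sup>2) - (\<Sum>l<m. (w l)\<^sup>2)"
      using distJ[OF w e(2)[OF i]] distJ[OF w zu] \<sigma>[OF i] by (simp add: b_def)
    have "(\<Sum>l<m. (w l - e i l)\<^sup>2) - (\<Sum>l<m. (w l)\<^sup>2) = (\<Sum>l<m. if l = i then 1 - 2 * w i else 0)"
      unfolding sum_subtractf[symmetric] by (intro sum.cong) (auto simp: e_def power2_eq_square algebra_simps)
    also have "\<dots> = 1 - 2 * w i" using i by simp
    finally have 2: "(\<Sum>l<m. (w l - e i l)\<^sup>2) - (\<Sum>l<m. (w l)\<^sup>2) = 1 - 2 * w i" .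
    have "(\<Sum>j\<in>J. (h w j - flip b (\<sigma> i) j)\<^sup>2) - (\<Sum>j\<in>J. (h w j - b j)\<^sup>2)
        = (\<Sum>j\<in>J. if j = \<sigma> i then (h w j - (1 - b j))\<^sup>2 - (h w j - b j)\<^sup>2 else 0)"
      unfolding sum_subtractf[symmetric] by (intro sum.cong) auto
    also have "\<dots> = (h w (\<sigma> i) - (1 - b (\<sigma> i)))\<^sup>2 - (h w (\<sigma> i) - b (\<sigma> i))\<^sup>2"
      using J(1) \<sigma>[OF i] by simp
    finally have 3: "(h w (\<sigma> i) - (1 - b (\<sigma> i)))\<^sup>2 - (h w (\<sigma> i) - b (\<sigma> i))\<^sup>2 = 1 - 2 * w i"
      using 1 2 by simp
    show ?thesis using 3 cube_corners_value[OF b, of "\<sigma> i"] unit_cube_bounds[OF w, of i]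
      by (auto simp: power2_eq_square algebra_simps)
  qed
  have inj: "inj_on \<sigma> {..<m}"
  proof (rule inj_onI, rule ccontr)
    fix i l assume il: "i \<in> {..<m}" "l \<in> {..<m}" "\<sigma> i = \<sigma> l" "i \<noteq> l"
    then have "\<bar>b (\<sigma> i) - e i i\<bar> = \<bar>b (\<sigma> i) - e i l\<bar>" using coord[of "e i" i] coord[of "e i" l] e(2)[of i] by simp
    then show False using il(4) cube_corners_value[OF b, of "\<sigma> i"] by (auto simp: e_def)
  qed
  have "\<sigma> ` {..<m} \<subseteq> J" using \<sigma> by auto
  then have im: "\<sigma> ` {..<m} = J" using J(1) inj mJ by (intro card_subset_eq) (auto simp: card_image)
  have "face_map m n \<sigma> b h" unfolding face_map_def
  proof (intro conjI ballI allI impI inj b)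
    show "\<sigma> ` {..<m} \<subseteq> {..<n}" using im J by simp
    fix w assume w: "w \<in> unit_cube m"
    show "h w (\<sigma> i) = \<bar>b (\<sigma> i) - w i\<bar>" if "i < m" for i using coord w that .
    fix j assume j: "j \<notin> \<sigma> ` {..<m}"
    show "h w j = b j"
    proof (cases "j < n")
      case True
      then have "j \<in> I" using j im by (auto simp: J_def)
      then show ?thesis using hI[OF w] hI[OF zu] by (simp add: b_def)
    next
      case False
      then show ?thesis using unit_cube_out[OF Fu[OF hF[OF w]], of j] b by (simp add: cube_corners_iff)
    qed
  qed
  moreover have "b i = \<epsilon> i" if "i \<in> I" for i using hI[OF zu that] by (simp add: b_def)
  ultimately show ?thesis using that im by (simp add: J_def)
qed

section \<open>Open cells and evenly covered neighbourhoods\<close>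

locale cube_cx =
  fixes K :: "('a, 'c) cube_structure"
  assumes cube_complex: "cube_complex K"
begin

abbreviation "cdim \<equiv> cell_dim K"
abbreviation "chr \<equiv> char_map K"

lemma chr_points: "e \<in> cells K \<Longrightarrow> y \<in> unit_cube (cdim e) \<Longrightarrow> chr e y \<in> points K"
  using cube_complex unfolding cube_complex_def by blast

lemma chr_bij: "bij_betw (\<lambda>(e, y). chr e y) (SIGMA e:cells K. open_cube (cdim e)) (points K)"
  using cube_complex unfolding cube_complex_def by blast

lemma chr_open_inj:
  assumes "e \<in> cells K" "f \<in> cells K" "y \<in> open_cube (cdim e)" "z \<in> open_cube (cdim f)" "chr e y = chr f z"
  shows "e = f \<and> y = z"
proof -
  have "inj_on (\<lambda>(e, y). chr e y) (SIGMA e:cells K. open_cube (cdim e))"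
    using chr_bij by (simp add: bij_betw_def)
  from inj_onD[OF this, of "(e, y)" "(f, z)"] show ?thesis using assms by simp
qed

definition face :: "'c \<Rightarrow> 'c \<Rightarrow> ((nat \<Rightarrow> real) \<Rightarrow> nat \<Rightarrow> real) \<Rightarrow> bool" where
  "face g f h \<longleftrightarrow> g \<in> cells K \<and> f \<in> cells K \<and> (\<exists>\<sigma> b. face_map (cdim g) (cdim f) \<sigma> b h) \<and>
     (\<forall>y\<in>unit_cube (cdim g). chr f (h y) = chr g y)"

lemma faceD:
  assumes "face g f h"
  shows "g \<in> cells K" "f \<in> cells K" "y \<in> unit_cube (cdim g) \<Longrightarrow> chr f (h y) = chr g y"
  using assms unfolding face_def by auto

lemma faceE:
  assumes "face g f h"
  obtains \<sigma> b where "face_map (cdim g) (cdim f) \<sigma> b h"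
  using assms unfolding face_def by auto

lemma face_comp:
  assumes "face g f h" "face k g h'"
  shows "face k f (h \<circ> h')"
proof -
  obtain \<sigma> b where fm: "face_map (cdim g) (cdim f) \<sigma> b h" using assms(1) by (rule faceE)
  obtain \<tau> a where gm: "face_map (cdim k) (cdim g) \<tau> a h'" using assms(2) by (rule faceE)
  have "chr f ((h \<circ> h') y) = chr k y" if "y \<in> unit_cube (cdim k)" for y
    using faceD(3)[OF assms(2) that] faceD(3)[OF assms(1) face_map_unit[OF gm that]] by simp
  then show ?thesis unfolding face_def using face_map_comp[OF fm gm] faceD(1)[OF assms(2)] faceD(2)[OF assms(1)]
    by blast
qed

lemma face_id:
  assumes "f \<in> cells K"
  shows "face f f (\<lambda>y. y)"
proof -
  have "face_map (cdim f) (cdim f) (\<lambda>i. i) zero_corner (\<lambda>y. y)"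
    unfolding face_map_def by (auto simp: unit_cube_out zero_corner_in abs_of_nonneg unit_cube_bounds)
  then show ?thesis unfolding face_def using assms by blast
qed

lemma face_unit: "face g f h \<Longrightarrow> w \<in> unit_cube (cdim g) \<Longrightarrow> h w \<in> unit_cube (cdim f)"
  by (erule faceE) (rule face_map_unit)

lemma face_corner: "face g f h \<Longrightarrow> c \<in> cube_corners (cdim g) \<Longrightarrow> h c \<in> cube_corners (cdim f)"
  by (erule faceE) (rule face_map_corner)

lemma face_near: "face g f h \<Longrightarrow> w \<in> unit_cube (cdim g) \<Longrightarrow> w' \<in> unit_cube (cdim g) \<Longrightarrow> r > 0 \<Longrightarrow>
    near (cdim f) r (h w) (h w') \<longleftrightarrow> near (cdim g) r w w'"
  by (erule faceE) (rule face_map_near)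

lemma exists_face:
  assumes f: "f \<in> cells K" and I: "I \<subseteq> {..<cdim f}" and \<epsilon>: "\<epsilon> \<in> I \<rightarrow> {0, 1}"
  obtains g h \<sigma> b where "face g f h" "face_map (cdim g) (cdim f) \<sigma> b h" "\<sigma> ` {..<cdim g} = {..<cdim f} - I"
    "\<And>i. i \<in> I \<Longrightarrow> b i = \<epsilon> i"
proof -
  let ?F = "{x \<in> unit_cube (cdim f). \<forall>i\<in>I. x i = \<epsilon> i}"
  have "?F \<in> cube_faces (cdim f)" using I \<epsilon> unfolding cube_faces_def by blast
  then obtain g h where g: "g \<in> cells K" "cube_isometry (cdim g) (unit_cube (cdim g)) (cdim f) ?F h"
    "\<forall>y\<in>unit_cube (cdim g). chr f (h y) = chr g y"
    using cube_complex f unfolding cube_complex_def by blast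
  obtain \<sigma> b where "face_map (cdim g) (cdim f) \<sigma> b h" "\<sigma> ` {..<cdim g} = {..<cdim f} - I"
    "\<And>i. i \<in> I \<Longrightarrow> b i = \<epsilon> i"
    using cube_isometry_face_map[OF g(2) refl I \<epsilon>] by blast
  then show ?thesis using that g f unfolding face_def by blast
qed

text \<open>Freezing exactly the coordinates with value 0 or 1 leaves a face that contains the point
  in its interior.\<close>

lemma open_face:
  assumes f: "f \<in> cells K" and z: "z \<in> unit_cube (cdim f)"
  obtains g h w where "face g f h" "w \<in> open_cube (cdim g)" "h w = z"
proof -
  define I where "I = {i. i < cdim f \<and> (z i = 0 \<or> z i = 1)}"
  have I: "I \<subseteq> {..<cdim f}" "z \<in> I \<rightarrow> {0, 1}" by (auto simp: I_def)
  obtain g h \<sigma> b where g: "face g f h" "face_map (cdim g) (cdim f) \<sigma> b h" "\<sigma> ` {..<cdim g} = {..<cdim f} - I"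
    "\<And>i. i \<in> I \<Longrightarrow> b i = z i" using exists_face[OF f I] by blast
  have "z j = b j" if "j < cdim f" "j \<notin> \<sigma> ` {..<cdim g}" for j using that g by auto
  then obtain w where w: "w \<in> unit_cube (cdim g)" "h w = z" "\<And>i. i < cdim g \<Longrightarrow> w i = \<bar>b (\<sigma> i) - z (\<sigma> i)\<bar>"
    using face_map_surj[OF g(2) z] by blast
  have "0 < w i \<and> w i < 1" if i: "i < cdim g" for i
  proof -
    have "\<sigma> i \<in> {..<cdim f} - I" using g(3) i by blast
    then have "z (\<sigma> i) \<noteq> 0" "z (\<sigma> i) \<noteq> 1" by (auto simp: I_def)
    then show ?thesis using w(3)[OF i] unit_cube_bounds[OF z, of "\<sigma> i"]
        cube_corners_value[OF face_mapD(3)[OF g(2)], of "\<sigma> i"] by auto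
  qed
  then have "w \<in> open_cube (cdim g)" using unit_cube_out[OF w(1)] by (simp add: open_cube_def)
  then show ?thesis using that g w by blast
qed

definition pcell :: "'a \<Rightarrow> 'c" where
  "pcell k = (SOME e. e \<in> cells K \<and> (\<exists>y\<in>open_cube (cdim e). chr e y = k))"

definition pcoord :: "'a \<Rightarrow> nat \<Rightarrow> real" where
  "pcoord k = (SOME y. y \<in> open_cube (cdim (pcell k)) \<and> chr (pcell k) y = k)"

lemma pcell:
  assumes "k \<in> points K"
  shows "pcell k \<in> cells K" "pcoord k \<in> open_cube (cdim (pcell k))" "chr (pcell k) (pcoord k) = k"
proof -
  have "k \<in> (\<lambda>(e, y). chr e y) ` (SIGMA e:cells K. open_cube (cdim e))"
    using chr_bij assms by (simp add: bij_betw_def)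
  then have "\<exists>e. e \<in> cells K \<and> (\<exists>y\<in>open_cube (cdim e). chr e y = k)" by auto
  then have 1: "pcell k \<in> cells K \<and> (\<exists>y\<in>open_cube (cdim (pcell k)). chr (pcell k) y = k)"
    unfolding pcell_def by (rule someI_ex)
  then have "\<exists>y. y \<in> open_cube (cdim (pcell k)) \<and> chr (pcell k) y = k" by blast
  then have "pcoord k \<in> open_cube (cdim (pcell k)) \<and> chr (pcell k) (pcoord k) = k"
    unfolding pcoord_def by (rule someI_ex)
  then show "pcell k \<in> cells K" "pcoord k \<in> open_cube (cdim (pcell k))" "chr (pcell k) (pcoord k) = k"
    using 1 by auto
qed

lemma pcell_eq:
  assumes "e \<in> cells K" "y \<in> open_cube (cdim e)" "chr e y = k"
  shows "pcell k = e" "pcoord k = y"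
proof -
  have "k \<in> points K" using chr_points[OF assms(1) open_cube_unit[OF assms(2)]] assms(3) by simp
  then show "pcell k = e" "pcoord k = y"
    using chr_open_inj[OF assms(1) pcell(1) assms(2) pcell(2)] pcell(3) assms(3) by auto
qed

lemma pcoord_unit: "k \<in> points K \<Longrightarrow> pcoord k \<in> unit_cube (cdim (pcell k))"
  using pcell(2) open_cube_unit by blast

lemma pcell_face:
  assumes "f \<in> cells K" "z \<in> unit_cube (cdim f)" "chr f z = k"
  obtains h where "face (pcell k) f h" "h (pcoord k) = z"
proof -
  obtain g h w where g: "face g f h" "w \<in> open_cube (cdim g)" "h w = z" using open_face[OF assms(1,2)] .
  have "chr g w = k" using faceD(3)[OF g(1) open_cube_unit[OF g(2)]] g(3) assms(3) by simp
  then have "pcell k = g" "pcoord k = w" using pcell_eq faceD(1)[OF g(1)] g(2) by blast+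
  then show ?thesis using that g by blast
qed

text \<open>The distance of a point from the boundary of its open cell, cut off at 1/2. Different
  preimages of the point in a closed cube are at least this far apart, whence the neighbourhoods
  below are evenly covered by every closed cube.\<close>

definition depth :: "'a \<Rightarrow> real" where
  "depth k = Min (insert (1/2) ((\<lambda>i. min (pcoord k i) (1 - pcoord k i)) ` {..<cdim (pcell k)}))"

lemma depth_le: "depth k \<le> 1/2" "i < cdim (pcell k) \<Longrightarrow> depth k \<le> pcoord k i"
    "i < cdim (pcell k) \<Longrightarrow> depth k \<le> 1 - pcoord k i"
proof -
  let ?S = "insert (1/2) ((\<lambda>i. min (pcoord k i) (1 - pcoord k i)) ` {..<cdim (pcell k)})"
  have le: "depth k \<le> x" if "x \<in> ?S" for x unfolding depth_def using that by (intro Min_le) auto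
  show "depth k \<le> 1/2" by (rule le) simp
  assume "i < cdim (pcell k)"
  then have "depth k \<le> min (pcoord k i) (1 - pcoord k i)" by (intro le) auto
  then show "depth k \<le> pcoord k i" "depth k \<le> 1 - pcoord k i" by auto
qed

lemma depth_cases:
  obtains "depth k = 1/2"
  | i where "i < cdim (pcell k)" "depth k = min (pcoord k i) (1 - pcoord k i)"
proof -
  have "depth k \<in> insert (1/2) ((\<lambda>i. min (pcoord k i) (1 - pcoord k i)) ` {..<cdim (pcell k)})"
    unfolding depth_def by (intro Min_in) auto
  then show ?thesis using that by auto
qed

lemma depth_pos:
  assumes "k \<in> points K"
  shows "depth k > 0"
proof (cases rule: depth_cases[of k])
  case (2 i)
  then show ?thesis using pcell(2)[OF assms] by (simp add: open_cube_def)
qed simp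

lemma face_coord:
  assumes k: "k \<in> points K" and fm: "face_map (cdim (pcell k)) n \<sigma> b h"
    and j: "j \<in> \<sigma> ` {..<cdim (pcell k)}"
  shows "depth k \<le> h (pcoord k) j" "h (pcoord k) j \<le> 1 - depth k"
proof -
  obtain i where i: "j = \<sigma> i" "i < cdim (pcell k)" using j by auto
  have "h (pcoord k) j = \<bar>b j - pcoord k i\<bar>" using face_mapD(4)[OF fm pcoord_unit[OF k] i(2)] i by simp
  then show "depth k \<le> h (pcoord k) j" "h (pcoord k) j \<le> 1 - depth k"
    using depth_le(2)[OF i(2)] depth_le(3)[OF i(2)] cube_corners_value[OF face_mapD(3)[OF fm], of j]
      unit_cube_bounds[OF pcoord_unit[OF k], of i] by auto
qed

text \<open>Both preimages are images of the interior point \<open>pcoord k\<close> under face maps.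
  In a direction along its face, a preimage keeps distance at least \<open>depth k\<close> from 0
  and 1, so the two faces have the same directions; their frozen bits agree since they differ by
  less than 1/2. Injectivity on the open cell then identifies the points.\<close>

lemma preimage_unique:
  assumes f: "f \<in> cells K" and z: "z \<in> unit_cube (cdim f)" "z' \<in> unit_cube (cdim f)"
    and k: "chr f z = k" "chr f z' = k" and nr: "near (cdim f) (depth k) z z'"
  shows "z = z'"
proof -
  have kp: "k \<in> points K" using chr_points f z k by blast
  let ?g = "pcell k" and ?w = "pcoord k"
  have w: "?w \<in> unit_cube (cdim ?g)" using pcoord_unit[OF kp] .
  obtain h where h: "face ?g f h" "h ?w = z" using pcell_face[OF f z(1) k(1)] .
  obtain h' where h': "face ?g f h'" "h' ?w = z'" using pcell_face[OF f z(2) k(2)] .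
  obtain \<sigma> b where fm: "face_map (cdim ?g) (cdim f) \<sigma> b h" using h(1) by (rule faceE)
  obtain \<sigma>' b' where fm': "face_map (cdim ?g) (cdim f) \<sigma>' b' h'" using h'(1) by (rule faceE)
  note D = face_mapD[OF fm] and D' = face_mapD[OF fm']
  have d: "depth k > 0" "depth k \<le> 1/2" using depth_pos[OF kp] depth_le by auto
  have nearj: "\<bar>z j - z' j\<bar> < depth k" if "j < cdim f" for j using nr that by (simp add: near_def)
  have sub: "\<sigma> ` {..<cdim ?g} \<subseteq> \<sigma>' ` {..<cdim ?g}"
  proof
    fix j assume j: "j \<in> \<sigma> ` {..<cdim ?g}"
    show "j \<in> \<sigma>' ` {..<cdim ?g}"
    proof (rule ccontr)
      assume "j \<notin> \<sigma>' ` {..<cdim ?g}"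
      then have "z' j = b' j" using D'(5)[OF w] h'(2) by simp
      then have "z' j = 0 \<or> z' j = 1" using cube_corners_value[OF D'(3), of j] by simp
      moreover have "j < cdim f" using j D(2) by auto
      ultimately show False using nearj[of j] face_coord[OF kp fm j] h(2) by auto
    qed
  qed
  have im: "\<sigma> ` {..<cdim ?g} = \<sigma>' ` {..<cdim ?g}"
    using sub by (intro card_subset_eq) (simp_all add: card_image D(1) D'(1))
  have out: "z' j = b j" if "j < cdim f" "j \<notin> \<sigma> ` {..<cdim ?g}" for j
  proof -
    have "z j = b j" "z' j = b' j" using D(5)[OF w] D'(5)[OF w] h(2) h'(2) that im by auto
    then show ?thesis using nearj[OF that(1)] cube_corners_value[OF D(3), of j]
        cube_corners_value[OF D'(3), of j] d by auto
  qed
  obtain v where v: "v \<in> unit_cube (cdim ?g)" "h v = z'" "\<And>i. i < cdim ?g \<Longrightarrow> v i = \<bar>b (\<sigma> i) - z' (\<sigma> i)\<bar>"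
    using face_map_surj[OF fm z(2) out] by blast
  have "0 < v i \<and> v i < 1" if i: "i < cdim ?g" for i
  proof -
    have "\<sigma> i \<in> \<sigma>' ` {..<cdim ?g}" using i im by blast
    from face_coord[OF kp fm' this] have "0 < z' (\<sigma> i)" "z' (\<sigma> i) < 1" using d h'(2) by auto
    then show ?thesis using v(3)[OF i] cube_corners_value[OF D(3), of "\<sigma> i"] by auto
  qed
  then have "v \<in> open_cube (cdim ?g)" using unit_cube_out[OF v(1)] by (simp add: open_cube_def)
  moreover have "chr ?g v = k" using faceD(3)[OF h(1) v(1)] v(2) k(2) by simp
  ultimately have "v = ?w" using chr_open_inj[OF pcell(1)[OF kp] pcell(1)[OF kp] _ pcell(2)[OF kp], of v]
      pcell(3)[OF kp] by simp
  then show ?thesis using v(2) h(2) by simp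
qed

text \<open>The point \<open>w\<close> may be fixed by a symmetry of the cube, for instance as its
  centre, so agreement at \<open>w\<close> does not determine the face map formally. Such a symmetry
  is excluded by the injectivity of the characteristic map on the open cube.\<close>

lemma face_zero_unique:
  assumes h: "face g f h" "face g f h'" and w: "w \<in> open_cube (cdim g)" "h w = h' w"
  shows "h zero_corner = h' zero_corner"
proof -
  obtain \<sigma> b where fm: "face_map (cdim g) (cdim f) \<sigma> b h" using h(1) by (rule faceE)
  obtain \<sigma>' b' where fm': "face_map (cdim g) (cdim f) \<sigma>' b' h'" using h(2) by (rule faceE)
  note D = face_mapD[OF fm] and D' = face_mapD[OF fm']
  have wu: "w \<in> unit_cube (cdim g)" using w(1) by (rule open_cube_unit)
  have inner: "j \<in> \<tau> ` {..<cdim g} \<longleftrightarrow> h'' w j \<noteq> 0 \<and> h'' w j \<noteq> 1"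
    if gm: "face_map (cdim g) (cdim f) \<tau> a h''" for \<tau> a h'' j
  proof (cases "j \<in> \<tau> ` {..<cdim g}")
    case True
    then obtain i where i: "j = \<tau> i" "i < cdim g" by auto
    have "0 < w i" "w i < 1" using w(1) i(2) by (auto simp: open_cube_def)
    then show ?thesis using face_mapD(4)[OF gm wu i(2)] i True
        cube_corners_value[OF face_mapD(3)[OF gm], of j] by auto
  next
    case False
    then show ?thesis using face_mapD(5)[OF gm wu False]
        cube_corners_value[OF face_mapD(3)[OF gm], of j] by auto
  qed
  have im: "j \<in> \<sigma> ` {..<cdim g} \<longleftrightarrow> j \<in> \<sigma>' ` {..<cdim g}" for j
    using inner[OF fm] inner[OF fm'] w(2) by simp
  \<comment> \<open>A test point whose coordinates avoid 1/2, so that its image shows which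
    directions are reflected.\<close>
  define q :: "nat \<Rightarrow> real" where "q i = (if i < cdim g then 1/4 else 0)" for i
  have q: "q \<in> open_cube (cdim g)" "q \<in> unit_cube (cdim g)" by (auto simp: q_def open_cube_def unit_cube_def)
  \<comment> \<open>Both face maps parametrise the face spanned by the point, so they agree on its interior.\<close>
  have hq: "h q = h' q"
  proof -
    have out: "h q j = b' j" if "j < cdim f" "j \<notin> \<sigma>' ` {..<cdim g}" for j
      using D(5)[OF q(2)] D(5)[OF wu] D'(5)[OF wu] im w(2) that by metis
    obtain v where v: "v \<in> unit_cube (cdim g)" "h' v = h q" "\<And>i. i < cdim g \<Longrightarrow> v i = \<bar>b' (\<sigma>' i) - h q (\<sigma>' i)\<bar>"
      using face_map_surj[OF fm' face_map_unit[OF fm q(2)] out] by blast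
    have "0 < v i \<and> v i < 1" if i: "i < cdim g" for i
    proof -
      have "\<sigma>' i \<in> \<sigma> ` {..<cdim g}" using i im by blast
      then obtain l where l: "\<sigma>' i = \<sigma> l" "l < cdim g" by auto
      have "h q (\<sigma>' i) = \<bar>b (\<sigma>' i) - 1/4\<bar>" using D(4)[OF q(2) l(2)] l by (simp add: q_def)
      then show ?thesis using v(3)[OF i] cube_corners_value[OF D(3), of "\<sigma>' i"]
          cube_corners_value[OF D'(3), of "\<sigma>' i"] by auto
    qed
    then have "v \<in> open_cube (cdim g)" using unit_cube_out[OF v(1)] by (simp add: open_cube_def)
    moreover have "chr g v = chr g q"
      using faceD(3)[OF h(2) v(1)] faceD(3)[OF h(1) q(2)] v(2) by simp
    ultimately have "v = q" using chr_open_inj[of g g v q] faceD(1)[OF h(1)] q(1) by simp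
    then show ?thesis using v(2) by simp
  qed
  have "b j = b' j" for j
  proof (cases "j \<in> \<sigma> ` {..<cdim g}")
    case True
    then obtain i l where i: "j = \<sigma> i" "i < cdim g" "j = \<sigma>' l" "l < cdim g" using im by blast
    then have "\<bar>b j - 1/4\<bar> = \<bar>b' j - 1/4\<bar>"
      using D(4)[OF q(2) i(2)] D'(4)[OF q(2) i(4)] hq by (simp add: q_def)
    then show ?thesis using cube_corners_value[OF D(3), of j] cube_corners_value[OF D'(3), of j] by auto
  next
    case False
    then show ?thesis using D(5)[OF q(2)] D'(5)[OF q(2)] im hq by metis
  qed
  then show ?thesis using face_map_zero[OF fm] face_map_zero[OF fm'] by auto
qed

text \<open>A frozen coordinate of the face has value 0 or 1. A preimage of \<open>k\<close> closer
  than \<open>depth k\<close> cannot have an interior value there, and being within 1/2 it has the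
  same bit.\<close>

lemma near_preimage_in_face:
  assumes h: "face g f h" and w: "w \<in> unit_cube (cdim g)" and z': "z' \<in> unit_cube (cdim f)" "chr f z' = k"
    and nr: "near (cdim f) (depth k) (h w) z'"
  obtains w' where "w' \<in> unit_cube (cdim g)" "h w' = z'" "chr g w' = k"
proof -
  have f: "f \<in> cells K" using faceD[OF h] by blast
  have kp: "k \<in> points K" using chr_points f z' by blast
  obtain \<sigma> b where fm: "face_map (cdim g) (cdim f) \<sigma> b h" using h by (rule faceE)
  obtain h0 where h0: "face (pcell k) f h0" "h0 (pcoord k) = z'" using pcell_face[OF f z'] .
  obtain \<tau> a where gm: "face_map (cdim (pcell k)) (cdim f) \<tau> a h0" using h0(1) by (rule faceE)
  note D = face_mapD[OF fm]
  have d: "depth k > 0" "depth k \<le> 1/2" using depth_pos[OF kp] depth_le by auto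
  have out: "z' j = b j" if j: "j < cdim f" "j \<notin> \<sigma> ` {..<cdim g}" for j
  proof -
    have hj: "h w j = b j" using D(5)[OF w j(2)] .
    have nj: "\<bar>h w j - z' j\<bar> < depth k" using nr j by (simp add: near_def)
    have bj: "b j = 0 \<or> b j = 1" using cube_corners_value[OF D(3)] .
    have "j \<notin> \<tau> ` {..<cdim (pcell k)}"
    proof
      assume "j \<in> \<tau> ` {..<cdim (pcell k)}"
      from face_coord[OF kp gm this] show False using nj hj bj h0(2) by auto
    qed
    then have "z' j = a j" using face_mapD(5)[OF gm pcoord_unit[OF kp]] h0(2) by auto
    then show ?thesis using cube_corners_value[OF face_mapD(3)[OF gm], of j] nj hj bj d by auto
  qed
  obtain w' where w': "w' \<in> unit_cube (cdim g)" "h w' = z'"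
    using face_map_surj[OF fm z'(1) out] by blast
  then show ?thesis using that faceD(3)[OF h w'(1)] z'(2) by simp
qed

text \<open>The factor 1/4 is for \<open>transport_cocycle\<close>: for \<open>k1\<close> in the
  neighbourhood of \<open>k0\<close> the radius of \<open>k1\<close> is at most 5/16 of the depth of
  \<open>k0\<close>, so two radii of \<open>k0\<close> and one of \<open>k1\<close> together stay
  below that depth.\<close>

definition radius :: "'a \<Rightarrow> real" where "radius k = depth k / 4"

lemma radius: "k \<in> points K \<Longrightarrow> 0 < radius k" "k \<in> points K \<Longrightarrow> radius k < depth k"
    "k \<in> points K \<Longrightarrow> radius k + radius k \<le> depth k"
  using depth_pos[of k] by (auto simp: radius_def)

definition nbhd :: "'a \<Rightarrow> 'a set" where
  "nbhd k = {chr f z | f z z'. f \<in> cells K \<and> z \<in> unit_cube (cdim f) \<and> z' \<in> unit_cube (cdim f) \<and>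
     chr f z' = k \<and> near (cdim f) (radius k) z z'}"

text \<open>A witness in an arbitrary closed cube is moved to the cell whose interior contains the
  point, which makes it independent of the cube.\<close>

lemma near_pcell:
  assumes f: "f \<in> cells K" and z: "z \<in> unit_cube (cdim f)" "z' \<in> unit_cube (cdim f)"
    and k: "chr f z' = k" and nr: "near (cdim f) (radius k) z z'"
  obtains h w' where "face (pcell (chr f z)) f h" "h (pcoord (chr f z)) = z" "h w' = z'"
    "w' \<in> unit_cube (cdim (pcell (chr f z)))" "chr (pcell (chr f z)) w' = k"
    "near (cdim (pcell (chr f z))) (radius k) (pcoord (chr f z)) w'"
proof -
  have kp: "k \<in> points K" using chr_points f z(2) k by blast
  let ?g = "pcell (chr f z)" and ?w = "pcoord (chr f z)"
  have zp: "chr f z \<in> points K" using chr_points f z by blast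
  obtain h where h: "face ?g f h" "h ?w = z" using pcell_face[OF f z(1) refl] .
  have wu: "?w \<in> unit_cube (cdim ?g)" using pcoord_unit[OF zp] .
  have "near (cdim f) (depth k) (h ?w) z'" using near_mono[OF nr] radius(2)[OF kp] h(2) by simp
  then obtain w' where w': "w' \<in> unit_cube (cdim ?g)" "h w' = z'" "chr ?g w' = k"
    using near_preimage_in_face[OF h(1) wu z(2) k] by blast
  have "near (cdim ?g) (radius k) ?w w'"
    using face_near[OF h(1) wu w'(1) radius(1)[OF kp]] nr h(2) w'(2) by simp
  then show ?thesis using that h w' by blast
qed

lemma nbhdE:
  assumes "x \<in> nbhd k"
  obtains w' where "x \<in> points K" "w' \<in> unit_cube (cdim (pcell x))" "chr (pcell x) w' = k"
    "near (cdim (pcell x)) (radius k) (pcoord x) w'"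
proof -
  obtain f z z' where *: "x = chr f z" "f \<in> cells K" "z \<in> unit_cube (cdim f)" "z' \<in> unit_cube (cdim f)"
    "chr f z' = k" "near (cdim f) (radius k) z z'" using assms unfolding nbhd_def by blast
  then show ?thesis using near_pcell[OF *(2-6)] that chr_points by metis
qed

lemma nbhd_self: "k \<in> points K \<Longrightarrow> k \<in> nbhd k"
  unfolding nbhd_def
  by (rule CollectI, rule exI[of _ "pcell k"], rule exI[of _ "pcoord k"], rule exI[of _ "pcoord k"])
    (use pcell pcoord_unit radius(1) in \<open>auto simp: near_def\<close>)

text \<open>In every closed cube the preimage is a union of sup-norm balls around the preimages of
  \<open>k\<close>, hence open for the weak topology.\<close>

lemma nbhd_preimage:
  assumes e: "e \<in> cells K" and k: "k \<in> points K"
  shows "{y \<in> unit_cube (cdim e). chr e y \<in> nbhd k} =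
    (\<Union>y'\<in>{y' \<in> unit_cube (cdim e). chr e y' = k}. {y \<in> unit_cube (cdim e). near (cdim e) (radius k) y y'})"
    (is "?L = ?R")
proof
  show "?R \<subseteq> ?L" using e unfolding nbhd_def by blast
  show "?L \<subseteq> ?R"
  proof
    fix y assume "y \<in> ?L"
    then have y: "y \<in> unit_cube (cdim e)" "chr e y \<in> nbhd k" by auto
    obtain w' where w': "chr e y \<in> points K" "w' \<in> unit_cube (cdim (pcell (chr e y)))"
      "chr (pcell (chr e y)) w' = k" "near (cdim (pcell (chr e y))) (radius k) (pcoord (chr e y)) w'"
      using nbhdE[OF y(2)] .
    obtain h where h: "face (pcell (chr e y)) e h" "h (pcoord (chr e y)) = y"
      using pcell_face[OF e y(1) refl] .
    have "near (cdim e) (radius k) y (h w')"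
      using face_near[OF h(1) pcoord_unit[OF w'(1)] w'(2) radius(1)[OF k]] w'(4) h(2) by simp
    moreover have "h w' \<in> unit_cube (cdim e)" using face_unit[OF h(1) w'(2)] .
    moreover have "chr e (h w') = k" using faceD(3)[OF h(1) w'(2)] w'(3) by simp
    ultimately show "y \<in> ?R" using y by blast
  qed
qed

end

lemma openin_near: "openin (cube_topology n) {y \<in> unit_cube n. near n r y y'}"
proof -
  have "open {y :: nat \<Rightarrow> real. \<bar>y i - y' i\<bar> < r}" for i
    by (intro open_Collect_less continuous_intros continuous_on_product_coordinates)
  then have "open (\<Inter>i\<in>{..<n}. {y :: nat \<Rightarrow> real. \<bar>y i - y' i\<bar> < r})" by (intro open_INT) auto
  moreover have "{y. near n r y y'} = (\<Inter>i\<in>{..<n}. {y. \<bar>y i - y' i\<bar> < r})" by (auto simp: near_def)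
  ultimately have "openin (powertop_real UNIV) {y. near n r y y'}"
    by (simp add: euclidean_product_topology)
  moreover have "cube_topology n = subtopology (powertop_real UNIV) (unit_cube n)"
    unfolding cube_topology_def Euclidean_space_def subtopology_subtopology
    by (rule arg_cong[of _ _ "subtopology _"]) (auto simp: unit_cube_def)
  moreover have "{y \<in> unit_cube n. near n r y y'} = unit_cube n \<inter> {y. near n r y y'}" by auto
  ultimately show ?thesis using openin_subtopology_Int2 by metis
qed

context cube_cx
begin

lemma openin_nbhd: "k \<in> points K \<Longrightarrow> openin (complex_topology K) (nbhd k)"
  unfolding openin_complex_topology
proof (intro conjI ballI)
  assume k: "k \<in> points K"
  show "nbhd k \<subseteq> points K" using chr_points unfolding nbhd_def by blast
  fix e assume e: "e \<in> cells K"
  show "openin (cube_topology (cdim e)) {y \<in> unit_cube (cdim e). chr e y \<in> nbhd k}"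
    unfolding nbhd_preimage[OF e k] by (intro openin_Union) (auto intro: openin_near)
qed

text \<open>The cell of \<open>k\<close> is a face of the cell of \<open>x\<close>. The coordinate
  that realises \<open>depth k\<close> survives in the larger cell and moves by less than
  \<open>radius k\<close>.\<close>

lemma depth_near:
  assumes k: "k \<in> points K" and x: "x \<in> nbhd k"
  shows "depth x \<le> depth k + radius k"
proof -
  obtain w' where w': "x \<in> points K" "w' \<in> unit_cube (cdim (pcell x))" "chr (pcell x) w' = k"
    "near (cdim (pcell x)) (radius k) (pcoord x) w'" using nbhdE[OF x] .
  show ?thesis
  proof (cases rule: depth_cases[of k])
    case 1
    then show ?thesis using depth_le(1)[of x] radius(1)[OF k] by simp
  next
    case (2 i)
    obtain h where h: "face (pcell k) (pcell x) h" "h (pcoord k) = w'"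
      using pcell_face[OF pcell(1)[OF w'(1)] w'(2,3)] .
    obtain \<sigma> b where fm: "face_map (cdim (pcell k)) (cdim (pcell x)) \<sigma> b h" using h(1) by (rule faceE)
    have j: "\<sigma> i < cdim (pcell x)" using face_mapD(2)[OF fm] 2 by blast
    have "w' (\<sigma> i) = \<bar>b (\<sigma> i) - pcoord k i\<bar>" using face_mapD(4)[OF fm pcoord_unit[OF k] 2(1)] h(2) by simp
    then have "depth k = min (w' (\<sigma> i)) (1 - w' (\<sigma> i))"
      using 2(2) cube_corners_value[OF face_mapD(3)[OF fm], of "\<sigma> i"] unit_cube_bounds[OF pcoord_unit[OF k], of i]
      by auto
    moreover have "\<bar>pcoord x (\<sigma> i) - w' (\<sigma> i)\<bar> < radius k" using w'(4) j by (simp add: near_def)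
    ultimately show ?thesis using depth_le(2)[OF j] depth_le(3)[OF j] by (auto simp: min_def split: if_splits)
  qed
qed

end

section \<open>Edges, squares and local systems on vertices\<close>

lemma corner_edge_apply:
  "t \<in> {0..1} \<Longrightarrow> corner_edge K (e, c) i t = char_map K e (c(i := \<bar>c i - t\<bar>))"
  by (simp add: corner_edge_def)

context cube_cx
begin

definition edges :: "(real \<Rightarrow> 'a) set" where
  "edges = {corner_edge K (e, c) i | e c i. e \<in> cells K \<and> c \<in> cube_corners (cdim e) \<and> i < cdim e}"

text \<open>The identity outside \<open>edges\<close>, so that it is an involution on all functions,
  as \<open>square_complex\<close> demands.\<close>

definition erev :: "(real \<Rightarrow> 'a) \<Rightarrow> real \<Rightarrow> 'a" where
  "erev a = (if a \<in> edges then (\<lambda>t\<in>{0..1}. a (1 - t)) else a)"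

text \<open>Squares are read off at corners of cubes of any dimension, so those inside a larger cube
  are available directly; \<open>esq_square\<close> returns to two-dimensional cells.\<close>

definition esq :: "(real \<Rightarrow> 'a) \<Rightarrow> (real \<Rightarrow> 'a) \<Rightarrow> (real \<Rightarrow> 'a) \<Rightarrow> (real \<Rightarrow> 'a) \<Rightarrow> bool" where
  "esq x a y b \<longleftrightarrow> (\<exists>e c i j. e \<in> cells K \<and> c \<in> cube_corners (cdim e) \<and> i < cdim e \<and> j < cdim e \<and> i \<noteq> j \<and>
     x = corner_edge K (e, c) i \<and> a = corner_edge K (e, flip c i) j \<and>
     y = corner_edge K (e, c) j \<and> b = corner_edge K (e, flip c j) i)"

lemma edgesI: "e \<in> cells K \<Longrightarrow> c \<in> cube_corners (cdim e) \<Longrightarrow> i < cdim e \<Longrightarrow> corner_edge K (e, c) i \<in> edges"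
  unfolding edges_def by blast

lemma edgesE:
  assumes "a \<in> edges"
  obtains e c i where "e \<in> cells K" "c \<in> cube_corners (cdim e)" "i < cdim e" "a = corner_edge K (e, c) i"
  using assms unfolding edges_def by blast

lemma corner_edge_0: "c \<in> cube_corners n \<Longrightarrow> corner_edge K (e, c) i 0 = chr e c"
proof -
  assume "c \<in> cube_corners n"
  then have "c(i := \<bar>c i - 0\<bar>) = c" using cube_corners_value[of c n i] by auto
  then show ?thesis by (simp add: corner_edge_apply)
qed

lemma corner_edge_1: "c \<in> cube_corners n \<Longrightarrow> corner_edge K (e, c) i 1 = chr e (flip c i)"
proof -
  assume "c \<in> cube_corners n"
  then have "c(i := \<bar>c i - 1\<bar>) = flip c i" using cube_corners_value[of c n i] by auto
  then show ?thesis by (simp add: corner_edge_apply)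
qed

lemma erev_corner_edge:
  assumes "e \<in> cells K" "c \<in> cube_corners (cdim e)" "i < cdim e"
  shows "erev (corner_edge K (e, c) i) = corner_edge K (e, flip c i) i"
proof -
  have "corner_edge K (e, c) i (1 - t) = chr e ((flip c i)(i := \<bar>flip c i i - t\<bar>))" if "t \<in> {0..1}" for t
  proof -
    have "c(i := \<bar>c i - (1 - t)\<bar>) = (flip c i)(i := \<bar>flip c i i - t\<bar>)"
      using cube_corners_value[OF assms(2), of i] that by auto
    then show ?thesis using that by (simp add: corner_edge_apply)
  qed
  then show ?thesis unfolding erev_def using edgesI[OF assms]
    by (auto simp: corner_edge_def restrict_def)
qed

lemma face_corner_edge:
  assumes "face g f h" "face_map (cdim g) (cdim f) \<sigma> b h" "c \<in> cube_corners (cdim g)" "i < cdim g"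
  shows "corner_edge K (f, h c) (\<sigma> i) = corner_edge K (g, c) i"
proof -
  have "chr f ((h c)(\<sigma> i := \<bar>h c (\<sigma> i) - t\<bar>)) = chr g (c(i := \<bar>c i - t\<bar>))" if "t \<in> {0..1}" for t
    using face_map_move[OF assms(2,3,4), of t] faceD(3)[OF assms(1)] corner_move_unit[OF assms(3,4), of t] that
    by (metis atLeastAtMost_iff)
  then show ?thesis by (auto simp: corner_edge_def restrict_def)
qed

text \<open>Every open cell has its zero corner as base vertex. A closed cube may contain the same
  open cell several times; this is the base corner of the copy through \<open>z\<close>, well
  defined by \<open>face_zero_unique\<close>.\<close>

definition zero_vertex :: "'c \<Rightarrow> (nat \<Rightarrow> real) \<Rightarrow> nat \<Rightarrow> real" where
  "zero_vertex f z = (SOME b. \<exists>h. face (pcell (chr f z)) f h \<and> h (pcoord (chr f z)) = z \<and> b = h zero_corner)"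

lemma zero_vertex_eq:
  assumes "face g f h" "w \<in> open_cube (cdim g)"
  shows "zero_vertex f (h w) = h zero_corner"
proof -
  have eq: "chr f (h w) = chr g w" using faceD(3)[OF assms(1) open_cube_unit[OF assms(2)]] .
  have pc: "pcell (chr f (h w)) = g" "pcoord (chr f (h w)) = w"
    using pcell_eq[OF faceD(1)[OF assms(1)] assms(2) refl] by (simp_all add: eq)
  define Q where "Q b \<longleftrightarrow> (\<exists>h'. face g f h' \<and> h' w = h w \<and> b = h' zero_corner)" for b
  have "Q (h zero_corner)" unfolding Q_def using assms(1) by (intro exI[of _ h]) simp
  then have "Q (SOME b. Q b)" using someI[of Q "h zero_corner"] by blast
  moreover have "zero_vertex f (h w) = (SOME b. Q b)" unfolding zero_vertex_def pc Q_def ..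
  ultimately have "Q (zero_vertex f (h w))" by simp
  then obtain h' where h': "face g f h'" "h' w = h w" "zero_vertex f (h w) = h' zero_corner"
    unfolding Q_def by (elim exE conjE)
  then show ?thesis using face_zero_unique[OF h'(1) assms(1) assms(2) h'(2)] by simp
qed

lemma zero_vertex_corner: "f \<in> cells K \<Longrightarrow> z \<in> unit_cube (cdim f) \<Longrightarrow> zero_vertex f z \<in> cube_corners (cdim f)"
  by (metis open_face zero_vertex_eq face_corner zero_corner_in)

lemma chr_zero_vertex:
  assumes "f \<in> cells K" "z \<in> unit_cube (cdim f)"
  shows "chr f (zero_vertex f z) = chr (pcell (chr f z)) zero_corner"
proof -
  obtain g h w where g: "face g f h" "w \<in> open_cube (cdim g)" "h w = z" using open_face[OF assms] .
  have "chr f z = chr g w" using faceD(3)[OF g(1) open_cube_unit[OF g(2)]] g(3) by simp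
  then have "pcell (chr f z) = g" using pcell_eq[OF faceD(1)[OF g(1)] g(2)] by simp
  then show ?thesis
    using zero_vertex_eq[OF g(1,2)] g(3) faceD(3)[OF g(1) cube_corners_unit[OF zero_corner_in]] by simp
qed

lemma zero_vertex_face:
  assumes "face g f h" "w \<in> unit_cube (cdim g)"
  shows "zero_vertex f (h w) = h (zero_vertex g w)"
proof -
  obtain k h' u where k: "face k g h'" "u \<in> open_cube (cdim k)" "h' u = w"
    using open_face[OF faceD(1)[OF assms(1)] assms(2)] .
  have "zero_vertex f ((h \<circ> h') u) = (h \<circ> h') zero_corner"
    using zero_vertex_eq[OF face_comp[OF assms(1) k(1)] k(2)] .
  moreover have "zero_vertex g w = h' zero_corner" using zero_vertex_eq[OF k(1,2)] k(3) by simp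
  ultimately show ?thesis using k(3) by simp
qed

lemma corner_face_dim:
  assumes "face g f h" "w \<in> open_cube (cdim g)" "h w \<in> cube_corners (cdim f)"
  shows "cdim g = 0" "w = zero_corner"
proof -
  obtain \<sigma> b where fm: "face_map (cdim g) (cdim f) \<sigma> b h" using assms(1) by (rule faceE)
  have "\<not> i < cdim g" for i
  proof
    assume i: "i < cdim g"
    then have "h w (\<sigma> i) = \<bar>b (\<sigma> i) - w i\<bar>" using face_mapD(4)[OF fm open_cube_unit[OF assms(2)]] by blast
    moreover have "0 < w i" "w i < 1" using assms(2) i by (auto simp: open_cube_def)
    ultimately show False using cube_corners_value[OF assms(3), of "\<sigma> i"]
        cube_corners_value[OF face_mapD(3)[OF fm], of "\<sigma> i"] by auto
  qed
  then show "cdim g = 0" by blast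
  then show "w = zero_corner" using assms(2) by (auto simp: open_cube_def)
qed

lemma zero_vertex_of_corner:
  assumes "f \<in> cells K" "c \<in> cube_corners (cdim f)"
  shows "zero_vertex f c = c"
proof -
  obtain g h w where g: "face g f h" "w \<in> open_cube (cdim g)" "h w = c"
    using open_face[OF assms(1) cube_corners_unit[OF assms(2)]] .
  then show ?thesis using corner_face_dim[OF g(1,2)] zero_vertex_eq[OF g(1,2)] assms(2) by simp
qed

lemma pcell_corner:
  assumes "f \<in> cells K" "c \<in> cube_corners (cdim f)"
  shows "cdim (pcell (chr f c)) = 0" "chr (pcell (chr f c)) zero_corner = chr f c"
proof -
  obtain g h w where g: "face g f h" "w \<in> open_cube (cdim g)" "h w = c"
    using open_face[OF assms(1) cube_corners_unit[OF assms(2)]] .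
  have "chr f c = chr g w" using faceD(3)[OF g(1) open_cube_unit[OF g(2)]] g(3) by simp
  moreover from this have "pcell (chr f c) = g" using pcell_eq[OF faceD(1)[OF g(1)] g(2)] by simp
  ultimately show "cdim (pcell (chr f c)) = 0" "chr (pcell (chr f c)) zero_corner = chr f c"
    using corner_face_dim[OF g(1,2)] g(3) assms(2) by auto
qed

lemma continuous_chr: "e \<in> cells K \<Longrightarrow> continuous_map (cube_topology (cdim e)) (complex_topology K) (chr e)"
  unfolding continuous_map_def topspace_cube_topology topspace_complex_topology[OF cube_complex]
  using chr_points openin_complex_topology[of K] by blast

lemma continuous_move:
  assumes "c \<in> cube_corners n" "i < n"
  shows "continuous_map (top_of_set {0..1}) (cube_topology n) (\<lambda>t. c(i := \<bar>c i - t\<bar>))"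
proof -
  have eq: "cube_topology n = subtopology (powertop_real UNIV) (unit_cube n)"
    unfolding cube_topology_def Euclidean_space_def subtopology_subtopology
    by (rule arg_cong[of _ _ "subtopology _"]) (auto simp: unit_cube_def)
  show ?thesis unfolding eq continuous_map_in_subtopology
  proof
    show "continuous_map (top_of_set {0..1}) (powertop_real UNIV) (\<lambda>t. c(i := \<bar>c i - t\<bar>))"
      unfolding continuous_map_componentwise_UNIV
    proof
      fix j
      show "continuous_map (top_of_set {0..1}) euclideanreal (\<lambda>t. (c(i := \<bar>c i - t\<bar>)) j)"
        by (cases "j = i") (auto intro!: continuous_intros)
    qed
    show "(\<lambda>t. c(i := \<bar>c i - t\<bar>)) \<in> topspace (top_of_set {0..1}) \<rightarrow> unit_cube n"
      using corner_move_unit[OF assms] by auto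
  qed
qed

lemma pathin_corner_edge:
  assumes "e \<in> cells K" "c \<in> cube_corners (cdim e)" "i < cdim e"
  shows "pathin (complex_topology K) (corner_edge K (e, c) i)"
proof -
  have "continuous_map (top_of_set {0..1}) (complex_topology K) (chr e \<circ> (\<lambda>t. c(i := \<bar>c i - t\<bar>)))"
    using continuous_map_compose[OF continuous_move[OF assms(2,3)] continuous_chr[OF assms(1)]] .
  then show ?thesis unfolding pathin_def
    by (rule continuous_map_eq) (simp add: corner_edge_apply)
qed

end

lemma pathin_join:
  assumes "pathin X g" "pathin X h" "g 1 = h 0"
  shows "pathin X (\<lambda>t. if t \<le> 1/2 then g (2 * t) else h (2 * t - 1))"
proof -
  have g: "continuous_map (subtopology (top_of_set {0..1}) {t \<in> topspace (top_of_set {0..1}). t \<le> 1/2}) X (\<lambda>t. g (2 * t))"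
  proof -
    have "continuous_map (subtopology (top_of_set {0..1}) {t \<in> topspace (top_of_set {0..1}). t \<le> 1/2})
        (top_of_set {0..1}) (\<lambda>t::real. 2 * t)"
      unfolding subtopology_subtopology by (auto intro!: continuous_intros)
    from continuous_map_compose[OF this assms(1)[unfolded pathin_def]] show ?thesis by (simp add: o_def)
  qed
  have h: "continuous_map (subtopology (top_of_set {0..1}) {t \<in> topspace (top_of_set {0..1}). 1/2 \<le> t}) X (\<lambda>t. h (2 * t - 1))"
  proof -
    have "continuous_map (subtopology (top_of_set {0..1}) {t \<in> topspace (top_of_set {0..1}). 1/2 \<le> t})
        (top_of_set {0..1}) (\<lambda>t::real. 2 * t - 1)"
      unfolding subtopology_subtopology by (auto intro!: continuous_intros)
    from continuous_map_compose[OF this assms(2)[unfolded pathin_def]] show ?thesis by (simp add: o_def)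
  qed
  show ?thesis unfolding pathin_def
  proof (rule continuous_map_cases_le[OF _ _ g h])
    fix t :: real assume "t = 1/2"
    then have "2 * t = 1" "2 * t - 1 = 0" by auto
    then show "g (2 * t) = h (2 * t - 1)" using assms(3) by (simp only:)
  qed (auto intro!: continuous_intros)
qed

context local_system
begin

lemma lift_affine:
  assumes "lift c s 0 1" "m > 0" "\<And>t. t \<in> {a..b} \<Longrightarrow> m * t + q \<in> {0..1}"
  shows "lift (\<lambda>t. c (m * t + q)) (\<lambda>t. s (m * t + q)) a b"
  unfolding lift_def
proof (intro ballI conjI)
  fix t assume t: "t \<in> {a..b}"
  show "s (m * t + q) \<in> \<Gamma> (c (m * t + q))" using assms(1,3) t unfolding lift_def by blast
  obtain d where d: "d > 0" "\<forall>u\<in>{0..1}. \<bar>u - (m * t + q)\<bar> < d \<longrightarrow>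
      c u \<in> U (c (m * t + q)) \<and> s u = tr (c (m * t + q)) (c u) (s (m * t + q))"
    using assms(1,3) t unfolding lift_def by blast
  show "\<exists>d>0. \<forall>u\<in>{a..b}. \<bar>u - t\<bar> < d \<longrightarrow> c (m * u + q) \<in> U (c (m * t + q)) \<and>
      s (m * u + q) = tr (c (m * t + q)) (c (m * u + q)) (s (m * t + q))"
  proof (intro exI[of _ "d / m"] conjI ballI impI)
    fix u assume u: "u \<in> {a..b}" "\<bar>u - t\<bar> < d / m"
    have "\<bar>(m * u + q) - (m * t + q)\<bar> = m * \<bar>u - t\<bar>"
      using assms(2) by (simp add: abs_mult flip: right_diff_distrib)
    also have "\<dots> < d" using u(2) assms(2) by (simp add: pos_less_divide_eq mult.commute)
    finally show "c (m * u + q) \<in> U (c (m * t + q))"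
      "s (m * u + q) = tr (c (m * t + q)) (c (m * u + q)) (s (m * t + q))"
      using d(2) assms(3)[OF u(1)] by blast+
  qed (use d(1) assms(2) in simp)
qed

lemma lift_cong:
  assumes "lift c s a b" "\<And>t. t \<in> {a..b} \<Longrightarrow> c t = c' t" "\<And>t. t \<in> {a..b} \<Longrightarrow> s t = s' t"
  shows "lift c' s' a b"
  using assms(1) unfolding lift_def by (simp add: assms(2,3))

lemma lift_join:
  assumes "lift g s 0 1" "lift h r 0 1" "g 1 = h 0" "s 1 = r 0"
  shows "\<exists>q. lift (\<lambda>t. if t \<le> 1/2 then g (2 * t) else h (2 * t - 1)) q 0 1 \<and> q 0 = s 0 \<and> q 1 = r 1"
proof -
  let ?c = "\<lambda>t. if t \<le> 1/2 then g (2 * t) else h (2 * t - 1)"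
  have "lift (\<lambda>t. g (2 * t + 0)) (\<lambda>t. s (2 * t + 0)) 0 (1/2)"
    by (rule lift_affine[OF assms(1)]) auto
  then have 1: "lift ?c (\<lambda>t. s (2 * t)) 0 (1/2)" by (rule lift_cong) auto
  have "lift (\<lambda>t. h (2 * t + (- 1))) (\<lambda>t. r (2 * t + (- 1))) (1/2) 1"
    by (rule lift_affine[OF assms(2)]) auto
  then have 2: "lift ?c (\<lambda>t. r (2 * t - 1)) (1/2) 1"
  proof (rule lift_cong)
    fix t :: real assume t: "t \<in> {1/2..1}"
    show "h (2 * t + - 1) = ?c t"
    proof (cases "t = 1/2")
      case True
      then have "2 * t = 1" "2 * t + - 1 = 0" by auto
      then show ?thesis using assms(3) True by (simp only:) simp
    qed (use t in auto)
  qed auto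
  have "lift ?c (\<lambda>t. if t \<le> 1/2 then s (2 * t) else r (2 * t - 1)) 0 1"
    by (rule lift_glue[OF 1 2]) (use assms(4) in auto)
  then show ?thesis
    by (intro exI[of _ "\<lambda>t. if t \<le> 1/2 then s (2 * t) else r (2 * t - 1)"]) auto
qed

end

locale cube_local_system = cube_cx K for K :: "('a, 'c) cube_structure" +
  fixes N :: "'a \<Rightarrow> 's set" and act :: "'s \<Rightarrow> (real \<Rightarrow> 'a) \<Rightarrow> 's"
  assumes act_in: "a \<in> edges \<Longrightarrow> P \<in> N (a 0) \<Longrightarrow> act P a \<in> N (a 1)"
    and act_rev: "a \<in> edges \<Longrightarrow> P \<in> N (a 0) \<Longrightarrow> act (act P a) (erev a) = P"
    and act_sq: "esq x a y b \<Longrightarrow> P \<in> N (x 0) \<Longrightarrow> act (act P x) a = act (act P y) b"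
begin

text \<open>A parallel section over the corners of one cube.\<close>

definition flat :: "'c \<Rightarrow> ((nat \<Rightarrow> real) \<Rightarrow> 's) \<Rightarrow> bool" where
  "flat f \<phi> \<longleftrightarrow> (\<forall>c\<in>cube_corners (cdim f). \<phi> c \<in> N (chr f c) \<and>
     (\<forall>i<cdim f. \<phi> (flip c i) = act (\<phi> c) (corner_edge K (f, c) i)))"

lemma flat_in: "flat f \<phi> \<Longrightarrow> c \<in> cube_corners (cdim f) \<Longrightarrow> \<phi> c \<in> N (chr f c)"
  unfolding flat_def by blast

text \<open>Coordinates are released one by one: a section on the corners that agree with
  \<open>c\<close> from coordinate \<open>k\<close> on is extended across direction \<open>k\<close>
  by transport. The squares in direction \<open>k\<close> make the extension parallel in the earlier
  directions.\<close>

lemma flat_exists: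
  assumes f: "f \<in> cells K" and c: "c \<in> cube_corners (cdim f)" and P: "P \<in> N (chr f c)"
  shows "\<exists>\<phi>. flat f \<phi> \<and> \<phi> c = P"
proof -
  let ?E = "\<lambda>c i. corner_edge K (f, c) i"
  have "\<exists>\<phi>. \<phi> c = P \<and> (\<forall>d\<in>cube_corners (cdim f). (\<forall>i\<ge>k. d i = c i) \<longrightarrow>
      \<phi> d \<in> N (chr f d) \<and> (\<forall>i<k. \<phi> (flip d i) = act (\<phi> d) (?E d i)))" if "k \<le> cdim f" for k
    using that
  proof (induction k)
    case 0
    have "d = c" if "\<forall>i\<ge>0. d i = c i" for d :: "nat \<Rightarrow> real" using that by auto
    then show ?case using P by (intro exI[of _ "\<lambda>_. P"]) auto
  next
    case (Suc k)
    then obtain \<phi> where \<phi>: "\<phi> c = P" "\<And>d. d \<in> cube_corners (cdim f) \<Longrightarrow> (\<forall>i\<ge>k. d i = c i) \<Longrightarrow>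
      \<phi> d \<in> N (chr f d) \<and> (\<forall>i<k. \<phi> (flip d i) = act (\<phi> d) (?E d i))" by (metis Suc_leD)
    have k: "k < cdim f" using Suc by simp
    \<comment> \<open>On the far side the value is carried over from the neighbour in direction
      \<open>k\<close>.\<close>
    define \<psi> where "\<psi> d = (if d k = c k then \<phi> d else act (\<phi> (flip d k)) (?E (flip d k) k))" for d
    have "\<psi> d \<in> N (chr f d) \<and> (\<forall>i<Suc k. \<psi> (flip d i) = act (\<psi> d) (?E d i))"
      if d: "d \<in> cube_corners (cdim f)" "\<forall>i\<ge>Suc k. d i = c i" for d
    proof (cases "d k = c k")
      case True
      have dc: "\<forall>i\<ge>k. d i = c i" using d(2) True by (metis le_antisym not_less_eq_eq)
      note \<phi>d = \<phi>(2)[OF d(1) dc]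
      have ne: "1 - c k \<noteq> c k" using cube_corners_value[OF c, of k] by auto
      have "\<psi> (flip d i) = act (\<psi> d) (?E d i)" if "i < Suc k" for i
      proof (cases "i = k")
        case True
        have "flip d k k \<noteq> c k" using \<open>d k = c k\<close> ne by simp
        then have "\<psi> (flip d k) = act (\<phi> (flip (flip d k) k)) (?E (flip (flip d k) k) k)"
          unfolding \<psi>_def by (rule if_not_P)
        then have "\<psi> (flip d k) = act (\<phi> d) (?E d k)" unfolding flip_flip .
        moreover have "\<psi> d = \<phi> d" using \<open>d k = c k\<close> by (simp add: \<psi>_def)
        ultimately show ?thesis using True by simp
      next
        case False
        then have "\<psi> (flip d i) = \<phi> (flip d i)" using \<open>d k = c k\<close> by (simp add: \<psi>_def)
        then show ?thesis using \<phi>d False that \<open>d k = c k\<close> by (simp add: \<psi>_def)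
      qed
      then show ?thesis using \<phi>d True by (simp add: \<psi>_def)
    next
      case False
      define d' where "d' = flip d k"
      have d': "d' \<in> cube_corners (cdim f)" using flip_in[OF d(1) k] by (simp add: d'_def)
      have dd': "flip d' k = d" unfolding d'_def by (rule flip_flip)
      have d'k: "d' k = c k"
        using cube_corners_value[OF c, of k] cube_corners_value[OF d(1), of k] False by (auto simp: d'_def)
      have d'c: "\<forall>i\<ge>k. d' i = c i"
        using d(2) d'k by (metis d'_def fun_upd_other le_antisym not_less_eq_eq)
      note \<phi>d = \<phi>(2)[OF d' d'c]
      have Ed': "?E d' k \<in> edges" using edgesI[OF f d' k] .
      have N': "\<phi> d' \<in> N (?E d' k 0)" using \<phi>d corner_edge_0[OF d'] by simp
      have \<psi>d: "\<psi> d = act (\<phi> d') (?E d' k)" using False by (simp add: \<psi>_def d'_def)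
      have "\<psi> d \<in> N (chr f d)"
        using act_in[OF Ed' N'] corner_edge_1[OF d', of f k] dd' \<psi>d by simp
      moreover have "\<psi> (flip d i) = act (\<psi> d) (?E d i)" if "i < Suc k" for i
      proof (cases "i = k")
        case True
        have "\<psi> (flip d i) = \<phi> d'" using True d'k by (simp add: \<psi>_def d'_def)
        also have "\<dots> = act (act (\<phi> d') (?E d' k)) (erev (?E d' k))" using act_rev[OF Ed' N'] by simp
        also have "erev (?E d' k) = ?E d k" using erev_corner_edge[OF f d' k] dd' by simp
        finally show ?thesis unfolding \<psi>d True .
      next
        case False
        then have i: "i < k" "i < cdim f" using that k by auto
        have fl: "flip (flip d i) k = flip d' i" unfolding d'_def using False by (rule flip_commute)
        have "\<psi> (flip d i) = act (\<phi> (flip d' i)) (?E (flip d' i) k)"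
          using \<open>d k \<noteq> c k\<close> False unfolding \<psi>_def fl by simp
        also have "\<dots> = act (act (\<phi> d') (?E d' i)) (?E (flip d' i) k)" using \<phi>d i by simp
        also have "\<dots> = act (act (\<phi> d') (?E d' k)) (?E (flip d' k) i)"
        proof (rule act_sq)
          show "esq (?E d' i) (?E (flip d' i) k) (?E d' k) (?E (flip d' k) i)"
            unfolding esq_def using f d' i k False by blast
          show "\<phi> d' \<in> N (?E d' i 0)" using \<phi>d corner_edge_0[OF d'] by simp
        qed
        finally show ?thesis using \<psi>d dd' by simp
      qed
      ultimately show ?thesis by blast
    qed
    moreover have "\<psi> c = P" using \<phi>(1) by (simp add: \<psi>_def)
    ultimately show ?case by blast
  qed
  from this[of "cdim f"] obtain \<phi> where \<phi>: "\<phi> c = P" "\<And>d. d \<in> cube_corners (cdim f) \<Longrightarrow>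
      (\<forall>i\<ge>cdim f. d i = c i) \<Longrightarrow> \<phi> d \<in> N (chr f d) \<and> (\<forall>i<cdim f. \<phi> (flip d i) = act (\<phi> d) (?E d i))"
    by auto
  have "flat f \<phi>" unfolding flat_def using \<phi>(2) c by (simp add: cube_corners_iff)
  then show ?thesis using \<phi>(1) by blast
qed

lemma flat_unique:
  assumes "flat f \<phi>" "flat f \<psi>" "c \<in> cube_corners (cdim f)" "c' \<in> cube_corners (cdim f)" "\<phi> c = \<psi> c"
  shows "\<phi> c' = \<psi> c'"
  using assms(3,4)
proof (induction rule: corner_induct)
  case (flip d i)
  then have "\<phi> (d(i := 1 - d i)) = act (\<phi> d) (corner_edge K (f, d) i)"
    "\<psi> (d(i := 1 - d i)) = act (\<psi> d) (corner_edge K (f, d) i)"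
    using assms(1,2) unfolding flat_def by blast+
  then show ?case using flip(3) by (simp only:)
qed (rule assms(5))

lemma flat_face:
  assumes h: "face g f h" and \<phi>: "flat f \<phi>"
  shows "flat g (\<phi> \<circ> h)"
proof -
  obtain \<sigma> b where fm: "face_map (cdim g) (cdim f) \<sigma> b h" using h by (rule faceE)
  show ?thesis unfolding flat_def
  proof (intro ballI conjI allI impI)
    fix c assume c: "c \<in> cube_corners (cdim g)"
    have hc: "h c \<in> cube_corners (cdim f)" using face_corner[OF h c] .
    show "(\<phi> \<circ> h) c \<in> N (chr g c)"
      using flat_in[OF \<phi> hc] faceD(3)[OF h cube_corners_unit[OF c]] by simp
    fix i assume i: "i < cdim g"
    have "\<phi> (flip (h c) (\<sigma> i)) = act (\<phi> (h c)) (corner_edge K (f, h c) (\<sigma> i))"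
      using \<phi> hc face_mapD(2)[OF fm i] unfolding flat_def by blast
    then show "(\<phi> \<circ> h) (flip c i) = act ((\<phi> \<circ> h) c) (corner_edge K (g, c) i)"
      using face_map_flip[OF fm c i] face_corner_edge[OF h fm c i] by simp
  qed
qed

text \<open>All points of an open cell share the fibre of its base vertex.\<close>

definition fibre :: "'a \<Rightarrow> 's set" where "fibre k = N (chr (pcell k) zero_corner)"

lemma flat_fibre:
  assumes "f \<in> cells K" "flat f \<phi>" "z \<in> unit_cube (cdim f)"
  shows "\<phi> (zero_vertex f z) \<in> fibre (chr f z)"
  unfolding fibre_def using flat_in[OF assms(2) zero_vertex_corner[OF assms(1,3)]]
    chr_zero_vertex[OF assms(1,3)] by simp

lemma flat_fibre_exists:
  assumes "f \<in> cells K" "z \<in> unit_cube (cdim f)" "s \<in> fibre (chr f z)"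
  shows "\<exists>\<phi>. flat f \<phi> \<and> \<phi> (zero_vertex f z) = s"
  using flat_exists[OF assms(1) zero_vertex_corner[OF assms(1,2)]] assms(3)
  unfolding fibre_def chr_zero_vertex[OF assms(1,2)] by blast

text \<open>Near \<open>k0\<close> the point \<open>k\<close> lies in a cell that has
  \<open>k0\<close> in its closure. The preimage \<open>w\<close> of \<open>k0\<close> close to
  \<open>k\<close> selects a corner of that cell, and a parallel section compares its value with
  that at the base vertex of \<open>k\<close>.\<close>

definition transport :: "'a \<Rightarrow> 'a \<Rightarrow> 's \<Rightarrow> 's \<Rightarrow> bool" where
  "transport k\<^sub>0 k s s' \<longleftrightarrow> (\<exists>w \<phi>. w \<in> unit_cube (cdim (pcell k)) \<and> chr (pcell k) w = k\<^sub>0 \<and>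
     near (cdim (pcell k)) (radius k\<^sub>0) (pcoord k) w \<and> flat (pcell k) \<phi> \<and>
     \<phi> (zero_vertex (pcell k) w) = s \<and> \<phi> zero_corner = s')"

lemma zero_vertex_pcoord: "k \<in> points K \<Longrightarrow> zero_vertex (pcell k) (pcoord k) = zero_corner"
  using zero_vertex_eq[OF face_id[OF pcell(1)] pcell(2)] by blast

text \<open>Transport may be computed in any closed cube that contains both points, because
  restriction to a face keeps a section parallel.\<close>

lemma transport_flat:
  assumes f: "f \<in> cells K" and \<phi>: "flat f \<phi>" and z: "z \<in> unit_cube (cdim f)" "z' \<in> unit_cube (cdim f)"
    and nr: "near (cdim f) (radius (chr f z')) z z'"
  shows "transport (chr f z') (chr f z) (\<phi> (zero_vertex f z')) (\<phi> (zero_vertex f z))"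
proof -
  obtain h w' where h: "face (pcell (chr f z)) f h" "h (pcoord (chr f z)) = z" "h w' = z'"
    "w' \<in> unit_cube (cdim (pcell (chr f z)))" "chr (pcell (chr f z)) w' = chr f z'"
    "near (cdim (pcell (chr f z))) (radius (chr f z')) (pcoord (chr f z)) w'"
    using near_pcell[OF f z refl nr] .
  have zp: "chr f z \<in> points K" using chr_points[OF f z(1)] .
  have "\<phi> (zero_vertex f z') = (\<phi> \<circ> h) (zero_vertex (pcell (chr f z)) w')"
    using zero_vertex_face[OF h(1,4)] h(3) by simp
  moreover have "\<phi> (zero_vertex f z) = (\<phi> \<circ> h) zero_corner"
    using zero_vertex_eq[OF h(1) pcell(2)[OF zp]] h(2) by simp
  ultimately show ?thesis unfolding transport_def using h(4,5,6) flat_face[OF h(1) \<phi>]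
    by (intro exI[of _ w'] exI[of _ "\<phi> \<circ> h"]) simp
qed

lemma transport_preimage_unique:
  assumes "k \<in> points K" "w \<in> unit_cube (cdim (pcell k))" "chr (pcell k) w = k\<^sub>0"
    "near (cdim (pcell k)) (radius k\<^sub>0) (pcoord k) w"
    "w' \<in> unit_cube (cdim (pcell k))" "chr (pcell k) w' = k\<^sub>0"
    "near (cdim (pcell k)) (radius k\<^sub>0) (pcoord k) w'"
  shows "w = w'"
proof -
  have k0: "k\<^sub>0 \<in> points K" using chr_points[OF pcell(1)[OF assms(1)] assms(2)] assms(3) by simp
  have "near (cdim (pcell k)) (radius k\<^sub>0 + radius k\<^sub>0) w w'"
    using near_triangle[OF near_sym[OF assms(4)] assms(7)] .
  then have "near (cdim (pcell k)) (depth k\<^sub>0) w w'" using near_mono radius(3)[OF k0] by blast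
  then show ?thesis using preimage_unique[OF pcell(1)[OF assms(1)] assms(2,5,3,6)] by blast
qed

lemma transport_iff:
  assumes k: "k \<in> points K" and tr: "transport k\<^sub>0 k s s'" "transport k\<^sub>0 k r r'"
  shows "s = r \<longleftrightarrow> s' = r'"
proof -
  let ?g = "pcell k"
  obtain w \<phi> where w: "w \<in> unit_cube (cdim ?g)" "chr ?g w = k\<^sub>0" "near (cdim ?g) (radius k\<^sub>0) (pcoord k) w"
    "flat ?g \<phi>" "\<phi> (zero_vertex ?g w) = s" "\<phi> zero_corner = s'" using tr(1) unfolding transport_def by blast
  obtain w' \<psi> where w': "w' \<in> unit_cube (cdim ?g)" "chr ?g w' = k\<^sub>0" "near (cdim ?g) (radius k\<^sub>0) (pcoord k) w'"
    "flat ?g \<psi>" "\<psi> (zero_vertex ?g w') = r" "\<psi> zero_corner = r'" using tr(2) unfolding transport_def by blast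
  have eq: "w = w'" using transport_preimage_unique[OF k w(1-3) w'(1-3)] .
  have zc: "zero_vertex ?g w \<in> cube_corners (cdim ?g)" using zero_vertex_corner[OF pcell(1)[OF k] w(1)] .
  show ?thesis
    using flat_unique[OF w(4) w'(4) zc zero_corner_in] flat_unique[OF w(4) w'(4) zero_corner_in zc]
      w(5,6) w'(5,6) eq by metis
qed

lemma transport_exists:
  assumes "k \<in> nbhd k\<^sub>0"
  shows "s \<in> fibre k\<^sub>0 \<Longrightarrow> \<exists>s'\<in>fibre k. transport k\<^sub>0 k s s'"
    and "s' \<in> fibre k \<Longrightarrow> \<exists>s\<in>fibre k\<^sub>0. transport k\<^sub>0 k s s'"
proof -
  obtain w where w: "k \<in> points K" "w \<in> unit_cube (cdim (pcell k))" "chr (pcell k) w = k\<^sub>0"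
    "near (cdim (pcell k)) (radius k\<^sub>0) (pcoord k) w" using nbhdE[OF assms] .
  let ?g = "pcell k"
  have g: "?g \<in> cells K" using pcell(1)[OF w(1)] .
  have *: "\<phi> (zero_vertex ?g w) \<in> fibre k\<^sub>0" "\<phi> zero_corner \<in> fibre k"
      "transport k\<^sub>0 k (\<phi> (zero_vertex ?g w)) (\<phi> zero_corner)" if "flat ?g \<phi>" for \<phi>
    using flat_fibre[OF g that w(2)] flat_fibre[OF g that pcoord_unit[OF w(1)]] w that
      zero_vertex_pcoord[OF w(1)] pcell(3)[OF w(1)] unfolding transport_def by auto
  show "\<exists>s'\<in>fibre k. transport k\<^sub>0 k s s'" if "s \<in> fibre k\<^sub>0"
    using flat_fibre_exists[OF g w(2)] w(3) that * by metis
  show "\<exists>s\<in>fibre k\<^sub>0. transport k\<^sub>0 k s s'" if "s' \<in> fibre k"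
    using flat_exists[OF g zero_corner_in] that * unfolding fibre_def by metis
qed

lemma transport_self:
  assumes "k \<in> points K" "s \<in> fibre k"
  shows "transport k k s s"
proof -
  have g: "pcell k \<in> cells K" using pcell(1)[OF assms(1)] .
  obtain \<phi> where \<phi>: "flat (pcell k) \<phi>" "\<phi> zero_corner = s"
    using flat_exists[OF g zero_corner_in] assms(2) unfolding fibre_def by blast
  have "near (cdim (pcell k)) (radius k) (pcoord k) (pcoord k)"
    using radius(1)[OF assms(1)] by (simp add: near_def)
  then have "transport (chr (pcell k) (pcoord k)) (chr (pcell k) (pcoord k))
      (\<phi> (zero_vertex (pcell k) (pcoord k))) (\<phi> (zero_vertex (pcell k) (pcoord k)))"
    using pcell(3)[OF assms(1)] by (intro transport_flat g \<phi> pcoord_unit assms) simp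
  then show ?thesis using \<phi> zero_vertex_pcoord[OF assms(1)] pcell(3)[OF assms(1)] by simp
qed

text \<open>All three points are represented in the closed cell of \<open>k\<close>, where a single
  parallel section computes all three transports.\<close>

lemma transport_cocycle:
  assumes k\<^sub>0: "k\<^sub>0 \<in> points K" and k\<^sub>1: "k\<^sub>1 \<in> nbhd k\<^sub>0" and k: "k \<in> nbhd k\<^sub>0" "k \<in> nbhd k\<^sub>1" and s: "s \<in> fibre k\<^sub>0"
  shows "\<exists>s' s''. transport k\<^sub>0 k\<^sub>1 s s' \<and> transport k\<^sub>1 k s' s'' \<and> transport k\<^sub>0 k s s''"
proof -
  let ?g = "pcell k" and ?g1 = "pcell k\<^sub>1"
  obtain w where w: "k \<in> points K" "w \<in> unit_cube (cdim ?g)" "chr ?g w = k\<^sub>0"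
    "near (cdim ?g) (radius k\<^sub>0) (pcoord k) w" using nbhdE[OF k(1)] .
  obtain v where v: "v \<in> unit_cube (cdim ?g)" "chr ?g v = k\<^sub>1"
    "near (cdim ?g) (radius k\<^sub>1) (pcoord k) v" using nbhdE[OF k(2)] .
  obtain u where u: "k\<^sub>1 \<in> points K" "u \<in> unit_cube (cdim ?g1)" "chr ?g1 u = k\<^sub>0"
    "near (cdim ?g1) (radius k\<^sub>0) (pcoord k\<^sub>1) u" using nbhdE[OF k\<^sub>1] .
  have g: "?g \<in> cells K" using pcell(1)[OF w(1)] .
  obtain h where h: "face ?g1 ?g h" "h (pcoord k\<^sub>1) = v" using pcell_face[OF g v(1,2)] .
  have hu: "h u \<in> unit_cube (cdim ?g)" "chr ?g (h u) = k\<^sub>0"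
    using face_unit[OF h(1) u(2)] faceD(3)[OF h(1) u(2)] u(3) by auto
  have vu: "near (cdim ?g) (radius k\<^sub>0) v (h u)"
    using face_near[OF h(1) pcoord_unit[OF u(1)] u(2) radius(1)[OF k\<^sub>0]] u(4) h(2) by simp
  \<comment> \<open>The preimages of \<open>k0\<close> found directly and through \<open>k1\<close>
    must coincide; their distance is below two radii of \<open>k0\<close> plus one of
    \<open>k1\<close>.\<close>
  have "near (cdim ?g) (radius k\<^sub>0 + (radius k\<^sub>1 + radius k\<^sub>0)) w (h u)"
    using near_triangle[OF near_sym[OF w(4)] near_triangle[OF v(3) vu]] .
  moreover have "radius k\<^sub>0 + (radius k\<^sub>1 + radius k\<^sub>0) \<le> depth k\<^sub>0"
    using depth_near[OF k\<^sub>0 k\<^sub>1] depth_pos[OF k\<^sub>0] by (simp add: radius_def)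
  ultimately have "w = h u" using preimage_unique[OF g w(2) hu(1) w(3) hu(2)] near_mono by blast
  then have vw: "near (cdim ?g) (radius k\<^sub>0) v w" using vu by simp
  obtain \<phi> where \<phi>: "flat ?g \<phi>" "\<phi> (zero_vertex ?g w) = s" using flat_fibre_exists[OF g w(2)] w(3) s by blast
  have ku: "pcoord k \<in> unit_cube (cdim ?g)" using pcoord_unit[OF w(1)] .
  have "transport k\<^sub>0 k\<^sub>1 s (\<phi> (zero_vertex ?g v))"
    using transport_flat[OF g \<phi>(1) v(1) w(2)] vw w(3) v(2) \<phi>(2) by simp
  moreover have "transport k\<^sub>1 k (\<phi> (zero_vertex ?g v)) (\<phi> zero_corner)"
    using transport_flat[OF g \<phi>(1) ku v(1)] v(2,3) pcell(3)[OF w(1)] zero_vertex_pcoord[OF w(1)] by simp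
  moreover have "transport k\<^sub>0 k s (\<phi> zero_corner)"
    using transport_flat[OF g \<phi>(1) ku w(2)] w(3,4) \<phi>(2) pcell(3)[OF w(1)] zero_vertex_pcoord[OF w(1)] by simp
  ultimately show ?thesis by blast
qed

definition trans_fun :: "'a \<Rightarrow> 'a \<Rightarrow> 's \<Rightarrow> 's" where
  "trans_fun k\<^sub>0 k s = (SOME s'. transport k\<^sub>0 k s s')"

lemma trans_fun_eq: "k \<in> points K \<Longrightarrow> transport k\<^sub>0 k s s' \<Longrightarrow> trans_fun k\<^sub>0 k s = s'"
  unfolding trans_fun_def using transport_iff by (metis someI)

lemma nbhd_points: "k \<in> nbhd k\<^sub>0 \<Longrightarrow> k \<in> points K"
  using nbhdE by metis

sublocale LS: local_system "complex_topology K" fibre nbhd trans_fun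
proof
  fix k k' k\<^sub>0 k\<^sub>1 s s'
  have tp: "topspace (complex_topology K) = points K" using topspace_complex_topology[OF cube_complex] .
  show "openin (complex_topology K) (nbhd k)" if "k \<in> topspace (complex_topology K)"
    using openin_nbhd that tp by simp
  show "k \<in> nbhd k" if "k \<in> topspace (complex_topology K)" using nbhd_self that tp by simp
  show "trans_fun k k' s \<in> fibre k'" if "k' \<in> nbhd k" "s \<in> fibre k"
    using transport_exists(1)[OF that] trans_fun_eq[OF nbhd_points[OF that(1)]] by auto
  show "s = s'" if "k' \<in> nbhd k" "s \<in> fibre k" "s' \<in> fibre k" "trans_fun k k' s = trans_fun k k' s'"
    using transport_exists(1)[OF that(1,2)] transport_exists(1)[OF that(1,3)]
      trans_fun_eq[OF nbhd_points[OF that(1)]] transport_iff[OF nbhd_points[OF that(1)]] that(4) by metis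
  show "\<exists>s\<in>fibre k. trans_fun k k' s = s'" if "k' \<in> nbhd k" "s' \<in> fibre k'"
    using transport_exists(2)[OF that] trans_fun_eq[OF nbhd_points[OF that(1)]] by metis
  show "trans_fun k k s = s" if "k \<in> topspace (complex_topology K)" "s \<in> fibre k"
    using trans_fun_eq transport_self that tp by simp
  show "trans_fun k\<^sub>1 k (trans_fun k\<^sub>0 k\<^sub>1 s) = trans_fun k\<^sub>0 k s"
    if k0: "k\<^sub>0 \<in> topspace (complex_topology K)" and k1: "k\<^sub>1 \<in> nbhd k\<^sub>0" and k: "k \<in> nbhd k\<^sub>0" "k \<in> nbhd k\<^sub>1"
      and s: "s \<in> fibre k\<^sub>0"
  proof -
    obtain s' s'' where "transport k\<^sub>0 k\<^sub>1 s s'" "transport k\<^sub>1 k s' s''" "transport k\<^sub>0 k s s''"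
      using transport_cocycle[OF _ k1 k s] k0 tp by auto
    then show ?thesis using trans_fun_eq nbhd_points k k1 by metis
  qed
qed

text \<open>The parallel section over the cube, evaluated at the base corner of each point of the
  edge, is a lift. At its ends it shows that topological transport along an edge is
  \<open>act\<close>.\<close>

lemma lift_corner_edge:
  assumes e: "e \<in> cells K" and c: "c \<in> cube_corners (cdim e)" "i < cdim e" and P: "P \<in> N (chr e c)"
  obtains s where "LS.lift (corner_edge K (e, c) i) s 0 1" "s 0 = P" "s 1 = act P (corner_edge K (e, c) i)"
proof -
  obtain \<phi> where \<phi>: "flat e \<phi>" "\<phi> c = P" using flat_exists[OF e c(1) P] by blast
  define z where "z t = c(i := \<bar>c i - t\<bar>)" for t
  define s where "s t = \<phi> (zero_vertex e (z t))" for t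
  have z: "z t \<in> unit_cube (cdim e)" if "t \<in> {0..1}" for t
    unfolding z_def using corner_move_unit[OF c] that by simp
  have "LS.lift (\<lambda>t. chr e (z t)) s 0 1" unfolding LS.lift_def
  proof (intro ballI conjI)
    fix t :: real assume t: "t \<in> {0..1}"
    show "s t \<in> fibre (chr e (z t))" unfolding s_def using flat_fibre[OF e \<phi>(1) z[OF t]] .
    have kp: "chr e (z t) \<in> points K" using chr_points[OF e z[OF t]] .
    show "\<exists>d>0. \<forall>u\<in>{0..1}. \<bar>u - t\<bar> < d \<longrightarrow> chr e (z u) \<in> nbhd (chr e (z t)) \<and>
        s u = trans_fun (chr e (z t)) (chr e (z u)) (s t)"
    proof (rule exI[of _ "radius (chr e (z t))"], intro conjI ballI impI)
      show r: "radius (chr e (z t)) > 0" using radius(1)[OF kp] .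
      fix u :: real assume u: "u \<in> {0..1}" "\<bar>u - t\<bar> < radius (chr e (z t))"
      have nr: "near (cdim e) (radius (chr e (z t))) (z u) (z t)"
        unfolding near_def z_def
        using u t r cube_corners_value[OF c(1), of i] by (auto simp: z_def abs_minus_commute)
      show "chr e (z u) \<in> nbhd (chr e (z t))" unfolding nbhd_def using e z[OF u(1)] z[OF t] nr by blast
      have "transport (chr e (z t)) (chr e (z u)) (s t) (s u)"
        unfolding s_def using transport_flat[OF e \<phi>(1) z[OF u(1)] z[OF t] nr] .
      then show "s u = trans_fun (chr e (z t)) (chr e (z u)) (s t)"
        using trans_fun_eq chr_points[OF e z[OF u(1)]] by simp
    qed
  qed
  then have "LS.lift (corner_edge K (e, c) i) s 0 1"
    by (rule LS.lift_cong) (simp_all add: corner_edge_apply z_def)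
  moreover have "z 0 = c" using cube_corners_value[OF c(1), of i] by (auto simp: z_def)
  then have "s 0 = P" using zero_vertex_of_corner[OF e c(1)] \<phi>(2) by (simp add: s_def)
  moreover have "z 1 = flip c i" using cube_corners_value[OF c(1), of i] by (auto simp: z_def)
  then have "s 1 = act P (corner_edge K (e, c) i)"
    using zero_vertex_of_corner[OF e flip_in[OF c]] \<phi> c unfolding s_def flat_def by simp
  ultimately show ?thesis using that by blast
qed

end

section \<open>Actions on CAT(0) cube complexes\<close>

context cube_cx
begin

section \<open>The link condition and the square complex of edges\<close>

lemma corner_vertex:
  assumes "f \<in> cells K" "c \<in> cube_corners (cdim f)"
  shows "chr f c \<in> vertices K"
proof -
  have "chr f c \<in> points K" using chr_points[OF assms(1) cube_corners_unit[OF assms(2)]] .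
  then show ?thesis unfolding vertices_def
    using pcell_corner[OF assms] pcell(1) by (metis (mono_tags, lifting) mem_Collect_eq)
qed

lemma corners_at_chr: "(e, c) \<in> corners_at K x \<longleftrightarrow> e \<in> cells K \<and> c \<in> cube_corners (cdim e) \<and> chr e c = x"
  by (simp add: corners_at_def)

lemma corner_face:
  assumes f: "f \<in> cells K" and c: "c \<in> cube_corners (cdim f)" and D: "D \<subseteq> {..<cdim f}"
  obtains g h \<sigma> b d where "face g f h" "face_map (cdim g) (cdim f) \<sigma> b h" "\<sigma> ` {..<cdim g} = D"
    "d \<in> cube_corners (cdim g)" "h d = c"
proof -
  have I: "{..<cdim f} - D \<subseteq> {..<cdim f}" "c \<in> {..<cdim f} - D \<rightarrow> {0, 1}"
    using cube_corners_value[OF c] by auto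
  obtain g h \<sigma> b where g: "face g f h" "face_map (cdim g) (cdim f) \<sigma> b h"
    "\<sigma> ` {..<cdim g} = {..<cdim f} - ({..<cdim f} - D)" "\<And>i. i \<in> {..<cdim f} - D \<Longrightarrow> b i = c i"
    using exists_face[OF f I] by blast
  have im: "\<sigma> ` {..<cdim g} = D" using g(3) D by auto
  have "c j = b j" if "j < cdim f" "j \<notin> \<sigma> ` {..<cdim g}" for j using that g(4) im by auto
  then obtain d where d: "d \<in> unit_cube (cdim g)" "h d = c" "\<And>i. i < cdim g \<Longrightarrow> d i = \<bar>b (\<sigma> i) - c (\<sigma> i)\<bar>"
    using face_map_surj[OF g(2) cube_corners_unit[OF c]] by blast
  have "d i = 0 \<or> d i = 1" if "i < cdim g" for i
    using d(3)[OF that] cube_corners_value[OF c, of "\<sigma> i"]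
      cube_corners_value[OF face_mapD(3)[OF g(2)], of "\<sigma> i"] by auto
  then have "d \<in> cube_corners (cdim g)" using d(1) by (simp add: cube_corners_def)
  then show ?thesis using that g(1,2) im d(2) by blast
qed

text \<open>Passing to the face spanned by two directions makes the simplex at the corner exactly
  the pair of edges, as the link condition requires.\<close>

lemma esq_square:
  assumes "esq x a y b"
  obtains g d i j where "g \<in> cells K" "cdim g = 2" "d \<in> cube_corners (cdim g)" "i < 2" "j < 2" "i \<noteq> j"
    "x = corner_edge K (g, d) i" "a = corner_edge K (g, flip d i) j"
    "y = corner_edge K (g, d) j" "b = corner_edge K (g, flip d j) i"
proof -
  obtain e c i j where e: "e \<in> cells K" "c \<in> cube_corners (cdim e)" "i < cdim e" "j < cdim e" "i \<noteq> j"
     "x = corner_edge K (e, c) i" "a = corner_edge K (e, flip c i) j"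
     "y = corner_edge K (e, c) j" "b = corner_edge K (e, flip c j) i"
    using assms unfolding esq_def by blast
  obtain g h \<sigma> b' d where g: "face g e h" "face_map (cdim g) (cdim e) \<sigma> b' h" "\<sigma> ` {..<cdim g} = {i, j}"
    "d \<in> cube_corners (cdim g)" "h d = c"
  proof -
    have "{i, j} \<subseteq> {..<cdim e}" using e(3,4) by auto
    then show ?thesis by (rule corner_face[OF e(1,2)]) (rule that)
  qed
  have "cdim g = card {i, j}" using card_image[OF face_mapD(1)[OF g(2)]] g(3) by simp
  then have dim: "cdim g = 2" using e(5) by simp
  have "i \<in> \<sigma> ` {..<cdim g}" "j \<in> \<sigma> ` {..<cdim g}" using g(3) by simp_all
  then obtain i' j' where ij: "i' < cdim g" "\<sigma> i' = i" "j' < cdim g" "\<sigma> j' = j" by blast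
  have ne: "i' \<noteq> j'" using ij e(5) by auto
  note E = face_corner_edge[OF g(1,2)]
  have 1: "x = corner_edge K (g, d) i'" using E[OF g(4) ij(1)] g(5) ij e by simp
  have 2: "y = corner_edge K (g, d) j'" using E[OF g(4) ij(3)] g(5) ij e by simp
  have 3: "a = corner_edge K (g, flip d i') j'"
    using E[OF flip_in[OF g(4) ij(1)] ij(3)] face_map_flip[OF g(2,4) ij(1)] g(5) ij e(7) by simp
  have 4: "b = corner_edge K (g, flip d j') i'"
    using E[OF flip_in[OF g(4) ij(3)] ij(1)] face_map_flip[OF g(2,4) ij(3)] g(5) ij e(9) by simp
  show ?thesis using that[OF faceD(1)[OF g(1)] dim g(4) _ _ ne 1 3 2 4] ij dim by simp
qed

lemma corner_simplex_square:
  assumes "cdim g = 2" "i < 2" "j < 2" "i \<noteq> j"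
  shows "corner_simplex K (g, d) = {corner_edge K (g, d) i, corner_edge K (g, d) j}"
proof -
  have "{..<cdim g} = {i, j}" using assms by auto
  then show ?thesis by (simp add: corner_simplex_def)
qed

end

locale cat0 = cube_cx K for K :: "('a, 'c) cube_structure" +
  assumes nonpositively_curved: "nonpositively_curved K"
    and simply_connected: "simply_connected_space (complex_topology K)"
begin

lemma corner_edge_inj:
  assumes "e \<in> cells K" "c \<in> cube_corners (cdim e)" "i < cdim e" "j < cdim e"
    "corner_edge K (e, c) i = corner_edge K (e, c) j"
  shows "i = j"
proof -
  have "simplicial_link K (chr e c)"
    using nonpositively_curved corner_vertex[OF assms(1,2)] unfolding nonpositively_curved_def by blast
  then have "inj_on (corner_edge K (e, c)) {..<cdim (fst (e, c))}"
    unfolding simplicial_link_def using assms(1,2) corners_at_chr[of e c "chr e c"] by blast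
  then show ?thesis using assms(3-5) by (auto dest: inj_onD)
qed

lemma corner_simplex_inj:
  assumes "e \<in> cells K" "c \<in> cube_corners (cdim e)" "f \<in> cells K" "d \<in> cube_corners (cdim f)"
    "chr e c = chr f d" "corner_simplex K (e, c) = corner_simplex K (f, d)"
  shows "e = f \<and> c = d"
proof -
  have "simplicial_link K (chr e c)"
    using nonpositively_curved corner_vertex[OF assms(1,2)] unfolding nonpositively_curved_def by blast
  then have "inj_on (corner_simplex K) (corners_at K (chr e c))"
    unfolding simplicial_link_def by blast
  from inj_onD[OF this assms(6)] show ?thesis using assms by (simp add: corners_at_chr)
qed

lemma esq_simplex:
  assumes "esq x a y b"
  shows "{x, y} \<in> corner_simplex K ` corners_at K (x 0)"
proof -
  obtain g d i j where g: "g \<in> cells K" "cdim g = 2" "d \<in> cube_corners (cdim g)" "i < 2" "j < 2" "i \<noteq> j"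
    "x = corner_edge K (g, d) i" "a = corner_edge K (g, flip d i) j"
    "y = corner_edge K (g, d) j" "b = corner_edge K (g, flip d j) i" using esq_square[OF assms] .
  have "(g, d) \<in> corners_at K (x 0)" using g(1,3) corner_edge_0[OF g(3)] g(7) by (simp add: corners_at_chr)
  moreover have "corner_simplex K (g, d) = {x, y}" using corner_simplex_square[OF g(2,4-6)] g(7,9) by simp
  ultimately show ?thesis by (metis image_eqI)
qed

text \<open>In a simplicial link the simplex with vertices \<open>x\<close> and \<open>y\<close>
  determines the square and its corner, and distinct directions give distinct edges.\<close>

lemma esq_unique:
  assumes "esq x a y b" "esq x a' y b'"
  shows "a = a' \<and> b = b'"
proof -
  obtain g d i j where g: "g \<in> cells K" "cdim g = 2" "d \<in> cube_corners (cdim g)" "i < 2" "j < 2" "i \<noteq> j"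
    "x = corner_edge K (g, d) i" "a = corner_edge K (g, flip d i) j"
    "y = corner_edge K (g, d) j" "b = corner_edge K (g, flip d j) i" using esq_square[OF assms(1)] .
  obtain g' d' i' j' where g': "g' \<in> cells K" "cdim g' = 2" "d' \<in> cube_corners (cdim g')" "i' < 2" "j' < 2" "i' \<noteq> j'"
    "x = corner_edge K (g', d') i'" "a' = corner_edge K (g', flip d' i') j'"
    "y = corner_edge K (g', d') j'" "b' = corner_edge K (g', flip d' j') i'" using esq_square[OF assms(2)] .
  have "chr g d = chr g' d'" using corner_edge_0[OF g(3)] corner_edge_0[OF g'(3)] g(7) g'(7) by metis
  moreover have "corner_simplex K (g, d) = corner_simplex K (g', d')"
    using corner_simplex_square[OF g(2,4-6)] corner_simplex_square[OF g'(2,4-6)] g(7,9) g'(7,9) by simp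
  ultimately have eq: "g' = g" "d' = d" using corner_simplex_inj[OF g(1,3) g'(1,3)] by auto
  have "i' = i" "j' = j"
    using corner_edge_inj[OF g(1,3), of i' i] corner_edge_inj[OF g(1,3), of j' j] g g' eq by simp_all
  then show ?thesis using g(8,10) g'(8,10) eq by simp
qed

lemma esqI:
  assumes "e \<in> cells K" "c \<in> cube_corners (cdim e)" "i < cdim e" "j < cdim e" "i \<noteq> j"
  shows "esq (corner_edge K (e, c) i) (corner_edge K (e, flip c i) j)
    (corner_edge K (e, c) j) (corner_edge K (e, flip c j) i)"
  unfolding esq_def using assms by blast

text \<open>The edges \<open>x\<close>, \<open>y\<close>, \<open>z\<close> are pairwise adjacent in
  the link, so flagness provides a cube corner with these edges. By uniqueness the given squares are
  its faces, and the remaining faces are the desired squares.\<close>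

lemma esq_cube:
  assumes "esq x yx y xy" "esq x zx z xz" "esq y zy z yz"
  shows "\<exists>zxy yxz xyz. esq yx zxy zx yxz \<and> esq xy zxy zy xyz \<and> esq xz yxz yz xyz"
proof -
  let ?S = "corner_simplex K ` corners_at K (x 0)"
  have src: "y 0 = x 0" "z 0 = x 0"
    using esq_square[OF assms(1)] esq_square[OF assms(2)] corner_edge_0 by metis+
  have s: "{x, y} \<in> ?S" "{x, z} \<in> ?S" "{y, z} \<in> ?S"
    using esq_simplex[OF assms(1)] esq_simplex[OF assms(2)] esq_simplex[OF assms(3)] src by auto
  have "x 0 \<in> vertices K"
    using esq_square[OF assms(1)] corner_edge_0 corner_vertex by metis
  then have fl: "flag ?S" using nonpositively_curved unfolding nonpositively_curved_def by blast
  have "{x, y, z} \<in> ?S"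
  proof -
    have "finite {x, y, z}" by simp
    moreover have "{x, y, z} \<subseteq> \<Union> ?S" using s by blast
    moreover have "\<forall>a\<in>{x, y, z}. \<forall>b\<in>{x, y, z}. a \<noteq> b \<longrightarrow> {a, b} \<in> ?S"
      using s by (auto simp: insert_commute)
    ultimately show ?thesis using fl[unfolded flag_def, THEN spec, of "{x, y, z}"] by blast
  qed
  then obtain e c where e: "e \<in> cells K" "c \<in> cube_corners (cdim e)" "corner_simplex K (e, c) = {x, y, z}"
    by (auto simp: corners_at_chr)
  have "x \<in> corner_edge K (e, c) ` {..<cdim e}" "y \<in> corner_edge K (e, c) ` {..<cdim e}"
    "z \<in> corner_edge K (e, c) ` {..<cdim e}" using e(3) by (auto simp: corner_simplex_def)
  then obtain i j k where i: "i < cdim e" "x = corner_edge K (e, c) i" and j: "j < cdim e" "y = corner_edge K (e, c) j"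
    and k: "k < cdim e" "z = corner_edge K (e, c) k" by auto
  have ne: "x \<noteq> y" "x \<noteq> z" "y \<noteq> z"
  proof -
    have *: "u \<noteq> v" if "esq u p v q" for u p v q
      using esq_square[OF that] corner_edge_inj by metis
    show "x \<noteq> y" "x \<noteq> z" "y \<noteq> z" using *[OF assms(1)] *[OF assms(2)] *[OF assms(3)] by auto
  qed
  then have ij: "i \<noteq> j" "i \<noteq> k" "j \<noteq> k" using i j k by auto
  have xy: "yx = corner_edge K (e, flip c i) j" "xy = corner_edge K (e, flip c j) i"
    using esq_unique[OF assms(1)] esqI[OF e(1,2) i(1) j(1) ij(1)] i j by auto
  have xz: "zx = corner_edge K (e, flip c i) k" "xz = corner_edge K (e, flip c k) i"
    using esq_unique[OF assms(2)] esqI[OF e(1,2) i(1) k(1) ij(2)] i k by auto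
  have yz: "zy = corner_edge K (e, flip c j) k" "yz = corner_edge K (e, flip c k) j"
    using esq_unique[OF assms(3)] esqI[OF e(1,2) j(1) k(1) ij(3)] j k by auto
  have f: "flip (flip c j) i = flip (flip c i) j" "flip (flip c k) i = flip (flip c i) k"
    "flip (flip c k) j = flip (flip c j) k"
    using flip_commute[of j i c] flip_commute[of k i c] flip_commute[of k j c] ij by metis+
  have "esq yx (corner_edge K (e, flip (flip c i) j) k) zx (corner_edge K (e, flip (flip c i) k) j)"
    unfolding xy xz using esqI[OF e(1) flip_in[OF e(2) i(1)] j(1) k(1) ij(3)] .
  moreover have "esq xy (corner_edge K (e, flip (flip c i) j) k) zy (corner_edge K (e, flip (flip c j) k) i)"
    using esqI[OF e(1) flip_in[OF e(2) j(1)] i(1) k(1) ij(2)] unfolding xy yz f .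
  moreover have "esq xz (corner_edge K (e, flip (flip c i) k) j) yz (corner_edge K (e, flip (flip c j) k) i)"
    using esqI[OF e(1) flip_in[OF e(2) k(1)] i(1) j(1) ij(1)] unfolding xz yz f .
  ultimately show ?thesis by blast
qed

lemma erev_in: "a \<in> edges \<Longrightarrow> erev a \<in> edges"
  by (erule edgesE) (simp add: erev_corner_edge edgesI flip_in)

lemma erev_erev: "erev (erev a) = a"
proof (cases "a \<in> edges")
  case True
  then obtain e c i where a: "e \<in> cells K" "c \<in> cube_corners (cdim e)" "i < cdim e" "a = corner_edge K (e, c) i"
    by (rule edgesE)
  show ?thesis using erev_corner_edge[OF a(1-3)] erev_corner_edge[OF a(1) flip_in[OF a(2,3)] a(3)] a(4)
    by (simp only: flip_flip)
qed (simp add: erev_def)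

sublocale square_complex edges "\<lambda>a. a 0" "\<lambda>a. a 1" erev esq
proof
  show "erev a \<in> edges" if "a \<in> edges" for a using erev_in that .
  show "erev (erev a) = a" for a by (rule erev_erev)
  show "erev a 0 = a 1" if "a \<in> edges" for a
  proof -
    obtain e c i where a: "e \<in> cells K" "c \<in> cube_corners (cdim e)" "i < cdim e" "a = corner_edge K (e, c) i"
      using \<open>a \<in> edges\<close> by (rule edgesE)
    show ?thesis using erev_corner_edge[OF a(1-3)] a(4) corner_edge_0[OF flip_in[OF a(2,3)]] corner_edge_1[OF a(2)]
      by simp
  qed
  show "esq x a y b \<Longrightarrow> esq x a' y b' \<Longrightarrow> a = a' \<and> b = b'" for x a y b a' b' using esq_unique .
  show "esq x yx y xy \<Longrightarrow> esq x zx z xz \<Longrightarrow> esq y zy z yz \<Longrightarrow>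
      \<exists>zxy yxz xyz. esq yx zxy zx yxz \<and> esq xy zxy zy xyz \<and> esq xz yxz yz xyz" for x yx y xy zx z xz zy yz
    using esq_cube .
  fix x a y b assume "esq x a y b"
  then obtain e c i j where e: "e \<in> cells K" "c \<in> cube_corners (cdim e)" "i < cdim e" "j < cdim e" "i \<noteq> j"
     "x = corner_edge K (e, c) i" "a = corner_edge K (e, flip c i) j"
     "y = corner_edge K (e, c) j" "b = corner_edge K (e, flip c j) i"
    unfolding esq_def by blast
  have ci: "flip c i \<in> cube_corners (cdim e)" and cj: "flip c j \<in> cube_corners (cdim e)"
    using flip_in e by auto
  show "x \<in> edges" "a \<in> edges" using edgesI e ci by auto
  show "x 0 = y 0" using corner_edge_0[OF e(2)] e by simp
  show "x 1 = a 0" using corner_edge_0[OF ci] corner_edge_1[OF e(2)] e by simp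
  show "a 1 = b 1" using corner_edge_1[OF ci] corner_edge_1[OF cj] e flip_commute[OF e(5), of c] by simp
  show "esq y b x a" unfolding e(6-9) using esqI[OF e(1,2) e(4,3)] e(5) by simp
  show "x \<noteq> y" using corner_edge_inj[OF e(1-4)] e(5-8) by auto
  have "esq (corner_edge K (e, flip c i) i) (corner_edge K (e, flip (flip c i) i) j)
    (corner_edge K (e, flip c i) j) (corner_edge K (e, flip (flip c i) j) i)"
    using esqI[OF e(1) ci e(3-5)] .
  then show "esq (erev x) y a (erev b)"
    using erev_corner_edge[OF e(1-3)] erev_corner_edge[OF e(1) cj e(3)] flip_commute[OF e(5), of c]
    unfolding flip_flip e(6-9) by simp
qed

lemma cube_corners_connected:
  assumes f: "f \<in> cells K" and c: "c \<in> cube_corners (cdim f)" "c' \<in> cube_corners (cdim f)"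
  shows "\<exists>p. path (chr f c) p (chr f c')"
  using c
proof (induction rule: corner_induct)
  case base
  have "path (chr f c) [] (chr f c)" by simp
  then show ?case by blast
next
  case (flip d i)
  then obtain p where p: "path (chr f c) p (chr f d)" by blast
  have "path (chr f c) (corner_edge K (f, d) i # p) (chr f (d(i := 1 - d i)))"
    using p edgesI[OF f flip(1,2)] corner_edge_0[OF flip(1)] corner_edge_1[OF flip(1)] by simp
  then show ?case by blast
qed

lemma vertices_eq: "u \<in> vertices K \<Longrightarrow> chr (pcell u) zero_corner = u"
  using pcell_corner(2) zero_corner_in unfolding vertices_def by auto

lemma vertices_points: "u \<in> vertices K \<Longrightarrow> u \<in> points K"
  unfolding vertices_def using chr_points cube_corners_unit[OF zero_corner_in] by auto

text \<open>The points whose base vertex can be reached from \<open>u\<close> contain each closed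
  cube entirely or not at all. In the weak topology they are therefore open and closed, and the
  space is connected.\<close>

lemma vertices_connected:
  assumes u: "u \<in> vertices K" and v: "v \<in> vertices K"
  shows "\<exists>p. path u p v"
proof -
  let ?X = "complex_topology K"
  have tp: "topspace ?X = points K" using topspace_complex_topology[OF cube_complex] .
  define C where "C = {k \<in> points K. \<exists>p. path u p (chr (pcell k) zero_corner)}"
  have iff: "chr e y \<in> C \<longleftrightarrow> (\<exists>p. path u p (chr e zero_corner))"
    if e: "e \<in> cells K" and y: "y \<in> unit_cube (cdim e)" for e y
  proof -
    let ?z = "zero_vertex e y"
    have z: "?z \<in> cube_corners (cdim e)" using zero_vertex_corner[OF e y] .
    have "chr (pcell (chr e y)) zero_corner = chr e ?z" using chr_zero_vertex[OF e y] by simp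
    moreover have "(\<exists>p. path u p (chr e ?z)) \<longleftrightarrow> (\<exists>p. path u p (chr e zero_corner))"
      using cube_corners_connected[OF e z zero_corner_in] cube_corners_connected[OF e zero_corner_in z]
        path_append by blast
    ultimately show ?thesis using chr_points[OF e y] by (simp add: C_def)
  qed
  have cases: "{y \<in> unit_cube (cdim e). chr e y \<in> C} = {} \<or> {y \<in> unit_cube (cdim e). chr e y \<in> C} = unit_cube (cdim e)"
    if "e \<in> cells K" for e using iff[OF that] by blast
  have full: "openin (cube_topology n) (unit_cube n)" for n
    using openin_topspace[of "cube_topology n"] by (simp add: topspace_cube_topology)
  have "openin ?X C" unfolding openin_complex_topology
  proof (intro conjI ballI)
    fix e assume e: "e \<in> cells K"
    show "openin (cube_topology (cdim e)) {y \<in> unit_cube (cdim e). chr e y \<in> C}"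
      using cases[OF e] by (elim disjE) (simp_all only: openin_empty full)
  qed (auto simp: C_def)
  moreover have "openin ?X (points K - C)" unfolding openin_complex_topology
  proof (intro conjI ballI)
    fix e assume e: "e \<in> cells K"
    have "{y \<in> unit_cube (cdim e). chr e y \<in> points K - C} = unit_cube (cdim e) - {y \<in> unit_cube (cdim e). chr e y \<in> C}"
      using chr_points[OF e] by blast
    then show "openin (cube_topology (cdim e)) {y \<in> unit_cube (cdim e). chr e y \<in> points K - C}"
      using cases[OF e] by (elim disjE) (simp_all only: openin_empty full Diff_cancel Diff_empty)
  qed auto
  then have "closedin ?X C" unfolding closedin_def tp by (auto simp: C_def)
  moreover have "connected_space ?X"
    using simply_connected path_connected_imp_connected_space unfolding simply_connected_space_def by blast
  ultimately have "C = {} \<or> C = points K" unfolding connected_space_clopen_in tp by blast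
  moreover have "u \<in> C"
  proof -
    have "path u [] u" by simp
    then have "\<exists>p. path u p u" by blast
    then show ?thesis using vertices_points[OF u] vertices_eq[OF u] by (simp add: C_def)
  qed
  ultimately have "v \<in> C" using vertices_points[OF v] by blast
  then show ?thesis using vertices_eq[OF v] by (simp add: C_def)
qed

lemma vertices_nonempty: "vertices K \<noteq> {}"
proof -
  have "points K \<noteq> {}"
    using simply_connected topspace_complex_topology[OF cube_complex] unfolding simply_connected_space_def by simp
  then obtain k where "k \<in> points K" by blast
  then show ?thesis using corner_vertex[OF pcell(1) zero_corner_in] by blast
qed

lemma edge_src_vertex: "a \<in> edges \<Longrightarrow> a 0 \<in> vertices K"
  by (erule edgesE) (simp add: corner_edge_0 corner_vertex)

end

section \<open>Triviality of monodromy\<close>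

locale cat0_local_system = cat0 K + cube_local_system K N act
  for K :: "('a, 'c) cube_structure" and N :: "'a \<Rightarrow> 's set" and act
begin

lemma fibre_vertex: "u \<in> vertices K \<Longrightarrow> fibre u = N u"
  by (simp add: fibre_def vertices_eq)

text \<open>Realises algebraic transport along an edge path as the end value of a lift of an actual
  path, to which the homotopy lifting applies.\<close>

lemma lift_path:
  assumes u: "u \<in> vertices K" and P: "P \<in> N u"
  shows "path u p v \<Longrightarrow> foldr (\<lambda>a P. act P a) p P \<in> N v \<and> (\<exists>\<gamma> s. pathin (complex_topology K) \<gamma> \<and>
    \<gamma> 0 = u \<and> \<gamma> 1 = v \<and> LS.lift \<gamma> s 0 1 \<and> s 0 = P \<and> s 1 = foldr (\<lambda>a P. act P a) p P)"
proof (induction p arbitrary: v)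
  case Nil
  have up: "u \<in> topspace (complex_topology K)"
    using vertices_points[OF u] topspace_complex_topology[OF cube_complex] by simp
  have Pf: "P \<in> fibre u" using P fibre_vertex[OF u] by simp
  have "LS.lift (\<lambda>_. u) (\<lambda>_. P) 0 1" unfolding LS.lift_def
    using LS.U_self[OF up] LS.tr_self[OF up Pf] Pf by (intro ballI conjI exI[of _ 1]) simp_all
  then show ?case using Nil P up by (intro conjI exI[of _ "\<lambda>_. u"] exI[of _ "\<lambda>_. P"]) auto
next
  case (Cons a p)
  then have a: "a \<in> edges" "a 1 = v" "path u p (a 0)" by auto
  obtain \<gamma> s where IH: "pathin (complex_topology K) \<gamma>" "\<gamma> 0 = u" "\<gamma> 1 = a 0" "LS.lift \<gamma> s 0 1" "s 0 = P"
    "s 1 = foldr (\<lambda>a P. act P a) p P" "foldr (\<lambda>a P. act P a) p P \<in> N (a 0)" using Cons.IH[OF a(3)] by blast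
  obtain e c i where e: "e \<in> cells K" "c \<in> cube_corners (cdim e)" "i < cdim e" "a = corner_edge K (e, c) i"
    using a(1) by (rule edgesE)
  have "s 1 \<in> N (chr e c)" using IH(6,7) e(4) corner_edge_0[OF e(2)] by simp
  then obtain r where r: "LS.lift a r 0 1" "r 0 = s 1" "r 1 = act (s 1) a"
    using lift_corner_edge[OF e(1-3), of "s 1"] e(4) by blast
  obtain q where q: "LS.lift (\<lambda>t. if t \<le> 1/2 then \<gamma> (2 * t) else a (2 * t - 1)) q 0 1" "q 0 = s 0" "q 1 = r 1"
    using LS.lift_join[OF IH(4) r(1) IH(3)] r(2) by auto
  have "pathin (complex_topology K) (\<lambda>t. if t \<le> 1/2 then \<gamma> (2 * t) else a (2 * t - 1))"
    using pathin_join[where g = \<gamma> and h = a, OF IH(1) _ IH(3)] pathin_corner_edge[OF e(1-3)] e(4) by blast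
  moreover have "act (foldr (\<lambda>a P. act P a) p P) a \<in> N v" using act_in[OF a(1) IH(7)] a(2) by simp
  ultimately show ?case using q r IH a(2)
    by (intro conjI exI[of _ "\<lambda>t. if t \<le> 1/2 then \<gamma> (2 * t) else a (2 * t - 1)"] exI[of _ q]) auto
qed

lemma loop_monodromy:
  assumes "u \<in> vertices K" "P \<in> N u" "path u p u"
  shows "foldr (\<lambda>a P. act P a) p P = P"
proof -
  obtain \<gamma> s where "pathin (complex_topology K) \<gamma>" "\<gamma> 0 = u" "\<gamma> 1 = u" "LS.lift \<gamma> s 0 1" "s 0 = P"
    "s 1 = foldr (\<lambda>a P. act P a) p P" using lift_path[OF assms] by blast
  then show ?thesis using LS.lift_null_homotopic[OF simply_connected, of \<gamma> s] by simp
qed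

lemma act_back:
  "path u q v \<Longrightarrow> X \<in> N v \<Longrightarrow>
    foldr (\<lambda>a P. act P a) q (foldr (\<lambda>a P. act P a) (rev (map erev q)) X) = X"
proof (induction q arbitrary: v X)
  case (Cons a q)
  then have a: "a \<in> edges" "a 1 = v" "path u q (a 0)" by auto
  have X: "X \<in> N (erev a 0)" using Cons.prems a src_rev by simp
  have "act X (erev a) \<in> N (a 0)" using act_in[OF erev_in[OF a(1)] X] tgt_rev[OF a(1)] by simp
  from Cons.IH[OF a(3) this] show ?case
    using act_rev[OF erev_in[OF a(1)] X] by (simp add: erev_erev)
qed simp

lemma trivial_monodromy:
  assumes u: "u \<in> vertices K" and P: "P \<in> N u" and pq: "path u p v" "path u q v"
  shows "foldr (\<lambda>a P. act P a) p P = foldr (\<lambda>a P. act P a) q P"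
proof -
  have "path u (rev (map erev q) @ p) u" using path_append[OF pq(1) path_rev[OF pq(2)]] .
  from loop_monodromy[OF u P this]
  have "foldr (\<lambda>a P. act P a) (rev (map erev q)) (foldr (\<lambda>a P. act P a) p P) = P" by simp
  then show ?thesis using act_back[OF pq(2), of "foldr (\<lambda>a P. act P a) p P"] lift_path[OF u P pq(1)] by simp
qed

end

context cat0
begin

sublocale simply_connected_square_complex edges "\<lambda>a. a 0" "\<lambda>a. a 1" erev esq "vertices K"
proof
  show "a \<in> edges \<Longrightarrow> a 0 \<in> vertices K" for a by (rule edge_src_vertex)
  show "u \<in> vertices K \<Longrightarrow> v \<in> vertices K \<Longrightarrow> \<exists>p. path u p v" for u v by (rule vertices_connected)
  fix N :: "'a \<Rightarrow> (real \<Rightarrow> 'a) list set set" and act p q u v P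
  assume act: "\<And>a P. a \<in> edges \<Longrightarrow> P \<in> N (a 0) \<Longrightarrow> act P a \<in> N (a 1)"
    "\<And>a P. a \<in> edges \<Longrightarrow> P \<in> N (a 0) \<Longrightarrow> act (act P a) (erev a) = P"
    "\<And>x a y b P. esq x a y b \<Longrightarrow> P \<in> N (x 0) \<Longrightarrow> act (act P x) a = act (act P y) b"
    and uv: "u \<in> vertices K" "path u p v" "path u q v" "P \<in> N u"
  interpret cat0_local_system K N act
    by unfold_locales (fact act)+
  show "foldr (\<lambda>a P. act P a) p P = foldr (\<lambda>a P. act P a) q P"
    using trivial_monodromy uv by blast
qed

section \<open>Walls of the complex and the action on them\<close>

sublocale M: median_graph "vertices K" adj gdist
  by (rule median_graph)

sublocale W: wall_space "vertices K" M.halfspaces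
  by (rule M.wall_space)

lemma automorphism_edge:
  assumes \<psi>: "cubical_automorphism K \<psi>"
  shows "u \<in> vertices K \<Longrightarrow> \<psi> u \<in> vertices K" and "adj u v \<Longrightarrow> adj (\<psi> u) (\<psi> v)"
proof -
  have *: "\<exists>f h \<sigma>. f \<in> cells K \<and> (\<exists>b. face_map (cdim e) (cdim f) \<sigma> b h) \<and>
      (\<forall>y\<in>unit_cube (cdim e). \<psi> (chr e y) = chr f (h y))" if e: "e \<in> cells K" for e
  proof -
    obtain f h where f: "f \<in> cells K" "cube_isometry (cdim e) (unit_cube (cdim e)) (cdim f) (unit_cube (cdim f)) h"
      "\<forall>y\<in>unit_cube (cdim e). \<psi> (chr e y) = chr f (h y)"
      using \<psi> e unfolding cubical_automorphism_def by blast
    \<comment> \<open>The whole cube is the face with no frozen coordinate, so the description of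
      isometries onto faces covers automorphisms.\<close>
    have "unit_cube (cdim f) = {x \<in> unit_cube (cdim f). \<forall>i\<in>{}. x i = zero_corner i}" by simp
    from cube_isometry_face_map[OF f(2) this empty_subsetI] obtain \<sigma> b
      where "face_map (cdim e) (cdim f) \<sigma> b h" by (metis Pi_I empty_iff)
    then show ?thesis using f by blast
  qed
  have corner: "\<psi> (chr e c) \<in> vertices K" if e: "e \<in> cells K" "c \<in> cube_corners (cdim e)" for e c
  proof -
    obtain f h \<sigma> b where f: "f \<in> cells K" "face_map (cdim e) (cdim f) \<sigma> b h"
      "\<forall>y\<in>unit_cube (cdim e). \<psi> (chr e y) = chr f (h y)" using *[OF e(1)] by blast
    then show ?thesis using corner_vertex[OF f(1) face_map_corner[OF f(2) e(2)]] cube_corners_unit[OF e(2)]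
      by simp
  qed
  show "\<psi> u \<in> vertices K" if "u \<in> vertices K"
    using that corner zero_corner_in unfolding vertices_def by auto
  show "adj (\<psi> u) (\<psi> v)" if uv: "adj u v"
  proof -
    obtain a where a: "a \<in> edges" "a 0 = u" "a 1 = v" using uv unfolding adj_def by blast
    obtain e c i where e: "e \<in> cells K" "c \<in> cube_corners (cdim e)" "i < cdim e" "a = corner_edge K (e, c) i"
      using a(1) by (rule edgesE)
    obtain f h \<sigma> b where f: "f \<in> cells K" "face_map (cdim e) (cdim f) \<sigma> b h"
      "\<forall>y\<in>unit_cube (cdim e). \<psi> (chr e y) = chr f (h y)" using *[OF e(1)] by blast
    have hc: "h c \<in> cube_corners (cdim f)" using face_map_corner[OF f(2) e(2)] .
    let ?b = "corner_edge K (f, h c) (\<sigma> i)"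
    have "?b \<in> edges" using edgesI[OF f(1) hc face_mapD(2)[OF f(2) e(3)]] .
    moreover have "?b 0 = \<psi> u"
      using corner_edge_0[OF hc] corner_edge_0[OF e(2)] a e(4) f(3) cube_corners_unit[OF e(2)] by metis
    moreover have "?b 1 = \<psi> v"
    proof -
      have "?b 1 = chr f (h (flip c i))"
        using corner_edge_1[OF hc] face_map_flip[OF f(2) e(2,3)] by (simp only:)
      also have "\<dots> = \<psi> (chr e (flip c i))"
        by (rule bspec[OF f(3) cube_corners_unit[OF flip_in[OF e(2,3)]], symmetric])
      also have "chr e (flip c i) = v" using corner_edge_1[OF e(2), of e i] a(3) e(4) by simp
      finally show ?thesis .
    qed
    ultimately show ?thesis unfolding adj_def by blast
  qed
qed

lemma automorphism_gdist_le:
  assumes \<psi>: "cubical_automorphism K \<psi>" and u: "u \<in> vertices K"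
  shows "v \<in> vertices K \<Longrightarrow> gdist (\<psi> u) (\<psi> v) \<le> gdist u v"
proof (induction "gdist u v" arbitrary: v)
  case 0
  then have "u = v" using gdist_eq_0[OF u] by simp
  then show ?case using gdist_eq_0[of "\<psi> v" "\<psi> v"] automorphism_edge(1)[OF \<psi> u] by simp
next
  case (Suc n)
  then have "u \<noteq> v" using gdist_eq_0[OF u u] by auto
  then obtain w where w: "adj w v" "gdist u v = gdist u w + 1" using gdist_neighbour[OF u Suc(3)] by blast
  have wV: "w \<in> vertices K" using adj_in(1)[OF w(1)] .
  have "gdist (\<psi> u) (\<psi> v) \<le> gdist (\<psi> u) (\<psi> w) + gdist (\<psi> w) (\<psi> v)"
    using gdist_triangle automorphism_edge(1)[OF \<psi>] u wV Suc(3) by blast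
  moreover have "gdist (\<psi> w) (\<psi> v) = 1" using gdist_adj automorphism_edge(2)[OF \<psi> w(1)] by blast
  moreover have "gdist (\<psi> u) (\<psi> w) \<le> gdist u w" using Suc(1)[of w] Suc(2) w wV by simp
  ultimately show ?case using w by simp
qed

end

theorem corollary1p6:
  fixes G :: "('g, 'm) monoid_scheme"
    and K :: "('a, 'c) cube_structure"
    and \<phi> :: "'g \<Rightarrow> 'a \<Rightarrow> 'a"
  assumes "polycyclic G"
    and "CAT0_cube_complex K"
    and "cubical_action G K \<phi>"
    and "proper_action G (complex_topology K) \<phi>"
  shows "virtually_free_abelian G"
proof -
  interpret cat0 K
    using assms(2) unfolding CAT0_cube_complex_def by unfold_locales auto
  interpret A: group_action G "points K" \<phi> using assms(3) unfolding cubical_action_def by blast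
  interpret G: group G using assms(1) unfolding polycyclic_def by blast
  have aut: "cubical_automorphism K (\<phi> g)" if "g \<in> carrier G" for g
    using assms(3) that unfolding cubical_action_def by blast
  have mult: "\<phi> (g \<otimes>\<^bsub>G\<^esub> k) y = \<phi> g (\<phi> k y)" if "g \<in> carrier G" "k \<in> carrier G" "y \<in> vertices K" for g k y
    using A.composition_rule[OF vertices_points[OF that(3)] that(1,2)] .
  have one: "\<phi> \<one>\<^bsub>G\<^esub> y = y" if "y \<in> vertices K" for y
    using A.id_eq_one vertices_points[OF that] by (metis restrict_apply')
  have inv: "\<phi> g (\<phi> (inv\<^bsub>G\<^esub> g) y) = y" "\<phi> (inv\<^bsub>G\<^esub> g) (\<phi> g y) = y" if "g \<in> carrier G" "y \<in> vertices K" for g y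
    using mult[of g "inv\<^bsub>G\<^esub> g" y] mult[of "inv\<^bsub>G\<^esub> g" g y] one that by auto
  have V: "\<phi> g y \<in> vertices K" if "g \<in> carrier G" "y \<in> vertices K" for g y
    using automorphism_edge(1)[OF aut] that by blast
  have dist: "gdist (\<phi> g x) (\<phi> g y) = gdist x y" if "g \<in> carrier G" "x \<in> vertices K" "y \<in> vertices K" for g x y
  proof (rule antisym)
    show "gdist (\<phi> g x) (\<phi> g y) \<le> gdist x y" using automorphism_gdist_le aut that by blast
    show "gdist x y \<le> gdist (\<phi> g x) (\<phi> g y)"
      using automorphism_gdist_le[OF aut[of "inv\<^bsub>G\<^esub> g"], of "\<phi> g x" "\<phi> g y"] that V inv by simp
  qed
  interpret WA: wall_action "vertices K" M.halfspaces G \<phi>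
  proof
    show "\<phi> g ` h \<in> M.halfspaces" if g: "g \<in> carrier G" and h: "h \<in> M.halfspaces" for g h
    proof -
      obtain u v where uv: "adj u v" "h = M.halfspace u v" using h unfolding M.halfspaces_def by blast
      have uV: "u \<in> vertices K" "v \<in> vertices K" using adj_in[OF uv(1)] by auto
      have "\<phi> g ` h = M.halfspace (\<phi> g u) (\<phi> g v)"
      proof
        show "\<phi> g ` h \<subseteq> M.halfspace (\<phi> g u) (\<phi> g v)"
          unfolding uv(2) M.halfspace_def using dist[OF g] V[OF g] uV by auto
        show "M.halfspace (\<phi> g u) (\<phi> g v) \<subseteq> \<phi> g ` h"
        proof
          fix z assume z: "z \<in> M.halfspace (\<phi> g u) (\<phi> g v)"
          then have zV: "z \<in> vertices K" by (simp add: M.halfspace_def)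
          define y where "y = \<phi> (inv\<^bsub>G\<^esub> g) z"
          have y: "y \<in> vertices K" "\<phi> g y = z" using V[of "inv\<^bsub>G\<^esub> g" z] inv[OF g zV] zV g by (auto simp: y_def)
          then have "y \<in> h" using z dist[OF g y(1)] uV by (simp add: uv(2) M.halfspace_def)
          then show "z \<in> \<phi> g ` h" using y(2) by blast
        qed
      qed
      then show ?thesis using automorphism_edge(2)[OF aut[OF g] uv(1)] unfolding M.halfspaces_def by blast
    qed
    show "finite {g \<in> carrier G. \<phi> g y = y}" if "y \<in> vertices K" for y
      using proper_action_finite_stabilizer[OF assms(4), of y] vertices_points[OF that]
        topspace_complex_topology[OF cube_complex] by (simp add: stabilizer_def)
  qed (use V mult one in auto)
  obtain x where x: "x \<in> vertices K" using vertices_nonempty by blast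
  interpret NL: noetherian_length_group G "WA.wlength x"
  proof
    show "WA.wlength x (g \<otimes>\<^bsub>G\<^esub> k) \<le> WA.wlength x g + WA.wlength x k"
      if "g \<in> carrier G" "k \<in> carrier G" for g k using WA.wlength_mult[OF x that] .
    show "WA.wlength x (inv\<^bsub>G\<^esub> g) = WA.wlength x g" if "g \<in> carrier G" for g
      using WA.wlength_inv[OF x that] .
    show "n \<le> WA.wlength x (g [^]\<^bsub>G\<^esub> n)" if "g \<in> carrier G" "\<And>n::nat. n > 0 \<Longrightarrow> g [^]\<^bsub>G\<^esub> n \<noteq> \<one>\<^bsub>G\<^esub>"
      for g and n :: nat using WA.wlength_pow[OF x that] .
    show "\<exists>S. finite S \<and> S \<subseteq> carrier G \<and> generate G S = H" if "subgroup H G" for H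
      using assms(1) that unfolding polycyclic_def by blast
  qed
  show ?thesis
    using NL.solvable_virtually_free_abelian assms(1) unfolding polycyclic_def by blast
qed

end
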